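(* Let $X=X(\mathbb{T})$ be a reflexive translation-invariant Banach function space on $\mathbb{T}$, and let $w$ be a measurable function on $\mathbb{T}$ with $0<w<\infty$ a.e. such that $w\in X$ and $\frac1w\in X'$. Suppose the Riesz projection is bounded on $X(w)$ and let $a\in(C+H^\infty)(\mathbb{T})$. Then the Toeplitz operator $T(a):H[X(w)]\to H[X(w)]$ satisfies $$\|a\|_{L^\infty} = \|T(a)\|_m \le \|T(a)\|_{\mathrm{e}} \le 2\,\|a\|_{L^\infty}.$$
   Context: $\mathbb{T}$ is the unit circle. $L^0$ is the set of measurable complex-valued functions on $\mathbb{T}$ and $L^0_+$ the set of measurable functions on $\mathbb{T}$ with values in $[0,\infty]$. A map $\rho:L^0_+\to[0,\infty]$ is a Banach function norm if for all $f,g,f_n\in L^0_+$ ($n\in\mathbb{N}$) and constants $c\ge0$: (A1) $\rho(f)=0\Leftrightarrow f=0$ a.e., $\rho(cf)=c\rho(f)$, $\rho(f+g)\le\rho(f)+\rho(g)$; (A2) $0\le g\le f$ a.e. implies $\rho(g)\le\rho(f)$; (A3) $0\le f_n\uparrow f$ a.e. implies $\rho(f_n)\uparrow\rho(f)$; (A4) $\rho(1)<\infty$; (A5) $\int_{-\pi}^{\pi} f(e^{i\theta})\,d\theta\le C\rho(f)$ with a constant $C\in(0,\infty)$ independent of $f$. The corresponding Banach function space is $X=\{f\in L^0:\rho(|f|)<\infty\}$ (functions equal a.e. identified) with norm $\|f\|_X=\rho(|f|)$; it is a Banach space. The associate norm is $\rho'(g)=\sup\{\int_{-\pi}^{\pi}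 f(e^{i\theta})g(e^{i\theta})\,d\theta: f\in L^0_+,\ \rho(f)\le1\}$, $g\in L^0_+$; it is a Banach function norm, and the associate space $X'$ is the Banach function space it determines. $X$ is translation-invariant if $\|\tau_\vartheta f\|_X=\|f\|_X$ for every $\vartheta\in[-\pi,\pi]$ and $f\in X$, where $(\tau_\vartheta f)(e^{i\theta})=f(e^{i\theta-i\vartheta})$. For a weight $w$ as in the claim, $X(w)$ is the set of measurable $g$ with $\|g\|_{X(w)}:=\|wg\|_X<\infty$; it is a Banach function space. For a Banach function space $Z$ (contained in $L^1(\mathbb{T})$ by (A5)), $H[Z]=\{f\in Z:\widehat f(k)=0\text{ for all }k<0\}$ with the norm of $Z$, where $\widehat f(k)=\frac1{2\pi}\int_{-\pi}^{\pi} f(e^{i\theta})e^{-ik\theta}\,d\theta$. The Riesz projection $P$ sends $f$ to the function with Fourier coefficients $\widehat f(k)$ for $k\ge0$ and $0$ for $k<0$; it is bounded on $Z$ if for every $f\in Z$ such a function $Pf$ exists in $Z$ and $\|Pf\|_Z\le C\|f\|_Z$ with $C$ independent of $f$. In that case, for $a\in L^\infty(\mathbb{T})$, the Toeplitz operator $T(a):H[Z]\to H[Z]$ is $T(a)f=P(af)$. $(C+H^\infty)(\mathbb{T})=\{f+g: f\in C(\mathbb{T}),\ g\in H^\infty(\mathbb{T})\}$, where $H^\infty(\mathbb{T})=\{f\in L^\infty(\mathbb{T}):\widehat f(k)=0\text{ for all }k<0\}$. For a bounded linear operator $A:E\to F$ between Banach spaces: $\|A\|_{\mathrm{e}}=\inf\{\|A-K\|:K:E\to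 F\text{ compact linear}\}$, and $\|A\|_m=\inf\|A|_M\|$, the infimum being over closed linear subspaces $M\subseteq E$ with $\dim(E/M)<\infty$. *)

theory Defs
  imports "HOL-Probability.Essential_Supremum"
begin

section \<open>The unit circle\<close>

text \<open>Lebesgue measure \<open>d\<theta>\<close> on the unit circle (total mass \<open>2\<pi>\<close>). The completion makes
  \<open>borel_measurable circle\<close> the Lebesgue measurable functions. Functions on the circle are
  functions on \<open>complex\<close> of which only the values on the circle matter. Instead of passing to
  classes modulo equality a.e., every notion below is invariant under changes on null sets.\<close>

definition circle :: "complex measure" where
  "circle = completion (distr (restrict_space lborel {-pi..pi}) (restrict_space borel (sphere 0 1)) cis)"

lemma space_circle: "space circle = sphere 0 1"
  by (simp add: circle_def space_restrict_space)

lemma nn_integral_circle: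
  assumes "f \<in> borel_measurable borel"
  shows "(\<integral>\<^sup>+ z. f z \<partial>circle) = (\<integral>\<^sup>+ \<theta>\<in>{-pi..pi}. f (cis \<theta>) \<partial>lborel)"
proof -
  have c: "cis \<in> borel_measurable borel"
    by (intro borel_measurable_continuous_onI continuous_intros)
  have "cis \<in> restrict_space lborel {-pi..pi} \<rightarrow>\<^sub>M borel" 
    by (rule measurable_restrict_space1) (simp add: c)
  then have m: "cis \<in> restrict_space lborel {-pi..pi} \<rightarrow>\<^sub>M restrict_space borel (sphere 0 1)"
    by (rule measurable_restrict_space2[rotated]) auto
  have f: "f \<in> borel_measurable (restrict_space borel (sphere 0 1))"
    using assms by (rule measurable_restrict_space1)
  have "(\<integral>\<^sup>+ z. f z \<partial>circle) = (\<integral>\<^sup>+ \<theta>. f (cis \<theta>) \<partial>restrict_space lborel {-pi..pi})"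
    unfolding circle_def nn_integral_completion by (subst nn_integral_distr[OF m]) (use f in simp_all)
  also have "\<dots> = (\<integral>\<^sup>+ \<theta>\<in>{-pi..pi}. f (cis \<theta>) \<partial>lborel)"
    by (rule nn_integral_restrict_space) simp
  finally show ?thesis .
qed

definition fourier_coeff :: "(complex \<Rightarrow> complex) \<Rightarrow> int \<Rightarrow> complex" where
  "fourier_coeff f k = 1 / (2 * pi) * (\<integral>z. f z * z powi (- k) \<partial>circle)"

definition Linf_norm :: "(complex \<Rightarrow> complex) \<Rightarrow> ennreal" where
  "Linf_norm f = esssup circle (\<lambda>z. ennreal (cmod (f z)))"

definition Linf :: "(complex \<Rightarrow> complex) set" where
  "Linf = {f \<in> borel_measurable circle. Linf_norm f < \<infinity>}"

definition Hinf :: "(complex \<Rightarrow> complex) set" where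
  "Hinf = {f \<in> Linf. \<forall>k<0. fourier_coeff f k = 0}"

definition C_plus_Hinf :: "(complex \<Rightarrow> complex) set" where
  "C_plus_Hinf = {a \<in> borel_measurable circle.
     \<exists>f g. continuous_on (sphere 0 1) f \<and> g \<in> Hinf \<and> (AE z in circle. a z = f z + g z)}"

section \<open>Banach function spaces\<close>

locale banach_function_norm =
  fixes \<rho> :: "(complex \<Rightarrow> ennreal) \<Rightarrow> ennreal"
  assumes eq_0_iff: "f \<in> borel_measurable circle \<Longrightarrow> \<rho> f = 0 \<longleftrightarrow> (AE z in circle. f z = 0)"
    and scale: "\<lbrakk>f \<in> borel_measurable circle; 0 \<le> c\<rbrakk> \<Longrightarrow>
      \<rho> (\<lambda>z. ennreal c * f z) = ennreal c * \<rho> f"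
    and triangle: "\<lbrakk>f \<in> borel_measurable circle; g \<in> borel_measurable circle\<rbrakk> \<Longrightarrow>
      \<rho> (\<lambda>z. f z + g z) \<le> \<rho> f + \<rho> g"
    and mono: "\<lbrakk>f \<in> borel_measurable circle; g \<in> borel_measurable circle;
      AE z in circle. g z \<le> f z\<rbrakk> \<Longrightarrow> \<rho> g \<le> \<rho> f"
    and fatou: "\<lbrakk>\<And>n::nat. F n \<in> borel_measurable circle; f \<in> borel_measurable circle;
      AE z in circle. incseq (\<lambda>n. F n z) \<and> (\<lambda>n. F n z) \<longlonglongrightarrow> f z\<rbrakk> \<Longrightarrow>
      incseq (\<lambda>n. \<rho> (F n)) \<and> (\<lambda>n. \<rho> (F n)) \<longlonglongrightarrow> \<rho> f"
    and one_finite: "\<rho> (\<lambda>_. 1) < \<infinity>"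
    and L1_embedding: "\<exists>C::real. 0 < C \<and>
      (\<forall>f\<in>borel_measurable circle. (\<integral>\<^sup>+ z. f z \<partial>circle) \<le> ennreal C * \<rho> f)"

definition assoc_norm :: "((complex \<Rightarrow> ennreal) \<Rightarrow> ennreal) \<Rightarrow> (complex \<Rightarrow> ennreal) \<Rightarrow> ennreal" where
  "assoc_norm \<rho> g = (SUP f\<in>{f \<in> borel_measurable circle. \<rho> f \<le> 1}. \<integral>\<^sup>+ z. f z * g z \<partial>circle)"

definition bfs_norm :: "((complex \<Rightarrow> ennreal) \<Rightarrow> ennreal) \<Rightarrow> (complex \<Rightarrow> complex) \<Rightarrow> ennreal" where
  "bfs_norm \<rho> f = \<rho> (\<lambda>z. ennreal (cmod (f z)))"

definition bfs :: "((complex \<Rightarrow> ennreal) \<Rightarrow> ennreal) \<Rightarrow> (complex \<Rightarrow> complex) set" where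
  "bfs \<rho> = {f \<in> borel_measurable circle. bfs_norm \<rho> f < \<infinity>}"

definition translate :: "real \<Rightarrow> (complex \<Rightarrow> complex) \<Rightarrow> (complex \<Rightarrow> complex)" where
  "translate \<theta> f = (\<lambda>z. f (z * cis (- \<theta>)))"

definition translation_invariant :: "((complex \<Rightarrow> ennreal) \<Rightarrow> ennreal) \<Rightarrow> bool" where
  "translation_invariant \<rho> \<longleftrightarrow>
     (\<forall>\<theta>\<in>{-pi..pi}. \<forall>f\<in>bfs \<rho>. bfs_norm \<rho> (translate \<theta> f) = bfs_norm \<rho> f)"

text \<open>The space \<open>X(w)\<close> is \<open>bfs (weighted \<rho> w)\<close>, since \<open>\<bar>w g\<bar> = \<bar>w\<bar> \<bar>g\<bar>\<close>.\<close>

definition weighted ::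
  "((complex \<Rightarrow> ennreal) \<Rightarrow> ennreal) \<Rightarrow> (complex \<Rightarrow> real) \<Rightarrow> (complex \<Rightarrow> ennreal) \<Rightarrow> ennreal" where
  "weighted \<rho> w f = \<rho> (\<lambda>z. ennreal \<bar>w z\<bar> * f z)"

definition hardy :: "((complex \<Rightarrow> ennreal) \<Rightarrow> ennreal) \<Rightarrow> (complex \<Rightarrow> complex) set" where
  "hardy \<rho> = {f \<in> bfs \<rho>. \<forall>k<0. fourier_coeff f k = 0}"

definition is_riesz_projection ::
  "((complex \<Rightarrow> ennreal) \<Rightarrow> ennreal) \<Rightarrow> (complex \<Rightarrow> complex) \<Rightarrow> (complex \<Rightarrow> complex) \<Rightarrow> bool" where
  "is_riesz_projection \<rho> f g \<longleftrightarrow> g \<in> bfs \<rho> \<and>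
     (\<forall>k. fourier_coeff g k = (if 0 \<le> k then fourier_coeff f k else 0))"

definition riesz_bounded :: "((complex \<Rightarrow> ennreal) \<Rightarrow> ennreal) \<Rightarrow> bool" where
  "riesz_bounded \<rho> \<longleftrightarrow> (\<exists>C::real. \<forall>f\<in>bfs \<rho>. \<exists>g. is_riesz_projection \<rho> f g \<and>
     bfs_norm \<rho> g \<le> ennreal C * bfs_norm \<rho> f)"

text \<open>Fourier coefficients determine an integrable function a.e., so the choice only selects
  a representative.\<close>

definition riesz_projection ::
  "((complex \<Rightarrow> ennreal) \<Rightarrow> ennreal) \<Rightarrow> (complex \<Rightarrow> complex) \<Rightarrow> (complex \<Rightarrow> complex)" where
  "riesz_projection \<rho> f = (SOME g. is_riesz_projection \<rho> f g)"

definition toeplitz ::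
  "((complex \<Rightarrow> ennreal) \<Rightarrow> ennreal) \<Rightarrow> (complex \<Rightarrow> complex) \<Rightarrow> (complex \<Rightarrow> complex) \<Rightarrow> (complex \<Rightarrow> complex)" where
  "toeplitz \<rho> a f = riesz_projection \<rho> (\<lambda>z. a z * f z)"

section \<open>Reflexivity\<close>

text \<open>A normed space is given by a set \<open>E\<close> of complex-valued functions, with pointwise operations,
  and a seminorm \<open>N\<close> that is finite on \<open>E\<close>; elements at distance 0 are identified. The dual
  consists again of complex-valued functions, now on functions, so the construction can be
  iterated. Functionals that agree on \<open>E\<close> have distance 0 for the dual norm.\<close>

definition dual_norm :: "('a \<Rightarrow> complex) set \<Rightarrow> (('a \<Rightarrow> complex) \<Rightarrow> ennreal) \<Rightarrow>
    (('a \<Rightarrow> complex) \<Rightarrow> complex) \<Rightarrow> ennreal" where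
  "dual_norm E N \<phi> = (SUP f\<in>{f\<in>E. N f \<le> 1}. ennreal (cmod (\<phi> f)))"

definition dual :: "('a \<Rightarrow> complex) set \<Rightarrow> (('a \<Rightarrow> complex) \<Rightarrow> ennreal) \<Rightarrow>
    (('a \<Rightarrow> complex) \<Rightarrow> complex) set" where
  "dual E N = {\<phi>. (\<forall>f\<in>E. \<forall>g\<in>E. \<phi> (\<lambda>x. f x + g x) = \<phi> f + \<phi> g) \<and>
     (\<forall>c. \<forall>f\<in>E. \<phi> (\<lambda>x. c * f x) = c * \<phi> f) \<and>
     (\<exists>C::real. \<forall>f\<in>E. ennreal (cmod (\<phi> f)) \<le> ennreal C * N f)}"

text \<open>The canonical embedding into the bidual is onto.\<close>

definition reflexive_space :: "('a \<Rightarrow> complex) set \<Rightarrow> (('a \<Rightarrow> complex) \<Rightarrow> ennreal) \<Rightarrow> bool" where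
  "reflexive_space E N \<longleftrightarrow>
     (\<forall>\<Phi>\<in>dual (dual E N) (dual_norm E N). \<exists>f\<in>E. \<forall>\<phi>\<in>dual E N. \<Phi> \<phi> = \<phi> f)"

section \<open>Operators on a space of functions on the circle\<close>

text \<open>Linear operators of the space of classes, represented by maps on functions.\<close>

definition linear_operator :: "(complex \<Rightarrow> complex) set \<Rightarrow>
    ((complex \<Rightarrow> complex) \<Rightarrow> (complex \<Rightarrow> complex)) \<Rightarrow> bool" where
  "linear_operator E A \<longleftrightarrow> A ` E \<subseteq> E \<and>
     (\<forall>f\<in>E. \<forall>g\<in>E. (AE z in circle. f z = g z) \<longrightarrow> (AE z in circle. A f z = A g z)) \<and>
     (\<forall>f\<in>E. \<forall>g\<in>E. AE z in circle. A (\<lambda>x. f x + g x) z = A f z + A g z) \<and>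
     (\<forall>c. \<forall>f\<in>E. AE z in circle. A (\<lambda>x. c * f x) z = c * A f z)"

definition compact_operator :: "(complex \<Rightarrow> complex) set \<Rightarrow> ((complex \<Rightarrow> complex) \<Rightarrow> ennreal) \<Rightarrow>
    ((complex \<Rightarrow> complex) \<Rightarrow> (complex \<Rightarrow> complex)) \<Rightarrow> bool" where
  "compact_operator E N K \<longleftrightarrow> linear_operator E K \<and>
     (\<forall>F::nat \<Rightarrow> complex \<Rightarrow> complex. (\<forall>n. F n \<in> E) \<and> (\<exists>C::real. \<forall>n. N (F n) \<le> ennreal C) \<longrightarrow>
        (\<exists>r g. strict_mono r \<and> g \<in> E \<and> (\<lambda>n. N (\<lambda>z. K (F (r n)) z - g z)) \<longlonglongrightarrow> 0))"

text \<open>The norm of the restriction of \<open>A\<close> to \<open>M\<close>.\<close>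

definition op_norm :: "(complex \<Rightarrow> complex) set \<Rightarrow> ((complex \<Rightarrow> complex) \<Rightarrow> ennreal) \<Rightarrow>
    ((complex \<Rightarrow> complex) \<Rightarrow> (complex \<Rightarrow> complex)) \<Rightarrow> ennreal" where
  "op_norm M N A = (SUP f\<in>{f\<in>M. N f \<le> 1}. N (A f))"

definition ess_norm :: "(complex \<Rightarrow> complex) set \<Rightarrow> ((complex \<Rightarrow> complex) \<Rightarrow> ennreal) \<Rightarrow>
    ((complex \<Rightarrow> complex) \<Rightarrow> (complex \<Rightarrow> complex)) \<Rightarrow> ennreal" where
  "ess_norm E N A = (INF K\<in>{K. compact_operator E N K}. op_norm E N (\<lambda>f z. A f z - K f z))"

text \<open>Closedness makes \<open>M\<close> saturated under equality a.e.\<close>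

definition closed_linear_subspace :: "(complex \<Rightarrow> complex) set \<Rightarrow>
    ((complex \<Rightarrow> complex) \<Rightarrow> ennreal) \<Rightarrow> (complex \<Rightarrow> complex) set \<Rightarrow> bool" where
  "closed_linear_subspace E N M \<longleftrightarrow> M \<subseteq> E \<and> (\<lambda>_. 0) \<in> M \<and>
     (\<forall>f\<in>M. \<forall>g\<in>M. (\<lambda>z. f z + g z) \<in> M) \<and> (\<forall>c. \<forall>f\<in>M. (\<lambda>z. c * f z) \<in> M) \<and>
     (\<forall>F f. (\<forall>n::nat. F n \<in> M) \<and> f \<in> E \<and> (\<lambda>n. N (\<lambda>z. F n z - f z)) \<longlonglongrightarrow> 0 \<longrightarrow> f \<in> M)"

text \<open>The quotient \<open>E/M\<close> is spanned by finitely many classes.\<close>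

definition finite_codimension ::
  "(complex \<Rightarrow> complex) set \<Rightarrow> (complex \<Rightarrow> complex) set \<Rightarrow> bool" where
  "finite_codimension E M \<longleftrightarrow> (\<exists>B. finite B \<and> B \<subseteq> E \<and>
     (\<forall>f\<in>E. \<exists>c. (\<lambda>z. f z - (\<Sum>b\<in>B. c b * b z)) \<in> M))"

definition m_norm :: "(complex \<Rightarrow> complex) set \<Rightarrow> ((complex \<Rightarrow> complex) \<Rightarrow> ennreal) \<Rightarrow>
    ((complex \<Rightarrow> complex) \<Rightarrow> (complex \<Rightarrow> complex)) \<Rightarrow> ennreal" where
  "m_norm E N A =
     (INF M\<in>{M. closed_linear_subspace E N M \<and> finite_codimension E M}. op_norm M N A)"

end

theory Submission
  imports Defs
begin

text \<open>For \<open>f\<close> in the weighted Hardy space and \<open>a = z\<^sup>-\<^sup>m h + d\<close> with \<open>h \<in> H\<^sup>\<infinity>\<close> and \<open>d\<close> small, \<open>T(a)(z\<^sup>n f)\<close> is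
  close to \<open>z\<^sup>n a f\<close> for large \<open>n\<close>. By reflexivity \<open>z\<^sup>n f\<close> tends to 0 weakly, so neither a compact
  perturbation nor the restriction to a closed subspace of finite codimension can make the norm of
  \<open>T(a)\<close> smaller than the norm of multiplication by \<open>a\<close> on the Hardy space. The latter norm is
  \<open>\<parallel>a\<parallel>\<^sub>\<infinity>\<close>, because there are outer functions with prescribed modulus. On \<open>z\<^sup>m H[X(w)]\<close>, the operator \<open>T(z\<^sup>-\<^sup>m h)\<close> is
  multiplication by a function of modulus at most \<open>\<parallel>a\<parallel>\<^sub>\<infinity> + \<epsilon>\<close>, which bounds \<open>\<parallel>T(a)\<parallel>\<^sub>m\<close> from above.

  For the essential norm, let \<open>W\<close> be an outer function with \<open>\<bar>W\<bar> = w\<close>. Multiplication by \<open>W\<close> maps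
  \<open>H[X(w)]\<close> isometrically onto \<open>H[X]\<close>, where the Fejer means \<open>F\<^sub>n\<close> are contractions of finite rank because the norm is
  translation-invariant. Up to a small correction of finitely many Fourier coefficients,
  \<open>T(z\<^sup>-\<^sup>m h)\<close> differs by a finite rank operator from \<open>f \<mapsto> z\<^sup>-\<^sup>m W\<^sup>-\<^sup>1 (I - F\<^sub>n)(W h f)\<close>,
  whose norm is at most \<open>2 \<parallel>h\<parallel>\<^sub>\<infinity>\<close>.\<close>

section \<open>Rotation invariance and Fourier coefficients on the circle\<close>

text \<open>The norm of X(w) is not translation-invariant in general, so Fejer means need not be
  bounded on X(w) itself. The outer function \<open>W\<close> carries the problem over to X, where
  rotations are isometries. The constant 2 is the bound 1 + 1 for the identity minus a contraction.
  The finitely many coefficients below m have to be corrected because the result is divided by z^m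
  afterwards and must remain analytic.

  The axioms of a Banach function norm give no direct hold on convergence in norm. Hence functions
  are approximated in L^1, which contains all the spaces involved, and norm bounds are carried to
  a.e. limits by the monotone convergence axiom. For the same reason Fejer means are reached through
  finite convex combinations of rotations. Reflexivity enters through a single fact, the weak
  convergence of z^n f to 0. The conditions on w and 1/w make log w square integrable, and the outer
  function is built from that by L^2 estimates. The inequality between the two operator quantities
  is read off from the norm of \<open>a\<close>, which equals the first and is a lower bound of the
  second.\<close>

abbreviation borel_circle :: "complex measure" where
  "borel_circle \<equiv> distr (restrict_space lborel {-pi..pi}) (restrict_space borel (sphere 0 1)) cis"

lemma cis_measurable_circle: "cis \<in> restrict_space lborel {-pi..pi} \<rightarrow>\<^sub>M restrict_space borel (sphere 0 1)"
proof -
  have "cis \<in> borel_measurable borel"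
    by (intro borel_measurable_continuous_onI continuous_intros)
  then have "cis \<in> restrict_space lborel {-pi..pi} \<rightarrow>\<^sub>M borel"
    by (intro measurable_restrict_space1) simp
  then show ?thesis
    by (rule measurable_restrict_space2[rotated]) auto
qed

lemma complete_measure_circle: "complete_measure circle"
  unfolding circle_def by (rule completion.complete_measure_axioms)

lemma norm_circle_eq_1: "z \<in> space circle \<Longrightarrow> cmod z = 1"
  by (simp add: space_circle)

lemma AE_circle_norm: "AE z in circle. cmod z = 1"
  by (rule AE_I2) (simp add: norm_circle_eq_1)

lemma emeasure_circle: "emeasure circle (space circle) = ennreal (2 * pi)"
proof -
  have "emeasure circle (space circle) = (\<integral>\<^sup>+ z. 1 \<partial>circle)"
    by simp
  also have "\<dots> = (\<integral>\<^sup>+ \<theta>\<in>{-pi..pi}. 1 \<partial>lborel)"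
    by (rule nn_integral_circle) simp
  also have "\<dots> = ennreal (2 * pi)"
    by simp
  finally show ?thesis .
qed

interpretation circle: finite_measure circle
  by standard (simp add: emeasure_circle)

lemma measure_circle: "measure circle (space circle) = 2 * pi"
  by (simp add: measure_def emeasure_circle)

lemma measurable_ident_circle [measurable]: "(\<lambda>z. z) \<in> borel_measurable circle"
  unfolding circle_def
  by (intro measurable_completion) (simp add: measurable_distr_eq1 measurable_restrict_space1)

lemma borel_measurable_circle_continuous_on:
  fixes f :: "complex \<Rightarrow> 'b::topological_space"
  assumes "continuous_on (sphere 0 1) f"
  shows "f \<in> borel_measurable circle"
  unfolding circle_def
  using borel_measurable_continuous_on_restrict[OF assms]
  by (intro measurable_completion) (simp add: measurable_distr_eq1)

lemma powi_measurable_circle [measurable]: "(\<lambda>z. z powi k) \<in> borel_measurable circle"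
  by (intro borel_measurable_circle_continuous_on continuous_intros) auto

lemma integrable_circle_bounded:
  fixes f :: "complex \<Rightarrow> 'b::{banach, second_countable_topology}"
  assumes "f \<in> borel_measurable circle" "AE z in circle. norm (f z) \<le> B"
  shows "integrable circle f"
  using circle.integrable_const_bound[OF assms(2,1)] .

text \<open>Substitution gives the integral of \<open>g\<close> over [-pi + t, pi + t]. The piece
  beyond pi is moved back by one period and fills the gap at the left end, up to the points -pi and
  -pi + t, which form a null set.\<close>

lemma nn_integral_periodic_shift:
  fixes g :: "real \<Rightarrow> ennreal"
  assumes [measurable]: "g \<in> borel_measurable borel" and per: "\<And>x. g (x + 2 * pi) = g x"
    and t: "0 \<le> t" "t < 2 * pi"
  shows "(\<integral>\<^sup>+ x\<in>{-pi..pi}. g (t + x) \<partial>lborel) = (\<integral>\<^sup>+ x\<in>{-pi..pi}. g x \<partial>lborel)"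
proof -
  have "(\<integral>\<^sup>+ x\<in>{-pi..pi}. g (t + x) \<partial>lborel)
      = (\<integral>\<^sup>+ x. (\<lambda>y. g y * indicator {-pi+t..pi+t} y) (t + 1 * x) \<partial>lborel)"
    by (intro nn_integral_cong) (auto simp: indicator_def)
  also have "\<dots> = (\<integral>\<^sup>+ y. g y * indicator {-pi+t..pi+t} y \<partial>lborel)"
    by (subst nn_integral_real_affine[where c = 1 and t = t and f = "\<lambda>y. g y * indicator {-pi+t..pi+t} y"]) auto
  also have "\<dots> = (\<integral>\<^sup>+ y. g y * indicator {-pi+t..pi} y + g y * indicator {pi<..pi+t} y \<partial>lborel)"
    using t by (intro nn_integral_cong) (auto simp: indicator_def)
  also have "\<dots> = (\<integral>\<^sup>+ y. g y * indicator {-pi+t..pi} y \<partial>lborel) + (\<integral>\<^sup>+ y. g y * indicator {pi<..pi+t} y \<partial>lborel)"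
    by (rule nn_integral_add) auto
  also have "(\<integral>\<^sup>+ y. g y * indicator {pi<..pi+t} y \<partial>lborel)
      = (\<integral>\<^sup>+ x. (\<lambda>y. g y * indicator {pi<..pi+t} y) (2 * pi + 1 * x) \<partial>lborel)"
    by (subst nn_integral_real_affine[where c = 1 and t = "2*pi"]) auto
  also have "\<dots> = (\<integral>\<^sup>+ x. g x * indicator {-pi<..-pi+t} x \<partial>lborel)"
  proof (intro nn_integral_cong)
    fix x :: real
    show "g (2 * pi + 1 * x) * indicator {pi<..pi+t} (2 * pi + 1 * x) = g x * indicator {-pi<..-pi+t} x"
      using per[of x] by (auto simp: indicator_def add.commute)
  qed
  also have "(\<integral>\<^sup>+ y. g y * indicator {-pi+t..pi} y \<partial>lborel) + \<dots>
      = (\<integral>\<^sup>+ x. g x * indicator {-pi+t..pi} x + g x * indicator {-pi<..-pi+t} x \<partial>lborel)"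
    by (rule nn_integral_add[symmetric]) auto
  also have "\<dots> = (\<integral>\<^sup>+ x\<in>{-pi..pi}. g x \<partial>lborel)"
  proof (rule nn_integral_cong_AE)
    show "AE x in lborel. g x * indicator {-pi+t..pi} x + g x * indicator {-pi<..-pi+t} x = g x * indicator {-pi..pi} x"
      using AE_lborel_singleton[of "-pi"] AE_lborel_singleton[of "-pi+t"]
    proof eventually_elim
      case (elim x)
      then show ?case using t by (auto simp: indicator_def)
    qed
  qed
  finally show ?thesis .
qed

text \<open>In the angle, the rotation is a shift of a function of period 2 pi. The Borel sets of
  the circle are traces of Borel sets of the plane, so they can be tested by indicators of
  \<open>cis\<close>.\<close>

lemma distr_borel_circle_rotation:
  assumes "cmod c = 1"
  shows "distr borel_circle borel_circle (\<lambda>z. z * c) = borel_circle"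
proof -
  let ?S = "restrict_space borel (sphere 0 1) :: complex measure"
  obtain t where t: "0 \<le> t" "t < 2 * pi" "c = cis t"
    using assms by (metis Arg2pi is_Arg_def cis_conv_exp mult.left_neutral of_real_1)
  have rot: "(\<lambda>z. z * c) \<in> ?S \<rightarrow>\<^sub>M ?S"
    by (rule measurable_restrict_space2)
       (use assms in \<open>auto simp: space_restrict_space norm_mult intro!: measurable_restrict_space1\<close>)
  have rot': "(\<lambda>z. z * c) \<in> borel_circle \<rightarrow>\<^sub>M borel_circle"
    using rot by (simp add: measurable_distr_eq1 measurable_distr_eq2)
  have sets: "sets borel_circle = sets ?S" by simp
  have em: "emeasure borel_circle (B \<inter> sphere 0 1) = (\<integral>\<^sup>+ x\<in>{-pi..pi}. indicator B (cis x) \<partial>lborel)"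
    if "B \<in> sets borel" for B
  proof -
    have B: "B \<inter> sphere 0 1 \<in> sets ?S"
      using that by (auto simp: sets_restrict_space)
    have "emeasure borel_circle (B \<inter> sphere 0 1) = (\<integral>\<^sup>+ z. indicator (B \<inter> sphere 0 1) z \<partial>borel_circle)"
      using B by simp
    also have "\<dots> = (\<integral>\<^sup>+ x. indicator (B \<inter> sphere 0 1) (cis x) \<partial>restrict_space lborel {-pi..pi})"
      by (rule nn_integral_distr[OF cis_measurable_circle]) (use B in simp)
    also have "\<dots> = (\<integral>\<^sup>+ x\<in>{-pi..pi}. indicator (B \<inter> sphere 0 1) (cis x) \<partial>lborel)"
      by (rule nn_integral_restrict_space) simp
    also have "\<dots> = (\<integral>\<^sup>+ x\<in>{-pi..pi}. indicator B (cis x) \<partial>lborel)"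
      by (intro nn_integral_cong) (auto simp: indicator_def)
    finally show ?thesis .
  qed
  show ?thesis
  proof (rule measure_eqI)
    fix A assume "A \<in> sets (distr borel_circle borel_circle (\<lambda>z. z * c))"
    then have A: "A \<in> sets ?S" by simp
    then obtain B where B: "B \<in> sets borel" "A = B \<inter> sphere 0 1"
      by (auto simp: sets_restrict_space)
    define B' where "B' = (\<lambda>z. z * c) -` B"
    have B': "B' \<in> sets borel"
      unfolding B'_def using B(1) by (intro measurable_sets_borel) auto
    have cis_m: "cis \<in> borel_measurable borel"
      by (intro borel_measurable_continuous_onI continuous_intros)
    have "emeasure (distr borel_circle borel_circle (\<lambda>z. z * c)) A
        = emeasure borel_circle ((\<lambda>z. z * c) -` A \<inter> space borel_circle)"
      using rot' A by (intro emeasure_distr) auto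
    also have "(\<lambda>z. z * c) -` A \<inter> space borel_circle = B' \<inter> sphere 0 1"
      using assms by (auto simp: B'_def B(2) space_restrict_space norm_mult)
    also have "emeasure borel_circle \<dots> = (\<integral>\<^sup>+ x\<in>{-pi..pi}. indicator B' (cis x) \<partial>lborel)"
      by (rule em[OF B'])
    also have "\<dots> = (\<integral>\<^sup>+ x\<in>{-pi..pi}. indicator B (cis (t + x)) \<partial>lborel)"
      by (intro nn_integral_cong) (auto simp: indicator_def B'_def t cis_mult add.commute)
    also have "\<dots> = (\<integral>\<^sup>+ x\<in>{-pi..pi}. indicator B (cis x) \<partial>lborel)"
    proof (rule nn_integral_periodic_shift)
      show "(\<lambda>x. indicator B (cis x) :: ennreal) \<in> borel_measurable borel"
        using measurable_compose[OF cis_m borel_measurable_indicator[OF B(1)]] .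
      show "indicator B (cis (x + 2 * pi)) = (indicator B (cis x) :: ennreal)" for x
        by (simp flip: cis_mult)
    qed (use t in auto)
    also have "\<dots> = emeasure borel_circle A"
      by (simp only: em[OF B(1)] B(2))
    finally show "emeasure (distr borel_circle borel_circle (\<lambda>z. z * c)) A = emeasure borel_circle A" .
  qed simp
qed

text \<open>For the completed sigma-algebra even measurability depends on the invariance: preimages
  of Borel null sets have to be null. Hence the two claims are derived together.\<close>

lemma
  assumes "cmod c = 1"
  shows rotation_measurable_circle: "(\<lambda>z. z * c) \<in> circle \<rightarrow>\<^sub>M circle"
    and distr_circle_rotation: "distr circle circle (\<lambda>z. z * c) = circle"
proof -
  interpret complete_measure circle by (rule complete_measure_circle)
  have rot: "(\<lambda>z. z * c) \<in> borel_circle \<rightarrow>\<^sub>M borel_circle"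
    unfolding measurable_distr_eq1 measurable_distr_eq2
    by (rule measurable_restrict_space2)
       (use assms in \<open>auto simp: space_restrict_space norm_mult intro!: measurable_restrict_space1\<close>)
  then have rot': "(\<lambda>z. z * c) \<in> circle \<rightarrow>\<^sub>M borel_circle"
    unfolding circle_def by (rule measurable_completion)
  have d: "distr circle borel_circle (\<lambda>z. z * c) = borel_circle"
    unfolding circle_def using distr_completion[OF rot] distr_borel_circle_rotation[OF assms] by simp
  have ns: "null_sets borel_circle \<subseteq> null_sets (distr circle borel_circle (\<lambda>z. z * c))"
    by (simp only: d order_refl)
  show "(\<lambda>z. z * c) \<in> circle \<rightarrow>\<^sub>M circle"
    using measurable_completion2[OF rot' ns] by (simp add: circle_def)
  show "distr circle circle (\<lambda>z. z * c) = circle"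
    using completion_distr_eq[OF rot'] d by (simp add: circle_def)
qed

lemma nn_integral_rotation:
  assumes "cmod c = 1" "f \<in> borel_measurable circle"
  shows "(\<integral>\<^sup>+ z. f (z * c) \<partial>circle) = (\<integral>\<^sup>+ z. f z \<partial>circle)"
  using nn_integral_distr[OF rotation_measurable_circle[OF assms(1)], of f] assms(2)
  by (simp add: distr_circle_rotation[OF assms(1)])

lemma integral_rotation:
  fixes f :: "complex \<Rightarrow> 'b::{banach, second_countable_topology}"
  assumes "cmod c = 1" "f \<in> borel_measurable circle"
  shows "(\<integral>z. f (z * c) \<partial>circle) = (\<integral>z. f z \<partial>circle)"
  using integral_distr[OF rotation_measurable_circle[OF assms(1)], of f] assms(2)
  by (simp add: distr_circle_rotation[OF assms(1)])

lemma measurable_rotation: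
  assumes "cmod c = 1" "f \<in> circle \<rightarrow>\<^sub>M M"
  shows "(\<lambda>z. f (z * c)) \<in> circle \<rightarrow>\<^sub>M M"
  using measurable_compose[OF rotation_measurable_circle[OF assms(1)] assms(2)] .

text \<open>For k \<noteq> 0, a rotation by \<open>c\<close> with c^k = -1 leaves the integral
  unchanged and also reverses its sign.\<close>

lemma integral_powi_circle: "(\<integral>z. z powi k \<partial>circle) = (if k = 0 then complex_of_real (2 * pi) else 0)"
proof (cases "k = 0")
  case True
  then show ?thesis by (simp add: measure_circle scaleR_conv_of_real)
next
  case False
  define c where "c = cis (pi / of_int k)"
  have c: "cmod c = 1" by (simp add: c_def)
  have "c powi k = cis (of_int k * (pi / of_int k))"
    by (simp add: c_def cis_power_int)
  then have ck: "c powi k = -1" using False by simp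
  have "(\<integral>z. z powi k \<partial>circle) = (\<integral>z. (z * c) powi k \<partial>circle)"
    by (rule integral_rotation[symmetric, OF c]) measurable
  also have "\<dots> = - (\<integral>z. z powi k \<partial>circle)"
    by (simp add: power_int_mult_distrib ck)
  finally have "2 * (\<integral>z. z powi k \<partial>circle) = 0" by simp
  then show ?thesis using False by simp
qed

section \<open>Rules for Fourier coefficients\<close>

lemma powi_times_integrable:
  assumes "integrable circle f"
  shows "integrable circle (\<lambda>z. f z * z powi k)"
proof (rule Bochner_Integration.integrable_bound[OF assms])
  have [measurable]: "f \<in> borel_measurable circle" using assms by simp
  show "(\<lambda>z. f z * z powi k) \<in> borel_measurable circle" by measurable
  show "AE z in circle. norm (f z * z powi k) \<le> norm (f z)"
    using AE_circle_norm by eventually_elim (simp add: norm_mult norm_power_int)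
qed

lemma fourier_coeff_cong_AE:
  assumes "f \<in> borel_measurable circle" "g \<in> borel_measurable circle" "AE z in circle. f z = g z"
  shows "fourier_coeff f k = fourier_coeff g k"
proof -
  have [measurable]: "f \<in> borel_measurable circle" "g \<in> borel_measurable circle" by fact+
  have "(\<integral>z. f z * z powi (-k) \<partial>circle) = (\<integral>z. g z * z powi (-k) \<partial>circle)"
    by (rule integral_cong_AE) (use assms(3) in auto)
  then show ?thesis by (simp add: fourier_coeff_def)
qed

lemma fourier_coeff_add:
  assumes "integrable circle f" "integrable circle g"
  shows "fourier_coeff (\<lambda>z. f z + g z) k = fourier_coeff f k + fourier_coeff g k"
  using powi_times_integrable[OF assms(1), of "-k"] powi_times_integrable[OF assms(2), of "-k"]
  by (simp add: fourier_coeff_def distrib_right add_divide_distrib)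

lemma fourier_coeff_diff:
  assumes "integrable circle f" "integrable circle g"
  shows "fourier_coeff (\<lambda>z. f z - g z) k = fourier_coeff f k - fourier_coeff g k"
  using powi_times_integrable[OF assms(1), of "-k"] powi_times_integrable[OF assms(2), of "-k"]
  by (simp add: fourier_coeff_def left_diff_distrib diff_divide_distrib)

lemma fourier_coeff_cmult: "fourier_coeff (\<lambda>z. c * f z) k = c * fourier_coeff f k"
  by (simp add: fourier_coeff_def mult.assoc)

lemma fourier_coeff_0 [simp]: "fourier_coeff (\<lambda>z. 0) k = 0"
  by (simp add: fourier_coeff_def)

lemma fourier_coeff_sum:
  assumes "\<And>i. i \<in> I \<Longrightarrow> integrable circle (f i)"
  shows "fourier_coeff (\<lambda>z. \<Sum>i\<in>I. f i z) k = (\<Sum>i\<in>I. fourier_coeff (f i) k)"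
  using assms
proof (induction I rule: infinite_finite_induct)
  case (insert i I)
  then show ?case by (simp add: fourier_coeff_add)
qed auto

lemma fourier_coeff_mult_powi:
  "fourier_coeff (\<lambda>z. z powi j * f z) k = fourier_coeff f (k - j)"
proof -
  have "(\<integral>z. z powi j * f z * z powi (-k) \<partial>circle) = (\<integral>z. f z * z powi (-(k - j)) \<partial>circle)"
  proof (rule Bochner_Integration.integral_cong[OF refl])
    fix z assume "z \<in> space circle"
    then have "z \<noteq> 0" by (auto dest: norm_circle_eq_1)
    then have "z powi j * z powi (-k) = z powi (-(k-j))"
      by (simp flip: power_int_add)
    then show "z powi j * f z * z powi (-k) = f z * z powi (-(k - j))"
      by (metis mult.assoc mult.commute)
  qed
  then show ?thesis by (simp add: fourier_coeff_def)
qed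

lemma fourier_coeff_const: "fourier_coeff (\<lambda>z. c) k = (if k = 0 then c else 0)"
  using integral_powi_circle[of "-k"] by (simp add: fourier_coeff_def)

lemma fourier_coeff_powi: "fourier_coeff (\<lambda>z. z powi j) k = (if k = j then 1 else 0)"
  using fourier_coeff_mult_powi[of j "\<lambda>_. 1" k] by (simp add: fourier_coeff_const)

lemma integrable_powi [simp]: "integrable circle (\<lambda>z. z powi k)"
  using powi_times_integrable[of "\<lambda>_. 1" k] by simp

text \<open>The factor 1/(2 pi) is estimated by 1; later arguments rest on continuity in the L^1
  norm, not on the constant.\<close>

lemma norm_fourier_coeff_le: "cmod (fourier_coeff f k) \<le> (\<integral>z. cmod (f z) \<partial>circle)"
proof -
  have "cmod (\<integral>z. f z * z powi (-k) \<partial>circle) \<le> (\<integral>z. cmod (f z * z powi (-k)) \<partial>circle)"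
    by (rule integral_norm_bound)
  also have "\<dots> = (\<integral>z. cmod (f z) \<partial>circle)"
    by (rule Bochner_Integration.integral_cong) (auto simp: norm_mult norm_power_int dest: norm_circle_eq_1)
  finally have 1: "cmod (\<integral>z. f z * z powi (-k) \<partial>circle) \<le> (\<integral>z. cmod (f z) \<partial>circle)" .
  have "cmod (fourier_coeff f k) = cmod (\<integral>z. f z * z powi (-k) \<partial>circle) / (2 * pi)"
    by (simp add: fourier_coeff_def norm_mult norm_divide)
  also have "\<dots> \<le> cmod (\<integral>z. f z * z powi (-k) \<partial>circle) / 1"
    using pi_gt3 by (intro divide_left_mono) auto
  finally show ?thesis using 1 by simp
qed

lemma fourier_coeff_tendsto:
  assumes "\<And>n. integrable circle (F n)" "integrable circle f"
    and "(\<lambda>n. \<integral>z. cmod (F n z - f z) \<partial>circle) \<longlonglongrightarrow> 0"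
  shows "(\<lambda>n. fourier_coeff (F n) k) \<longlonglongrightarrow> fourier_coeff f k"
proof -
  have "(\<lambda>n. fourier_coeff (F n) k - fourier_coeff f k) \<longlonglongrightarrow> 0"
  proof (rule Lim_null_comparison[OF always_eventually assms(3)], rule allI)
    fix n
    show "cmod (fourier_coeff (F n) k - fourier_coeff f k) \<le> (\<integral>z. cmod (F n z - f z) \<partial>circle)"
      using norm_fourier_coeff_le[of "\<lambda>z. F n z - f z" k] by (simp add: fourier_coeff_diff assms)
  qed
  then show ?thesis by (simp add: LIM_zero_iff)
qed

section \<open>Density of continuous functions and trigonometric polynomials\<close>

text \<open>Reduces the completed measure to Borel sets, for which regularity of measures is
  available.\<close>

lemma sets_circle_AE_borel:
  assumes "A \<in> sets circle"
  obtains B where "B \<in> sets borel" "AE z in circle. z \<in> A \<longleftrightarrow> z \<in> B"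
proof -
  from assms obtain S N N' where S: "A = S \<union> N" "N \<subseteq> N'" "N' \<in> null_sets borel_circle" "S \<in> sets borel_circle"
    unfolding circle_def by (rule sets_completionE)
  then obtain B where B: "B \<in> sets borel" "S = B \<inter> sphere 0 1"
    by (auto simp: sets_restrict_space)
  have "N' \<in> null_sets circle"
    unfolding circle_def using S(3) by (rule null_sets_completionI)
  then have "AE z in circle. z \<notin> N'" by (rule AE_not_in)
  then have "AE z in circle. z \<in> A \<longleftrightarrow> z \<in> B"
    using AE_circle_norm by eventually_elim (use S(1,2) B(2) in auto)
  with B(1) show thesis by (rule that)
qed

text \<open>Regularity encloses \<open>B\<close> between a compact \<open>K\<close> and an open
  \<open>U\<close> of nearly the same measure. A Urysohn function for this pair differs from the
  indicator only on U - K.\<close>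

lemma borel_indicator_approx_continuous:
  assumes B: "B \<in> sets borel" and e: "0 < (e::real)"
  obtains g :: "complex \<Rightarrow> real" where "continuous_on UNIV g" "\<And>z. 0 \<le> g z \<and> g z \<le> 1"
    "(\<integral>z. \<bar>indicator B z - g z\<bar> \<partial>circle) < e"
proof -
  \<comment> \<open>The image on the Borel sets of the whole plane, to which inner and outer
    regularity apply.\<close>
  define M where "M = distr circle borel (\<lambda>z. z)"
  have M: "sets M = sets borel" by (simp add: M_def)
  have emM: "emeasure M C = emeasure circle (C \<inter> space circle)" if "C \<in> sets borel" for C
    unfolding M_def using that by (subst emeasure_distr) auto
  have finM: "emeasure M (space M) \<noteq> \<infinity>"
    by (subst emM) (auto simp: M_def)
  have finB: "emeasure M B \<noteq> \<infinity>"
    by (subst emM) (use B in auto)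
  have "emeasure M B < emeasure M B + ennreal (e/2)"
    using finB e by (simp add: ennreal_add_left_cancel_less top.not_eq_extremum)
  then have "\<exists>U\<in>{U. B \<subseteq> U \<and> open U}. emeasure M U < emeasure M B + ennreal (e/2)"
    by (subst (asm) outer_regular[OF M finM B]) (simp add: INF_less_iff)
  then obtain U where U: "B \<subseteq> U" "open U" "emeasure M U < emeasure M B + ennreal (e/2)"
    by auto
  have "\<exists>K. K \<subseteq> B \<and> compact K \<and> emeasure M B < emeasure M K + ennreal (e/2)"
  \<comment> \<open>Nothing lies strictly below measure 0, so for a null set \<open>B\<close> the
    empty set serves as \<open>K\<close>.\<close>
  proof (cases "emeasure M B = 0")
    case True
    then show ?thesis using e by (intro exI[of _ "{}"]) auto
  next
    case False
    then have "emeasure M B - ennreal (e/2) < emeasure M B"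
      using finB e by (intro ennreal_between) (auto simp: top.not_eq_extremum zero_less_iff_neq_zero)
    then have "\<exists>K\<in>{K. K \<subseteq> B \<and> compact K}. emeasure M B - ennreal (e/2) < emeasure M K"
      by (subst (asm) (2) inner_regular[OF M finM B]) (simp add: less_SUP_iff)
    then obtain K where K: "K \<subseteq> B" "compact K" "emeasure M B - ennreal (e/2) < emeasure M K" by auto
    moreover from K have "emeasure M K \<le> emeasure M B"
      using B by (intro emeasure_mono) (auto simp: M)
    ultimately have "emeasure M B < emeasure M K + ennreal (e/2)"
      using finB e
      by (cases "emeasure M B"; cases "emeasure M K";
        simp add: ennreal_minus ennreal_less_iff top_unique flip: ennreal_plus)
        (metis ennreal_leI le_diff_eq not_le)
    with K show ?thesis by auto
  qed
  then obtain K where K: "K \<subseteq> B" "compact K" "emeasure M B < emeasure M K + ennreal (e/2)" by auto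
  obtain g :: "complex \<Rightarrow> real" where g: "continuous_on UNIV g" "\<And>z. g z \<in> closed_segment 0 1"
    "\<And>z. z \<in> - U \<Longrightarrow> g z = 0" "\<And>z. z \<in> K \<Longrightarrow> g z = 1"
    using Urysohn[of "- U" K "0::real" 1] U K by (auto simp: compact_imp_closed)
  have g01: "0 \<le> g z \<and> g z \<le> 1" for z
    using g(2)[of z] by (auto simp: closed_segment_eq_real_ivl)
  have KU: "K \<subseteq> U" "K \<in> sets borel" "U \<in> sets borel"
    using K U by (auto simp: borel_compact)
  have sc: "C \<inter> space circle \<in> sets circle" if "C \<in> sets borel" for C
    using measurable_sets[OF measurable_ident_circle that] by (simp add: vimage_def Int_def)
  have [measurable]: "g \<in> borel_measurable borel" "B \<in> sets borel"
    using g(1) B by (auto intro: borel_measurable_continuous_onI)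
  have UK: "(U - K) \<inter> space circle \<in> sets circle" using KU by (intro sc) auto
  have "(\<integral>z. \<bar>indicator B z - g z\<bar> \<partial>circle) \<le> (\<integral>z. indicator ((U - K) \<inter> space circle) z \<partial>circle)"
  proof (rule integral_mono)
    show "integrable circle (\<lambda>z. \<bar>indicator B z - g z\<bar>)"
    proof (rule integrable_circle_bounded)
      have "norm \<bar>indicator B z - g z\<bar> \<le> 1" for z
        using g01[of z] by (cases "z \<in> B") auto
      then show "AE z in circle. norm \<bar>indicator B z - g z\<bar> \<le> 1" by simp
    qed measurable
    show "integrable circle (indicator ((U - K) \<inter> space circle) :: complex \<Rightarrow> real)"
      using UK by (simp add: integrable_indicator_iff less_top[symmetric])
    show "\<bar>indicator B z - g z\<bar> \<le> indicator ((U - K) \<inter> space circle) z" if "z \<in> space circle" for z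
      using g01[of z] g(3,4)[of z] U(1) K(1) that by (auto simp: indicator_def)
  qed
  also have "\<dots> = measure circle ((U - K) \<inter> space circle)"
    using UK by (simp add: Int_absorb1)
  also have "\<dots> = measure circle (U \<inter> space circle) - measure circle (K \<inter> space circle)"
    using KU by (subst circle.finite_measure_Diff[symmetric]) (auto intro!: sc arg_cong[of _ _ "measure circle"])
  also have "\<dots> < e"
  proof -
    have "emeasure M C = ennreal (measure circle (C \<inter> space circle))" if "C \<in> sets borel" for C
      using emM[OF that] by (simp add: circle.emeasure_eq_measure)
    then have "measure circle (U \<inter> space circle) < measure circle (B \<inter> space circle) + e/2"
      "measure circle (B \<inter> space circle) < measure circle (K \<inter> space circle) + e/2"
      using U(3) K(3) KU B e by (simp_all flip: ennreal_plus add: ennreal_less_iff)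
    then show ?thesis by simp
  qed
  finally show thesis using g(1) g01 by (intro that) auto
qed

lemma integrable_circle_continuous_on:
  fixes g :: "complex \<Rightarrow> 'b::euclidean_space"
  assumes "continuous_on (sphere 0 1) g"
  shows "integrable circle g"
proof -
  have "bounded (g ` sphere 0 1)"
    using assms by (intro compact_imp_bounded compact_continuous_image) auto
  then obtain b where "\<forall>x\<in>g ` sphere 0 1. norm x \<le> b"
    unfolding bounded_iff by auto
  then have b: "norm (g z) \<le> b" if "z \<in> sphere 0 1" for z
    using that by blast
  show ?thesis
    by (rule integrable_circle_bounded[OF borel_measurable_circle_continuous_on[OF assms]])
       (auto intro!: AE_I2 b[unfolded space_circle[symmetric]])
qed

lemma integrable_approx_continuous:
  fixes f :: "complex \<Rightarrow> complex"
  assumes "integrable circle f"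
  shows "\<forall>e>0. \<exists>g. continuous_on UNIV g \<and> (\<integral>z. cmod (f z - g z) \<partial>circle) < e"
  using assms
proof (induction rule: integrable_induct)
  case (base A c)
  obtain B where B: "B \<in> sets borel" "AE z in circle. z \<in> A \<longleftrightarrow> z \<in> B"
    using sets_circle_AE_borel[OF base(1)] .
  show ?case
  proof (intro allI impI)
    fix e :: real assume e: "e > 0"
    \<comment> \<open>The summand 1 keeps the quotient meaningful for c = 0 and makes d |c| < e
      strict.\<close>
    define d where "d = e / (1 + cmod c)"
    have d: "d > 0" "d * cmod c < e"
      using e by (auto simp: d_def field_simps add_pos_nonneg)
    obtain g :: "complex \<Rightarrow> real" where g: "continuous_on UNIV g" "\<And>z. 0 \<le> g z \<and> g z \<le> 1"
      "(\<integral>z. \<bar>indicator B z - g z\<bar> \<partial>circle) < d"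
      using borel_indicator_approx_continuous[OF B(1) d(1)] by metis
    have [measurable]: "g \<in> borel_measurable borel" "B \<in> sets borel" "A \<in> sets circle"
      using g(1) B base by (auto intro: borel_measurable_continuous_onI)
    have "(\<integral>z. cmod (indicator A z *\<^sub>R c - g z *\<^sub>R c) \<partial>circle) = (\<integral>z. \<bar>indicator B z - g z\<bar> * cmod c \<partial>circle)"
    proof (rule integral_cong_AE)
      show "AE z in circle. cmod (indicator A z *\<^sub>R c - g z *\<^sub>R c) = \<bar>indicator B z - g z\<bar> * cmod c"
        using B(2)
      proof eventually_elim
        case (elim z)
        then have "indicator A z = (indicator B z :: real)" by (auto simp: indicator_def)
        then show ?case by (simp flip: scaleR_left_diff_distrib)
      qed
    qed measurable
    also have "\<dots> = (\<integral>z. \<bar>indicator B z - g z\<bar> \<partial>circle) * cmod c"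
      by simp
    also have "\<dots> \<le> d * cmod c" using g(3) by (intro mult_right_mono) auto
    also have "\<dots> < e" by (rule d)
    finally show "\<exists>g. continuous_on UNIV g \<and> (\<integral>z. cmod (indicator A z *\<^sub>R c - g z) \<partial>circle) < e"
      using g(1) by (intro exI[of _ "\<lambda>z. g z *\<^sub>R c"]) (auto intro!: continuous_intros)
  qed
next
  case (add f g)
  show ?case
  proof (intro allI impI)
    fix e :: real assume "e > 0"
    then obtain f' g' where *: "continuous_on UNIV f'" "(\<integral>z. cmod (f z - f' z) \<partial>circle) < e/2"
      "continuous_on UNIV g'" "(\<integral>z. cmod (g z - g' z) \<partial>circle) < e/2"
      using add.IH by (meson half_gt_zero)
    have i: "integrable circle f'" "integrable circle g'"
      using * by (auto intro!: integrable_circle_continuous_on intro: continuous_on_subset)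
    have "(\<integral>z. cmod (f z + g z - (f' z + g' z)) \<partial>circle) \<le> (\<integral>z. cmod (f z - f' z) + cmod (g z - g' z) \<partial>circle)"
      using add.hyps i
      by (intro integral_mono) (auto simp: add_diff_add norm_triangle_ineq)
    also have "\<dots> = (\<integral>z. cmod (f z - f' z) \<partial>circle) + (\<integral>z. cmod (g z - g' z) \<partial>circle)"
      using add.hyps i by (intro Bochner_Integration.integral_add) auto
    also have "\<dots> < e" using * by simp
    finally show "\<exists>h. continuous_on UNIV h \<and> (\<integral>z. cmod (f z + g z - h z) \<partial>circle) < e"
      using * by (intro exI[of _ "\<lambda>z. f' z + g' z"]) (auto intro!: continuous_intros)
  qed
next
  case (lim f s)
  have "(\<lambda>i. \<integral>z. cmod (f z - s i z) \<partial>circle) \<longlonglongrightarrow> (\<integral>z. 0 \<partial>circle)"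
  \<comment> \<open>The majorant 3 |f| comes from |f| + |s_i| and the bound |s_i| \<le> 2 |f| that
    the induction rule supplies.\<close>
  proof (rule integral_dominated_convergence[where w = "\<lambda>z. 3 * cmod (f z)"])
    have [measurable]: "f \<in> borel_measurable circle" "\<And>i. s i \<in> borel_measurable circle"
      using lim by auto
    show "(\<lambda>z. cmod (f z - s i z)) \<in> borel_measurable circle" for i by measurable
    show "integrable circle (\<lambda>z. 3 * cmod (f z))" using lim by simp
    show "AE z in circle. (\<lambda>i. cmod (f z - s i z)) \<longlonglongrightarrow> 0"
    proof (rule AE_I2)
      fix z assume "z \<in> space circle"
      then have "(\<lambda>i. cmod (f z - s i z)) \<longlonglongrightarrow> cmod (f z - f z)"
        by (intro tendsto_intros lim)
      then show "(\<lambda>i. cmod (f z - s i z)) \<longlonglongrightarrow> 0" by simp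
    qed
    show "AE z in circle. norm (cmod (f z - s i z)) \<le> 3 * cmod (f z)" for i
    proof (rule AE_I2)
      fix z assume "z \<in> space circle"
      then show "norm (cmod (f z - s i z)) \<le> 3 * cmod (f z)"
        using norm_triangle_ineq4[of "f z" "s i z"] lim.hyps(3)[of z i] by simp
    qed
  qed simp
  then have conv: "(\<lambda>i. \<integral>z. cmod (f z - s i z) \<partial>circle) \<longlonglongrightarrow> 0" by simp
  show ?case
  proof (intro allI impI)
    fix e :: real assume e: "e > 0"
    then have "\<forall>\<^sub>F i in sequentially. (\<integral>z. cmod (f z - s i z) \<partial>circle) < e/2"
      using conv by (intro order_tendstoD) auto
    then obtain i where i: "(\<integral>z. cmod (f z - s i z) \<partial>circle) < e/2"
      by (auto simp: eventually_sequentially)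
    obtain g where g: "continuous_on UNIV g" "(\<integral>z. cmod (s i z - g z) \<partial>circle) < e/2"
      using lim.IH e by (meson half_gt_zero)
    have ig: "integrable circle g"
      using g(1) by (auto intro!: integrable_circle_continuous_on intro: continuous_on_subset)
    have "(\<integral>z. cmod (f z - g z) \<partial>circle) \<le> (\<integral>z. cmod (f z - s i z) + cmod (s i z - g z) \<partial>circle)"
      using lim.hyps ig norm_triangle_ineq[of "f z - s i z" "s i z - g z" for z] by (intro integral_mono) auto
    also have "\<dots> = (\<integral>z. cmod (f z - s i z) \<partial>circle) + (\<integral>z. cmod (s i z - g z) \<partial>circle)"
      using lim.hyps ig by (intro Bochner_Integration.integral_add) auto
    also have "\<dots> < e" using i g by simp
    finally show "\<exists>g. continuous_on UNIV g \<and> (\<integral>z. cmod (f z - g z) \<partial>circle) < e"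
      using g(1) by auto
  qed
qed

section \<open>Trigonometric polynomials and uniform approximation\<close>

inductive trig_poly :: "(complex \<Rightarrow> complex) \<Rightarrow> bool" where
  monom: "trig_poly (\<lambda>z. c * z powi k)"
| add: "trig_poly s \<Longrightarrow> trig_poly t \<Longrightarrow> trig_poly (\<lambda>z. s z + t z)"

lemma trig_poly_const: "trig_poly (\<lambda>z. c)"
  using trig_poly.monom[of c 0] by simp

text \<open>The product is described off 0 only: for k \<noteq> 0 the function z^k z^(-k) has the
  value 0 there instead of 1. On the circle this makes no difference.\<close>

lemma trig_poly_mult:
  assumes "trig_poly s" "trig_poly t"
  obtains u where "trig_poly u" "\<And>z. z \<noteq> 0 \<Longrightarrow> u z = s z * t z"
proof -
  have *: "\<exists>u. trig_poly u \<and> (\<forall>z. z \<noteq> 0 \<longrightarrow> u z = (c * z powi k) * t z)" for c k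
    using assms(2)
  proof induction
    case (monom d j)
    then show ?case
      by (intro exI[of _ "\<lambda>z. (c * d) * z powi (k + j)"]) (auto intro: trig_poly.monom simp: power_int_add)
  next
    case (add s t)
    then obtain u v where "trig_poly u" "\<forall>z. z \<noteq> 0 \<longrightarrow> u z = (c * z powi k) * s z"
      "trig_poly v" "\<forall>z. z \<noteq> 0 \<longrightarrow> v z = (c * z powi k) * t z" by auto
    then show ?case
      by (intro exI[of _ "\<lambda>z. u z + v z"]) (auto intro: trig_poly.add simp: distrib_left)
  qed
  have "\<exists>u. trig_poly u \<and> (\<forall>z. z \<noteq> 0 \<longrightarrow> u z = s z * t z)"
    using assms(1)
  proof induction
    case (monom c k)
    show ?case by (rule *)
  next
    case (add s s')
    then obtain u v where "trig_poly u" "\<forall>z. z \<noteq> 0 \<longrightarrow> u z = s z * t z"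
      "trig_poly v" "\<forall>z. z \<noteq> 0 \<longrightarrow> v z = s' z * t z" by auto
    then show ?case
      by (intro exI[of _ "\<lambda>z. u z + v z"]) (auto intro: trig_poly.add simp: distrib_right)
  qed
  then show thesis using that by blast
qed

lemma trig_poly_continuous_on: "trig_poly t \<Longrightarrow> continuous_on (sphere 0 1) t"
  by (induction rule: trig_poly.induct) (auto intro!: continuous_intros)

lemma trig_poly_integrable: "trig_poly t \<Longrightarrow> integrable circle t"
  by (intro integrable_circle_continuous_on trig_poly_continuous_on)

text \<open>The bridge from Stone-Weierstrass. On the circle Re z = (z + z^(-1))/2 and Im z = (z -
  z^(-1))/(2 i), and a real linear \<open>f\<close> is f(1) Re z + f(i) Im z.\<close>

lemma trig_poly_real_polynomial_function:
  fixes f :: "complex \<Rightarrow> real"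
  assumes "real_polynomial_function f"
  shows "\<exists>t. trig_poly t \<and> (\<forall>z. cmod z = 1 \<longrightarrow> t z = of_real (f z))"
  using assms
proof induction
  case (linear f)
  interpret bounded_linear f by fact
  let ?a = "complex_of_real (f 1)" and ?b = "complex_of_real (f \<i>)"
  define t where "t = (\<lambda>z. (?a/2 + ?b/(2*\<i>)) * z powi 1 + (?a/2 - ?b/(2*\<i>)) * z powi (-1))"
  have "t z = of_real (f z)" if "cmod z = 1" for z
  proof -
    have "z powi (-1) = cnj z"
      using that by (simp add: power_int_minus inverse_eq_divide divide_conv_cnj)
    then have "t z = (?a/2 + ?b/(2*\<i>)) * z + (?a/2 - ?b/(2*\<i>)) * cnj z"
      by (simp only: t_def power_int_1_right)
    also have "\<dots> = ?a * ((z + cnj z)/2) + ?b * ((z - cnj z)/(2*\<i>))"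
      by (simp add: add_divide_distrib diff_divide_distrib algebra_simps)
    also have "\<dots> = of_real (Re z * f 1 + Im z * f \<i>)"
    proof -
      have "(z + cnj z)/2 = of_real (Re z)"
        by (simp add: complex_add_cnj)
      moreover have "(z - cnj z)/(2*\<i>) = of_real (Im z)"
        by (simp add: complex_diff_cnj, simp add: complex_eq_iff)
      ultimately show ?thesis
        by (simp only: of_real_add of_real_mult) (simp only: mult.commute)
    qed
    also have "Re z * f 1 + Im z * f \<i> = f (Re z *\<^sub>R 1 + Im z *\<^sub>R \<i>)"
      by (simp only: add scaleR real_scaleR_def)
    also have "Re z *\<^sub>R 1 + Im z *\<^sub>R \<i> = z"
      by (simp add: complex_eq_iff)
    finally show ?thesis .
  qed
  moreover have "trig_poly t"
    unfolding t_def by (intro trig_poly.intros)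
  ultimately show ?case by blast
next
  case (const c)
  show ?case by (intro exI[of _ "\<lambda>z. of_real c"]) (simp add: trig_poly_const)
next
  case (add f g)
  then obtain s t where "trig_poly s" "\<forall>z. cmod z = 1 \<longrightarrow> s z = of_real (f z)"
    "trig_poly t" "\<forall>z. cmod z = 1 \<longrightarrow> t z = of_real (g z)" by auto
  then show ?case by (intro exI[of _ "\<lambda>z. s z + t z"]) (auto intro: trig_poly.add)
next
  case (mult f g)
  then obtain s t where *: "trig_poly s" "\<forall>z. cmod z = 1 \<longrightarrow> s z = of_real (f z)"
    "trig_poly t" "\<forall>z. cmod z = 1 \<longrightarrow> t z = of_real (g z)" by auto
  then obtain u where "trig_poly u" "\<And>z. z \<noteq> 0 \<Longrightarrow> u z = s z * t z"
    using trig_poly_mult by blast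
  moreover have "z \<noteq> 0" if "cmod z = 1" for z :: complex using that by auto
  ultimately show ?case using * by (intro exI[of _ u]) (simp add: of_real_mult)
qed

lemma continuous_approx_trig_poly:
  fixes f :: "complex \<Rightarrow> complex"
  assumes "continuous_on (sphere 0 1) f" "e > 0"
  obtains t where "trig_poly t" "\<And>z. cmod z = 1 \<Longrightarrow> cmod (f z - t z) < e"
proof -
  obtain g where g: "polynomial_function g" "\<forall>z\<in>sphere 0 1. cmod (f z - g z) < e"
    using Stone_Weierstrass_polynomial_function[OF compact_sphere assms] by blast
  then have "real_polynomial_function (Re \<circ> g)" "real_polynomial_function (Im \<circ> g)"
    unfolding polynomial_function_def using bounded_linear_Re bounded_linear_Im by blast+
  then obtain s t where st: "trig_poly s" "\<forall>z. cmod z = 1 \<longrightarrow> s z = of_real (Re (g z))"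
    "trig_poly t" "\<forall>z. cmod z = 1 \<longrightarrow> t z = of_real (Im (g z))"
    using trig_poly_real_polynomial_function[of "Re \<circ> g"] trig_poly_real_polynomial_function[of "Im \<circ> g"] by auto
  obtain u where u: "trig_poly u" "\<And>z. z \<noteq> 0 \<Longrightarrow> u z = \<i> * t z"
    using trig_poly_mult[OF trig_poly_const st(3)] by blast
  show thesis
  proof (rule that)
    show "trig_poly (\<lambda>z. s z + u z)" using st u by (intro trig_poly.add)
    fix z :: complex assume z: "cmod z = 1"
    then have "z \<noteq> 0" by auto
    then have "s z + u z = g z"
      using st u(2)[of z] z by (auto simp: complex_eq_iff)
    then show "cmod (f z - (s z + u z)) < e" using g z by auto
  qed
qed

lemma integrable_approx_trig_poly:
  fixes f :: "complex \<Rightarrow> complex"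
  assumes "integrable circle f" "e > 0"
  obtains t where "trig_poly t" "(\<integral>z. cmod (f z - t z) \<partial>circle) < e"
proof -
  obtain g where g: "continuous_on UNIV g" "(\<integral>z. cmod (f z - g z) \<partial>circle) < e/2"
    using integrable_approx_continuous[OF assms(1)] assms(2) by (meson half_gt_zero)
  \<comment> \<open>Half of \<open>e\<close> is left for the uniform error, which integrates to 2 pi
    d = e/2.\<close>
  define d where "d = e / (4 * pi)"
  have d: "d > 0" using assms(2) by (simp add: d_def)
  obtain t where t: "trig_poly t" "\<And>z. cmod z = 1 \<Longrightarrow> cmod (g z - t z) < d"
    using continuous_approx_trig_poly[OF continuous_on_subset[OF g(1)] d] by auto
  have i: "integrable circle g" "integrable circle t"
    using g(1) trig_poly_integrable[OF t(1)] by (auto intro!: integrable_circle_continuous_on intro: continuous_on_subset)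
  have "(\<integral>z. cmod (f z - t z) \<partial>circle) \<le> (\<integral>z. cmod (f z - g z) + d \<partial>circle)"
  proof (intro integral_mono)
    fix z assume "z \<in> space circle"
    then have "cmod (g z - t z) < d" using t(2) norm_circle_eq_1 by blast
    then show "cmod (f z - t z) \<le> cmod (f z - g z) + d"
      using norm_triangle_ineq[of "f z - g z" "g z - t z"] by simp
  qed (use assms i in auto)
  also have "\<dots> = (\<integral>z. cmod (f z - g z) \<partial>circle) + e/2"
    using assms i by (subst Bochner_Integration.integral_add) (auto simp: measure_circle d_def field_simps)
  also have "\<dots> < e" using g by simp
  finally show thesis using t(1) that by blast
qed

text \<open>Prepares applications of dominated convergence. Approximation in L^1 gives no uniform
  bound, so the continuous approximant is cut to the ball of radius \<open>B\<close>; after that a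
  uniform error of at most 1 is harmless. A subsequence then converges a.e.\<close>

lemma bounded_limit_trig_poly:
  fixes u :: "complex \<Rightarrow> complex"
  assumes [measurable]: "u \<in> borel_measurable circle" and bd: "AE z in circle. cmod (u z) \<le> B" and B: "0 \<le> B"
  obtains t :: "nat \<Rightarrow> complex \<Rightarrow> complex" where "\<And>n. trig_poly (t n)" "\<And>n z. cmod z = 1 \<Longrightarrow> cmod (t n z) \<le> B + 1"
    "AE z in circle. (\<lambda>n. t n z) \<longlonglongrightarrow> u z"
proof -
  have iu: "integrable circle u" using bd by (intro integrable_circle_bounded) auto
  have "\<exists>t. trig_poly t \<and> (\<forall>z. cmod z = 1 \<longrightarrow> cmod (t z) \<le> B + 1) \<and> (\<integral>z. cmod (u z - t z) \<partial>circle) < (1 + 2 * pi) * inverse (real (Suc n))" for n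
  proof -
    \<comment> \<open>The factor 1 + 2 pi in the claim adds up the L^1 error \<open>e\<close> of the
      continuous function and the uniform error \<open>e\<close> integrated over the circle.\<close>
    define e where "e = inverse (real (Suc n))"
    have e: "0 < e" "e \<le> 1" by (auto simp: e_def inverse_le_1_iff)
    obtain g where g: "continuous_on UNIV g" "(\<integral>z. cmod (u z - g z) \<partial>circle) < e"
      using integrable_approx_continuous[OF iu] e(1) by blast
    \<comment> \<open>the projection onto the ball of radius \<open>B\<close> is nonexpansive\<close>
    define h where "h = (\<lambda>z. closest_point (cball 0 B) (g z))"
    have ch: "continuous_on UNIV h"
      unfolding h_def using B
      by (intro continuous_on_compose2[OF continuous_on_closest_point g(1)]) auto
    have hB: "cmod (h z) \<le> B" for z
      using closest_point_in_set[of "cball (0::complex) B" "g z"] B by (auto simp: h_def)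
    have uh: "cmod (u z - h z) \<le> cmod (u z - g z)" if "cmod (u z) \<le> B" for z
    proof -
      have "closest_point (cball 0 B) (u z) = u z"
        using that by (intro closest_point_self) auto
      then show ?thesis
        using closest_point_lipschitz[of "cball (0::complex) B" "u z" "g z"] B by (auto simp: h_def dist_norm)
    qed
    obtain t where t: "trig_poly t" "\<And>z. cmod z = 1 \<Longrightarrow> cmod (h z - t z) < e"
      using continuous_approx_trig_poly[OF continuous_on_subset[OF ch] e(1)] by auto
    have i: "integrable circle g" "integrable circle t" "integrable circle h"
      using g(1) ch trig_poly_integrable[OF t(1)] by (auto intro!: integrable_circle_continuous_on intro: continuous_on_subset)
    have "(\<integral>z. cmod (u z - t z) \<partial>circle) \<le> (\<integral>z. cmod (u z - g z) + e \<partial>circle)"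
    proof (intro integral_mono_AE)
      show "AE z in circle. cmod (u z - t z) \<le> cmod (u z - g z) + e"
        using bd AE_circle_norm
      proof eventually_elim
        case (elim z)
        then show ?case
          using norm_triangle_ineq[of "u z - h z" "h z - t z"] uh[of z] t(2)[of z] by simp
      qed
    qed (use iu i in auto)
    also have "\<dots> = (\<integral>z. cmod (u z - g z) \<partial>circle) + 2 * pi * e"
      using iu i by (subst Bochner_Integration.integral_add) (auto simp: measure_circle)
    also have "\<dots> < (1 + 2 * pi) * e" using g by (simp add: distrib_right)
    finally have "(\<integral>z. cmod (u z - t z) \<partial>circle) < (1 + 2 * pi) * e" .
    moreover have "cmod (t z) \<le> B + 1" if "cmod z = 1" for z
      using norm_triangle_ineq3[of "t z" "h z"] t(2)[OF that] hB[of z] e(2)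
      by (simp add: norm_minus_commute abs_le_iff)
    ultimately show ?thesis using t(1) by (auto simp: e_def)
  qed
  then obtain t where t: "\<And>n. trig_poly (t n)" "\<And>n z. cmod z = 1 \<Longrightarrow> cmod (t n z) \<le> B + 1"
    "\<And>n. (\<integral>z. cmod (u z - t n z) \<partial>circle) < (1 + 2 * pi) * inverse (real (Suc n))"
    by metis
  have "(\<lambda>n. (1 + 2 * pi) * inverse (real (Suc n))) \<longlonglongrightarrow> (1 + 2 * pi) * 0"
    by (intro tendsto_intros LIMSEQ_inverse_real_of_nat)
  then have lim0: "(\<lambda>n. (1 + 2 * pi) * inverse (real (Suc n))) \<longlonglongrightarrow> 0" by simp
  have "(\<lambda>n. \<integral>z. cmod (u z - t n z) \<partial>circle) \<longlonglongrightarrow> 0"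
    by (rule tendsto_sandwich[OF always_eventually always_eventually tendsto_const lim0])
      (simp, blast intro: less_imp_le[OF t(3)])
  then obtain r where r: "strict_mono r" "AE z in circle. (\<lambda>n. u z - t (r n) z) \<longlonglongrightarrow> 0"
    using tendsto_L1_AE_subseq[of circle "\<lambda>n z. u z - t n z"] iu t(1) by (auto simp: trig_poly_integrable)
  show thesis
  proof (rule that[of "\<lambda>n. t (r n)"])
    show "AE z in circle. (\<lambda>n. t (r n) z) \<longlonglongrightarrow> u z"
      using r(2)
    proof eventually_elim
      case (elim z)
      then have "(\<lambda>n. u z - (u z - t (r n) z)) \<longlonglongrightarrow> u z - 0" by (intro tendsto_intros)
      then show ?case by simp
    qed
  qed (use t in auto)
qed

section \<open>Uniqueness of Fourier coefficients and the Riemann-Lebesgue lemma\<close>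

lemma integral_mult_trig_poly_eq_0:
  assumes "integrable circle f" "\<And>k. fourier_coeff f k = 0" "trig_poly t"
  shows "(\<integral>z. f z * t z \<partial>circle) = 0"
proof -
  have "integrable circle (\<lambda>z. f z * t z) \<and> (\<integral>z. f z * t z \<partial>circle) = 0"
    using assms(3)
  proof induction
    case (monom c k)
    have "(\<integral>z. f z * z powi k \<partial>circle) = 0"
      using assms(2)[of "-k"] by (simp add: fourier_coeff_def)
    moreover have "(\<lambda>z. f z * (c * z powi k)) = (\<lambda>z. c * (f z * z powi k))" by (simp add: fun_eq_iff)
    ultimately show ?case using powi_times_integrable[OF assms(1)] by simp
  next
    case (add s t)
    then show ?case by (simp add: distrib_left)
  qed
  then show ?thesis by simp
qed

text \<open>\<open>f\<close> is tested against trigonometric polynomials that converge boundedly to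
  its conjugate sign \<open>u\<close>, so the integral of |f| vanishes. Where f = 0, division by
  zero makes \<open>u\<close> equal to 0.\<close>

lemma fourier_coeff_eq_0_imp_AE:
  assumes f: "integrable circle f" and 0: "\<And>k. fourier_coeff f k = 0"
  shows "AE z in circle. f z = 0"
proof -
  have [measurable]: "f \<in> borel_measurable circle" using f by simp
  define u where "u = (\<lambda>z. cnj (f z) / of_real (cmod (f z)))"
  have [measurable]: "u \<in> borel_measurable circle"
    unfolding u_def
    by (intro borel_measurable_divide measurable_compose[OF _ borel_measurable_continuous_onI[of cnj]]
        continuous_intros) measurable
  have u1: "cmod (u z) \<le> 1" for z by (simp add: u_def norm_divide)
  obtain t :: "nat \<Rightarrow> complex \<Rightarrow> complex" where t: "\<And>n. trig_poly (t n)" "\<And>n z. cmod z = 1 \<Longrightarrow> cmod (t n z) \<le> 1 + 1"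
    "AE z in circle. (\<lambda>n. t n z) \<longlonglongrightarrow> u z"
    using bounded_limit_trig_poly[of u 1] u1 by auto
  have [measurable]: "t n \<in> borel_measurable circle" for n
    using trig_poly_integrable[OF t(1)] by simp
  have "(\<lambda>n. \<integral>z. f z * t n z \<partial>circle) \<longlonglongrightarrow> (\<integral>z. f z * u z \<partial>circle)"
  proof (rule integral_dominated_convergence[where w = "\<lambda>z. cmod (f z) * 2"])
    show "AE z in circle. (\<lambda>n. f z * t n z) \<longlonglongrightarrow> f z * u z"
      using t(3) by eventually_elim (intro tendsto_intros)
    show "AE z in circle. norm (f z * t n z) \<le> cmod (f z) * 2" for n
      using AE_circle_norm
      by eventually_elim (use t(2) in \<open>auto simp: norm_mult intro!: mult_left_mono\<close>)
  qed (use f in auto)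
  then have "(\<integral>z. f z * u z \<partial>circle) = 0"
    by (simp add: integral_mult_trig_poly_eq_0[OF f 0 t(1)] LIMSEQ_const_iff)
  moreover have "f z * u z = of_real (cmod (f z))" for z
    by (cases "f z = 0") (simp_all add: u_def complex_norm_square[symmetric] power2_eq_square)
  ultimately have "(\<integral>z. cmod (f z) \<partial>circle) = 0"
    by (simp add: integral_complex_of_real)
  then have "AE z in circle. cmod (f z) = 0"
    using f by (subst (asm) integral_nonneg_eq_0_iff_AE) auto
  then show ?thesis by simp
qed

lemma fourier_coeff_eq_imp_AE:
  assumes "integrable circle f" "integrable circle g" "\<And>k. fourier_coeff f k = fourier_coeff g k"
  shows "AE z in circle. f z = g z"
  using fourier_coeff_eq_0_imp_AE[of "\<lambda>z. f z - g z"] assms by (simp add: fourier_coeff_diff)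

lemma fourier_coeff_trig_poly_eventually_0:
  assumes "trig_poly t"
  shows "\<forall>\<^sub>F n in sequentially. fourier_coeff t (k - int n) = 0"
  using assms
proof induction
  case (monom c j)
  have "\<forall>\<^sub>F n in sequentially. nat (\<bar>k\<bar> + \<bar>j\<bar>) < n" by (rule eventually_gt_at_top)
  then show ?case
    by eventually_elim (auto simp: fourier_coeff_cmult fourier_coeff_powi)
next
  case (add s t)
  from add.IH show ?case
    by eventually_elim (simp add: fourier_coeff_add trig_poly_integrable add.hyps)
qed

text \<open>The index runs to minus infinity because the k-th coefficient of z^n f is the
  coefficient of \<open>f\<close> at k - n. A trigonometric polynomial has no coefficients that far
  out, and the remainder is small in L^1.\<close>

lemma riemann_lebesgue:
  assumes f: "integrable circle f"
  shows "(\<lambda>n. fourier_coeff f (k - int n)) \<longlonglongrightarrow> 0"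
proof (rule LIMSEQ_I)
  fix e :: real assume "e > 0"
  then obtain t where t: "trig_poly t" "(\<integral>z. cmod (f z - t z) \<partial>circle) < e"
    using integrable_approx_trig_poly[OF f] by blast
  obtain m where m: "\<And>n. n \<ge> m \<Longrightarrow> fourier_coeff t (k - int n) = 0"
    using fourier_coeff_trig_poly_eventually_0[OF t(1)] by (auto simp: eventually_sequentially)
  show "\<exists>m. \<forall>n\<ge>m. norm (fourier_coeff f (k - int n) - 0) < e"
  proof (intro exI allI impI)
    fix n assume "n \<ge> m"
    then have "fourier_coeff f (k - int n) = fourier_coeff (\<lambda>z. f z - t z) (k - int n)"
      using m f t by (simp add: fourier_coeff_diff trig_poly_integrable)
    then show "norm (fourier_coeff f (k - int n) - 0) < e"
      using norm_fourier_coeff_le[of "\<lambda>z. f z - t z" "k - int n"] t(2) by simp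
  qed
qed

section \<open>Outer functions\<close>

text \<open>Analyticity is treated apart from the norm: by \<open>hardy_iff\<close> every Hardy
  space is the intersection of \<open>bfs\<close> with \<open>H1\<close>, so invariance under
  multiplications is shown once, in L^1.\<close>

definition H1 :: "(complex \<Rightarrow> complex) set" where
  "H1 = {f. integrable circle f \<and> (\<forall>k<0. fourier_coeff f k = 0)}"

lemma H1_integrable: "f \<in> H1 \<Longrightarrow> integrable circle f"
  by (simp add: H1_def)

lemma H1_add: "f \<in> H1 \<Longrightarrow> g \<in> H1 \<Longrightarrow> (\<lambda>z. f z + g z) \<in> H1"
  by (simp add: H1_def fourier_coeff_add)

lemma H1_diff: "f \<in> H1 \<Longrightarrow> g \<in> H1 \<Longrightarrow> (\<lambda>z. f z - g z) \<in> H1"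
  by (simp add: H1_def fourier_coeff_diff)

lemma H1_cmult: "f \<in> H1 \<Longrightarrow> (\<lambda>z. c * f z) \<in> H1"
  by (simp add: H1_def fourier_coeff_cmult)

lemma H1_0: "(\<lambda>_. 0) \<in> H1"
  by (simp add: H1_def)

lemma H1_const: "(\<lambda>_. c) \<in> H1"
  by (simp add: H1_def fourier_coeff_const)

lemma H1_sum: "(\<And>i. i \<in> I \<Longrightarrow> f i \<in> H1) \<Longrightarrow> (\<lambda>z. \<Sum>i\<in>I. f i z) \<in> H1"
  by (induction I rule: infinite_finite_induct) (auto intro: H1_add H1_0)

lemma H1_cong_AE:
  assumes "f \<in> H1" "g \<in> borel_measurable circle" "AE z in circle. f z = g z"
  shows "g \<in> H1"
proof -
  have f: "f \<in> borel_measurable circle" "integrable circle f"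
    using assms(1) by (auto simp: H1_def)
  have "integrable circle g"
    using integrable_cong_AE[OF f(1) assms(2,3)] f(2) by simp
  then show ?thesis
    using assms fourier_coeff_cong_AE[OF f(1) assms(2,3)] by (simp add: H1_def)
qed

lemma integrable_powi_mult:
  assumes "integrable circle f"
  shows "integrable circle (\<lambda>z. z powi k * f z)"
  using powi_times_integrable[OF assms, of k] by (simp add: mult.commute)

lemma H1_powi_mult:
  assumes "f \<in> H1" "0 \<le> k"
  shows "(\<lambda>z. z powi k * f z) \<in> H1"
  using assms by (simp add: H1_def fourier_coeff_mult_powi integrable_powi_mult)

lemma H1_power_mult: "f \<in> H1 \<Longrightarrow> (\<lambda>z. z ^ n * f z) \<in> H1"
  using H1_powi_mult[of f "int n"] by simp

lemma H1_poly_mult: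
  assumes "f \<in> H1"
  shows "(\<lambda>z. poly p z * f z) \<in> H1"
proof -
  have "(\<lambda>z. \<Sum>i\<le>degree p. coeff p i * (z ^ i * f z)) \<in> H1"
    by (intro H1_sum H1_cmult H1_power_mult assms)
  then show ?thesis
    by (simp add: poly_altdef sum_distrib_right mult.assoc)
qed

lemma H1_limit:
  assumes "\<And>n. F n \<in> H1" "integrable circle f" "(\<lambda>n. \<integral>z. cmod (F n z - f z) \<partial>circle) \<longlonglongrightarrow> 0"
  shows "f \<in> H1"
proof -
  have "fourier_coeff f k = 0" if "k < 0" for k
  proof -
    have "(\<lambda>n. fourier_coeff (F n) k) \<longlonglongrightarrow> fourier_coeff f k"
      by (rule fourier_coeff_tendsto[OF H1_integrable[OF assms(1)] assms(2,3)])
    moreover have "fourier_coeff (F n) k = 0" for n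
      using assms(1) that by (simp add: H1_def)
    ultimately show ?thesis by (simp add: LIMSEQ_const_iff)
  qed
  then show ?thesis using assms(2) by (simp add: H1_def)
qed

text \<open>The closure property behind this section: exponentials of polynomials, of bounded
  logarithms and of log w are reached one after the other by a.e. limits with an integrable
  majorant.\<close>

lemma H1_dominated_limit:
  assumes F: "\<And>n. F n \<in> H1" and [measurable]: "f \<in> borel_measurable circle"
    and lim: "AE z in circle. (\<lambda>n. F n z) \<longlonglongrightarrow> f z"
    and bd: "\<And>n. AE z in circle. cmod (F n z) \<le> g z" and g: "integrable circle g"
  shows "f \<in> H1"
proof -
  have [measurable]: "F n \<in> borel_measurable circle" for n
    using H1_integrable[OF F] by simp
  have f: "integrable circle f"
    by (rule integrable_dominated_convergence[OF _ _ g lim bd]) measurable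
  have "AE z in circle. \<forall>n. cmod (F n z) \<le> g z"
    using bd by (simp add: AE_all_countable)
  then have fg: "AE z in circle. cmod (f z) \<le> g z"
    using lim
  proof eventually_elim
    case (elim z)
    then show ?case by (intro LIMSEQ_le_const2[OF tendsto_norm]) auto
  qed
  have "(\<lambda>n. \<integral>z. cmod (F n z - f z) \<partial>circle) \<longlonglongrightarrow> (\<integral>z. 0 \<partial>circle)"
  proof (rule integral_dominated_convergence[where w = "\<lambda>z. 2 * g z"])
    show "AE z in circle. (\<lambda>n. cmod (F n z - f z)) \<longlonglongrightarrow> 0"
      using lim
    proof eventually_elim
      case (elim z)
      then have "(\<lambda>n. cmod (F n z - f z)) \<longlonglongrightarrow> cmod (f z - f z)" by (intro tendsto_intros)
      then show ?case by simp
    qed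
    show "AE z in circle. norm (cmod (F n z - f z)) \<le> 2 * g z" for n
      using bd[of n] fg
    proof eventually_elim
      case (elim z)
      then show ?case using norm_triangle_ineq4[of "F n z" "f z"] by simp
    qed
  qed (use g in auto)
  then show ?thesis by (intro H1_limit[OF F f]) simp
qed

text \<open>Partial sums of the exponential series are polynomials in z, and on the circle they are
  dominated by exp B, where B bounds |p|.\<close>

lemma H1_exp_poly_mult:
  assumes f: "f \<in> H1"
  shows "(\<lambda>z. exp (poly p z) * f z) \<in> H1"
proof -
  have "compact (poly p ` sphere 0 1)"
    by (intro compact_continuous_image continuous_intros) auto
  then obtain B where "\<forall>x\<in>poly p ` sphere 0 1. cmod x \<le> B"
    using compact_imp_bounded bounded_iff by blast
  then have B: "cmod (poly p z) \<le> B" if "cmod z = 1" for z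
    using that by simp
  have [measurable]: "f \<in> borel_measurable circle" using H1_integrable[OF f] by simp
  have [measurable]: "poly p \<in> borel_measurable circle"
    by (intro borel_measurable_circle_continuous_on continuous_intros)
  have [measurable]: "(\<lambda>z. exp (poly p z)) \<in> borel_measurable circle"
    by (intro borel_measurable_circle_continuous_on continuous_intros)
  show ?thesis
  proof (rule H1_dominated_limit)
    fix n
    have "(\<lambda>z. \<Sum>i<n. inverse (fact i) * (poly (p ^ i) z * f z)) \<in> H1"
      by (intro H1_sum H1_cmult H1_poly_mult f)
    then show "(\<lambda>z. (\<Sum>i<n. poly p z ^ i /\<^sub>R fact i) * f z) \<in> H1"
      by (simp add: sum_distrib_right scaleR_conv_of_real mult.assoc)
    show "AE z in circle. cmod ((\<Sum>i<n. poly p z ^ i /\<^sub>R fact i) * f z) \<le> exp B * cmod (f z)"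
      using AE_circle_norm
    proof eventually_elim
      case (elim z)
      have "cmod (\<Sum>i<n. poly p z ^ i /\<^sub>R fact i) \<le> (\<Sum>i<n. B ^ i /\<^sub>R fact i)"
        by (rule order_trans[OF norm_sum])
           (auto intro!: sum_mono mult_left_mono power_mono B elim simp: norm_power)
      also have "\<dots> \<le> (\<Sum>i. B ^ i /\<^sub>R fact i)"
        using order_trans[OF norm_ge_zero B[OF elim]]
        by (intro sum_le_suminf summable_exp_generic) auto
      also have "\<dots> = exp B" by (simp add: exp_def)
      finally show ?case by (simp add: norm_mult mult_right_mono)
    qed
  next
    show "AE z in circle. (\<lambda>n. (\<Sum>i<n. poly p z ^ i /\<^sub>R fact i) * f z) \<longlonglongrightarrow> exp (poly p z) * f z"
    proof (rule AE_I2)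
      fix z
      have "(\<lambda>i. poly p z ^ i /\<^sub>R fact i) sums exp (poly p z)"
        by (rule exp_converges)
      then show "(\<lambda>n. (\<Sum>i<n. poly p z ^ i /\<^sub>R fact i) * f z) \<longlonglongrightarrow> exp (poly p z) * f z"
        unfolding sums_def by (intro tendsto_intros)
    qed
    show "integrable circle (\<lambda>z. exp B * cmod (f z))"
      using H1_integrable[OF f] by simp
  qed measurable
qed

text \<open>On the circle c z^(-n) is the conjugate of cnj c z^n, so negative powers fold onto
  positive ones without a change of the real part. The constant term can be replaced by its real
  part, as \<open>L2_norm_analytic_le_real_part\<close> demands.\<close>

lemma trig_poly_analytic_part:
  assumes "trig_poly t"
  shows "\<exists>q. Im (coeff q 0) = 0 \<and> (\<forall>z. cmod z = 1 \<longrightarrow> Re (poly q z) = Re (t z))"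
  using assms
proof induction
  case (monom c k)
  consider "k = 0" | "k > 0" | "k < 0" by linarith
  then show ?case
  proof cases
    case 1
    then show ?thesis by (intro exI[of _ "[:of_real (Re c):]"]) simp
  next
    case 2
    then obtain n where n: "k = int n" "n > 0" by (metis zero_less_imp_eq_int)
    then show ?thesis
      by (intro exI[of _ "Polynomial.monom c n"]) (simp add: poly_monom)
  next
    case 3
    then obtain n where n: "- k = int n" "n > 0" by (metis zero_less_imp_eq_int neg_0_less_iff_less)
    have "Re (cnj c * z ^ n) = Re (c * z powi k)" if "cmod z = 1" for z
    proof -
      have "z powi k = inverse (z powi (- k))" by (simp add: power_int_minus)
      also have "\<dots> = inverse z ^ n" using n by (simp add: power_inverse)
      also have "inverse z = cnj z"
        using that by (simp add: inverse_eq_divide divide_conv_cnj)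
      finally have "c * z powi k = cnj (cnj c * z ^ n)" by simp
      then show ?thesis by (simp only: cnj.sel)
    qed
    then show ?thesis using n
      by (intro exI[of _ "Polynomial.monom (cnj c) n"]) (simp add: poly_monom)
  qed
next
  case (add s t)
  then obtain p q where "Im (coeff p 0) = 0" "\<forall>z. cmod z = 1 \<longrightarrow> Re (poly p z) = Re (s z)"
    "Im (coeff q 0) = 0" "\<forall>z. cmod z = 1 \<longrightarrow> Re (poly q z) = Re (t z)" by auto
  then show ?case by (intro exI[of _ "p + q"]) simp
qed

lemma continuous_on_poly_circle: "continuous_on (sphere 0 1) (poly p)" for p :: "complex poly"
  by (intro continuous_intros)

lemma poly_measurable_circle [measurable]: "poly p \<in> borel_measurable circle" for p :: "complex poly"
  by (rule borel_measurable_circle_continuous_on[OF continuous_on_poly_circle])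

lemma integral_poly_circle: "(\<integral>z. poly p z \<partial>circle) = 2 * pi * coeff p 0"
proof -
  have "(\<integral>z. poly p z \<partial>circle) = (\<integral>z. (\<Sum>i\<le>degree p. coeff p i * z powi int i) \<partial>circle)"
    by (simp add: poly_altdef)
  also have "\<dots> = (\<Sum>i\<le>degree p. coeff p i * (\<integral>z. z powi int i \<partial>circle))"
    by (subst Bochner_Integration.integral_sum) (auto simp del: power_int_of_nat)
  also have "\<dots> = (\<Sum>i\<le>degree p. if i = 0 then coeff p 0 * (2 * pi) else 0)"
    by (intro sum.cong) (auto simp: integral_powi_circle simp del: power_int_of_nat)
  also have "\<dots> = 2 * pi * coeff p 0" by simp
  finally show ?thesis .
qed

text \<open>The square of an analytic polynomial \<open>q\<close> has mean value \<open>q(0)\<^sup>2\<close>, so the real part of \<open>q\<close>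
  controls \<open>q\<close> in \<open>L\<^sup>2\<close> if \<open>q(0)\<close> is real.\<close>

lemma L2_norm_analytic_le_real_part:
  assumes "Im (coeff q 0) = 0"
  shows "(\<integral>\<^sup>+z. ennreal ((cmod (poly q z))\<^sup>2) \<partial>circle) \<le> 2 * (\<integral>\<^sup>+z. ennreal ((Re (poly q z))\<^sup>2) \<partial>circle)"
proof -
  have i1: "integrable circle (\<lambda>z. (Re (poly q z))\<^sup>2)" and i2: "integrable circle (poly (q * q))"
    and i3: "integrable circle (\<lambda>z. (cmod (poly q z))\<^sup>2)"
    by (intro integrable_circle_continuous_on continuous_intros)+
  have eq: "(cmod x)\<^sup>2 = 2 * (Re x)\<^sup>2 - Re (x * x)" for x
    by (simp add: cmod_power2, simp add: power2_eq_square)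
  have "(\<integral>z. Re (poly (q * q) z) \<partial>circle) = Re (2 * pi * coeff (q * q) 0)"
    using i2 by (simp only: integral_Re integral_poly_circle)
  also have "\<dots> = 2 * pi * (Re (coeff q 0))\<^sup>2"
    using assms by (simp add: coeff_mult power2_eq_square)
  finally have "0 \<le> (\<integral>z. Re (poly (q * q) z) \<partial>circle)" by simp
  moreover have "(\<integral>z. (cmod (poly q z))\<^sup>2 \<partial>circle)
      = (\<integral>z. 2 * (Re (poly q z))\<^sup>2 - Re (poly (q * q) z) \<partial>circle)"
    unfolding eq by simp
  moreover have "\<dots> = 2 * (\<integral>z. (Re (poly q z))\<^sup>2 \<partial>circle) - (\<integral>z. Re (poly (q * q) z) \<partial>circle)"
    using i1 integrable_Re[OF i2] by (subst Bochner_Integration.integral_diff) (auto simp del: poly_mult)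
  ultimately have le: "(\<integral>z. (cmod (poly q z))\<^sup>2 \<partial>circle) \<le> 2 * (\<integral>z. (Re (poly q z))\<^sup>2 \<partial>circle)"
    by simp
  have "(\<integral>\<^sup>+z. ennreal ((cmod (poly q z))\<^sup>2) \<partial>circle) = ennreal (\<integral>z. (cmod (poly q z))\<^sup>2 \<partial>circle)"
    using i3 by (intro nn_integral_eq_integral) auto
  also have "\<dots> \<le> ennreal (2 * (\<integral>z. (Re (poly q z))\<^sup>2 \<partial>circle))"
    by (rule ennreal_leI[OF le])
  also have "\<dots> = 2 * (\<integral>\<^sup>+z. ennreal ((Re (poly q z))\<^sup>2) \<partial>circle)"
    using i1 by (subst nn_integral_eq_integral) (auto simp: ennreal_mult)
  finally show ?thesis .
qed

lemma strict_mono_dominating: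
  obtains r :: "nat \<Rightarrow> nat" where "strict_mono r" "\<And>k. M k \<le> r k"
proof
  define r where "r = (\<lambda>k. k + (\<Sum>i\<le>k. M i))"
  show "strict_mono r"
    by (rule strict_monoI_Suc) (simp add: r_def)
  show "M k \<le> r k" for k
    using member_le_sum[of k "{..k}" M] by (auto simp: r_def intro: trans_le_add2)
qed

text \<open>Along a subsequence the squared distances are at most 4^(-k). This makes the sum of the
  moduli of the increments integrable, hence finite a.e., and the increments telescope.\<close>

lemma L2_cauchy_limit:
  fixes g :: "nat \<Rightarrow> complex \<Rightarrow> complex"
  assumes [measurable]: "\<And>n. g n \<in> borel_measurable circle"
    and cauchy: "\<And>e. e > 0 \<Longrightarrow> \<exists>N. \<forall>m\<ge>N. \<forall>n\<ge>N. (\<integral>\<^sup>+z. ennreal ((cmod (g m z - g n z))\<^sup>2) \<partial>circle) \<le> ennreal e"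
  obtains r h where "strict_mono r" "h \<in> borel_measurable circle" "AE z in circle. (\<lambda>n. g (r n) z) \<longlonglongrightarrow> h z"
proof -
  have "\<exists>N. \<forall>m\<ge>N. \<forall>n\<ge>N. (\<integral>\<^sup>+z. ennreal ((cmod (g m z - g n z))\<^sup>2) \<partial>circle) \<le> ennreal ((1/4)^k)" for k :: nat
    by (rule cauchy) simp
  then obtain M where M: "\<And>k m n. M k \<le> m \<Longrightarrow> M k \<le> n \<Longrightarrow>
      (\<integral>\<^sup>+z. ennreal ((cmod (g m z - g n z))\<^sup>2) \<partial>circle) \<le> ennreal ((1/4)^k)" by metis
  obtain r where r: "strict_mono r" "\<And>k. M k \<le> r k"
    using strict_mono_dominating[of M] by blast
  define d where "d = (\<lambda>k z. g (r (Suc k)) z - g (r k) z)"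
  have [measurable]: "d k \<in> borel_measurable circle" for k by (simp add: d_def)
  have int: "(\<integral>\<^sup>+z. ennreal (cmod (d k z)) \<partial>circle) \<le> ennreal ((1 + 2 * pi) * (1/2)^k)" for k
  proof -
    \<comment> \<open>Takes the place of Cauchy-Schwarz: 2^k multiplies a square integral of at most
      4^(-k), and the additive 2^(-k) is integrated over a total mass of 2 pi.\<close>
    have amgm: "x \<le> 2^k * x\<^sup>2 + (1/2)^k" for x :: real
    proof -
      have "0 \<le> (2^k * x - 1)\<^sup>2 + (2^k*x)\<^sup>2 + 1" by simp
      then have "2 * (2^k * x) \<le> 2 * ((2^k * x)\<^sup>2 + 1)" by (simp add: power2_eq_square algebra_simps)
      then have "2^k * x \<le> 2^k * (2^k * x\<^sup>2 + (1/2)^k)"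
        by (simp add: power2_eq_square algebra_simps flip: power_mult_distrib)
      then show ?thesis by (rule mult_left_le_imp_le) simp
    qed
    have "(\<integral>\<^sup>+z. ennreal (cmod (d k z)) \<partial>circle) \<le> (\<integral>\<^sup>+z. ennreal (2^k) * ennreal ((cmod (d k z))\<^sup>2) + ennreal ((1/2)^k) \<partial>circle)"
      using amgm by (intro nn_integral_mono) (simp flip: ennreal_mult ennreal_plus)
    also have "\<dots> = ennreal (2^k) * (\<integral>\<^sup>+z. ennreal ((cmod (d k z))\<^sup>2) \<partial>circle) + ennreal ((1/2)^k) * ennreal (2 * pi)"
      by (simp add: nn_integral_add nn_integral_cmult emeasure_circle)
    also have "\<dots> \<le> ennreal (2^k) * ennreal ((1/4)^k) + ennreal ((1/2)^k) * ennreal (2 * pi)"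
    proof -
      have "M k \<le> r (Suc k)"
        using r(2)[of k] strict_mono_less_eq[OF r(1), of k "Suc k"] by simp
      then show ?thesis
        unfolding d_def by (intro add_right_mono mult_left_mono M r(2)) auto
    qed
    also have "\<dots> = ennreal ((1 + 2 * pi) * (1/2)^k)"
      by (simp add: algebra_simps flip: ennreal_mult ennreal_plus power_mult_distrib)
    finally show ?thesis .
  qed
  have "(\<integral>\<^sup>+z. (\<Sum>k. ennreal (cmod (d k z))) \<partial>circle) = (\<Sum>k. \<integral>\<^sup>+z. ennreal (cmod (d k z)) \<partial>circle)"
    by (intro nn_integral_suminf) measurable
  also have "\<dots> \<le> (\<Sum>k. ennreal ((1 + 2 * pi) * (1/2)^k))"
    by (intro suminf_le int) auto
  also have "\<dots> = ennreal (\<Sum>k. (1 + 2 * pi) * (1/2)^k)"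
    by (intro suminf_ennreal2 summable_mult summable_geometric) auto
  finally have "(\<integral>\<^sup>+z. (\<Sum>k. ennreal (cmod (d k z))) \<partial>circle) \<noteq> \<infinity>"
    unfolding infinity_ennreal_def by (rule neq_top_trans[OF ennreal_neq_top])
  then have "AE z in circle. (\<Sum>k. ennreal (cmod (d k z))) \<noteq> \<infinity>"
    by (intro nn_integral_PInf_AE) auto
  then have conv: "AE z in circle. convergent (\<lambda>n. g (r n) z)"
  proof eventually_elim
    case (elim z)
    then have "summable (\<lambda>k. cmod (d k z))"
      by (intro summable_suminf_not_top) auto
    then have "summable (\<lambda>k. d k z)" by (rule summable_norm_cancel)
    then have "(\<lambda>n. \<Sum>k<n. d k z) \<longlonglongrightarrow> (\<Sum>k. d k z)" by (rule summable_LIMSEQ)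
    moreover have "(\<Sum>k<n. d k z) = g (r n) z - g (r 0) z" for n
      unfolding d_def by (rule sum_lessThan_telescope)
    ultimately have "(\<lambda>n. (g (r n) z - g (r 0) z) + g (r 0) z) \<longlonglongrightarrow> (\<Sum>k. d k z) + g (r 0) z"
      by (intro tendsto_intros) simp
    then show ?case by (auto simp: convergent_def)
  qed
  show thesis
  proof (rule that[OF r(1)])
    show "(\<lambda>z. lim (\<lambda>n. g (r n) z)) \<in> borel_measurable circle" by measurable
    show "AE z in circle. (\<lambda>n. g (r n) z) \<longlonglongrightarrow> lim (\<lambda>n. g (r n) z)"
      using conv by eventually_elim (simp add: convergent_LIMSEQ_iff)
  qed
qed

text \<open>Logarithms of outer functions that are bounded above and below.\<close>

definition bounded_outer_log :: "(complex \<Rightarrow> complex) \<Rightarrow> bool" where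
  "bounded_outer_log h \<longleftrightarrow> h \<in> borel_measurable circle \<and>
     (\<exists>q B. (\<forall>j. Im (coeff (q j) 0) = 0) \<and> (\<forall>j z. cmod z = 1 \<longrightarrow> \<bar>Re (poly (q j) z)\<bar> \<le> B) \<and>
       (AE z in circle. (\<lambda>j. poly (q j) z) \<longlonglongrightarrow> h z))"

lemma nn_integral_dominated_square_tendsto:
  fixes F :: "nat \<Rightarrow> complex \<Rightarrow> real"
  assumes [measurable]: "\<And>n. F n \<in> borel_measurable circle" "f \<in> borel_measurable circle"
    and lim: "AE z in circle. (\<lambda>n. F n z) \<longlonglongrightarrow> f z"
    and bd: "\<And>n. AE z in circle. (F n z)\<^sup>2 \<le> g z" and g: "integrable circle g"
  shows "(\<lambda>n. \<integral>\<^sup>+z. ennreal ((F n z)\<^sup>2) \<partial>circle) \<longlonglongrightarrow> (\<integral>\<^sup>+z. ennreal ((f z)\<^sup>2) \<partial>circle)"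
proof (rule nn_integral_dominated_convergence[where w = "\<lambda>z. ennreal (g z)"])
  have "AE z in circle. 0 \<le> g z"
    using bd[of 0] by eventually_elim (meson order_trans zero_le_power2)
  then show "(\<integral>\<^sup>+ z. ennreal (g z) \<partial>circle) < \<infinity>"
    using nn_integral_eq_integral[OF g] by simp
  show "AE z in circle. ennreal ((F j z)\<^sup>2) \<le> ennreal (g z)" for j
    using bd[of j] by eventually_elim (rule ennreal_leI)
  show "AE z in circle. (\<lambda>i. ennreal ((F i z)\<^sup>2)) \<longlonglongrightarrow> ennreal ((f z)\<^sup>2)"
    using lim by eventually_elim (intro tendsto_intros)
qed (use g in measurable)

text \<open>\<open>L2_norm_analytic_le_real_part\<close> holds for the differences of the
  polynomials. Their real parts are uniformly bounded, which allows dominated convergence on the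
  right; the polynomials themselves have no such bound, hence Fatou's lemma on the left.\<close>

lemma bounded_outer_log_L2:
  assumes "bounded_outer_log h" "bounded_outer_log h'"
  shows "(\<integral>\<^sup>+z. ennreal ((cmod (h z - h' z))\<^sup>2) \<partial>circle) \<le> 2 * (\<integral>\<^sup>+z. ennreal ((Re (h z) - Re (h' z))\<^sup>2) \<partial>circle)"
proof -
  from assms(1) obtain q B where q: "\<And>j. Im (coeff (q j) 0) = 0"
    "\<And>j z. cmod z = 1 \<Longrightarrow> \<bar>Re (poly (q j) z)\<bar> \<le> B" "AE z in circle. (\<lambda>j. poly (q j) z) \<longlonglongrightarrow> h z"
    and [measurable]: "h \<in> borel_measurable circle"
    unfolding bounded_outer_log_def by blast
  from assms(2) obtain q' B' where q': "\<And>j. Im (coeff (q' j) 0) = 0"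
    "\<And>j z. cmod z = 1 \<Longrightarrow> \<bar>Re (poly (q' j) z)\<bar> \<le> B'" "AE z in circle. (\<lambda>j. poly (q' j) z) \<longlonglongrightarrow> h' z"
    and [measurable]: "h' \<in> borel_measurable circle"
    unfolding bounded_outer_log_def by blast
  have lim: "(\<lambda>j. \<integral>\<^sup>+z. ennreal ((Re (poly (q j) z) - Re (poly (q' j) z))\<^sup>2) \<partial>circle)
      \<longlonglongrightarrow> (\<integral>\<^sup>+z. ennreal ((Re (h z) - Re (h' z))\<^sup>2) \<partial>circle)"
  proof (rule nn_integral_dominated_square_tendsto)
    show "AE z in circle. (\<lambda>j. Re (poly (q j) z) - Re (poly (q' j) z)) \<longlonglongrightarrow> Re (h z) - Re (h' z)"
      using q(3) q'(3) by eventually_elim (intro tendsto_intros)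
    show "AE z in circle. (Re (poly (q j) z) - Re (poly (q' j) z))\<^sup>2 \<le> (B + B')\<^sup>2" for j
      using AE_circle_norm
    proof eventually_elim
      case (elim z)
      then show ?case
        using q(2)[of z j] q'(2)[of z j] by (intro abs_le_square_iff[THEN iffD1]) (simp add: abs_if split: if_splits)
    qed
  qed simp_all
  have "(\<integral>\<^sup>+z. ennreal ((cmod (h z - h' z))\<^sup>2) \<partial>circle)
      = (\<integral>\<^sup>+z. liminf (\<lambda>j. ennreal ((cmod (poly (q j) z - poly (q' j) z))\<^sup>2)) \<partial>circle)"
  proof (rule nn_integral_cong_AE)
    show "AE z in circle. ennreal ((cmod (h z - h' z))\<^sup>2) = liminf (\<lambda>j. ennreal ((cmod (poly (q j) z - poly (q' j) z))\<^sup>2))"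
      using q(3) q'(3)
    proof eventually_elim
      case (elim z)
      then have "(\<lambda>j. ennreal ((cmod (poly (q j) z - poly (q' j) z))\<^sup>2)) \<longlonglongrightarrow> ennreal ((cmod (h z - h' z))\<^sup>2)"
        by (intro tendsto_intros)
      then show ?case by (intro lim_imp_Liminf[symmetric]) auto
    qed
  qed
  also have "\<dots> \<le> liminf (\<lambda>j. \<integral>\<^sup>+z. ennreal ((cmod (poly (q j) z - poly (q' j) z))\<^sup>2) \<partial>circle)"
    by (rule nn_integral_liminf) measurable
  also have "\<dots> \<le> liminf (\<lambda>j. 2 * (\<integral>\<^sup>+z. ennreal ((Re (poly (q j) z) - Re (poly (q' j) z))\<^sup>2) \<partial>circle))"
    using L2_norm_analytic_le_real_part[of "q j - q' j" for j] q(1) q'(1)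
    by (intro Liminf_mono always_eventually allI) simp
  also have "\<dots> = 2 * (\<integral>\<^sup>+z. ennreal ((Re (h z) - Re (h' z))\<^sup>2) \<partial>circle)"
    using tendsto_mult_ennreal[OF tendsto_const lim, of 2] by (intro lim_imp_Liminf) auto
  finally show ?thesis .
qed

lemma nn_integral_square_triangle:
  fixes f g k :: "complex \<Rightarrow> real"
  assumes [measurable]: "f \<in> borel_measurable circle" "g \<in> borel_measurable circle" "k \<in> borel_measurable circle"
  shows "(\<integral>\<^sup>+z. ennreal ((f z - g z)\<^sup>2) \<partial>circle)
    \<le> 2 * (\<integral>\<^sup>+z. ennreal ((f z - k z)\<^sup>2) \<partial>circle) + 2 * (\<integral>\<^sup>+z. ennreal ((g z - k z)\<^sup>2) \<partial>circle)"
proof -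
  have *: "(x - y)\<^sup>2 \<le> 2 * (x - u)\<^sup>2 + 2 * (y - u)\<^sup>2" for x y u :: real
  proof -
    have "0 \<le> ((x - u) + (y - u))\<^sup>2" by simp
    then show ?thesis by (simp add: power2_eq_square algebra_simps)
  qed
  have "(\<integral>\<^sup>+z. ennreal ((f z - g z)\<^sup>2) \<partial>circle) \<le> (\<integral>\<^sup>+z. 2 * ennreal ((f z - k z)\<^sup>2) + 2 * ennreal ((g z - k z)\<^sup>2) \<partial>circle)"
  proof (rule nn_integral_mono)
    fix z
    have "ennreal ((f z - g z)\<^sup>2) \<le> ennreal (2 * (f z - k z)\<^sup>2 + 2 * (g z - k z)\<^sup>2)"
      by (rule ennreal_leI[OF *])
    then show "ennreal ((f z - g z)\<^sup>2) \<le> 2 * ennreal ((f z - k z)\<^sup>2) + 2 * ennreal ((g z - k z)\<^sup>2)"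
      by (simp add: ennreal_mult)
  qed
  then show ?thesis by (simp add: nn_integral_add nn_integral_cmult)
qed

lemma ennreal_cauchy_from_null:
  fixes a :: "nat \<Rightarrow> ennreal" and c :: real
  assumes "a \<longlonglongrightarrow> 0" "e > 0" "c > 0" and d: "\<And>m n. d m n \<le> ennreal c * (a m + a n)"
  shows "\<exists>N. \<forall>m\<ge>N. \<forall>n\<ge>N. d m n \<le> ennreal e"
proof -
  have "\<forall>\<^sub>F n in sequentially. a n < ennreal (e / (2 * c))"
    using assms by (intro order_tendstoD(2)) auto
  then obtain N where N: "\<And>n. n \<ge> N \<Longrightarrow> a n < ennreal (e / (2 * c))"
    by (auto simp: eventually_sequentially)
  have "d m n \<le> ennreal e" if "m \<ge> N" "n \<ge> N" for m n
  proof -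
    have "d m n \<le> ennreal c * (ennreal (e / (2 * c)) + ennreal (e / (2 * c)))"
      by (rule order_trans[OF d]) (intro mult_left_mono add_mono less_imp_le N that; use assms in simp)
    also have "\<dots> = ennreal e"
      using assms by (simp flip: ennreal_plus ennreal_mult)
    finally show ?thesis .
  qed
  then show ?thesis by blast
qed

text \<open>The harmonic conjugate of \<open>u\<close> is found by completeness: analytic
  polynomials whose real parts tend to \<open>u\<close> boundedly form a Cauchy sequence in L^2, and
  a subsequence converges a.e. to \<open>h\<close>.\<close>

lemma bounded_outer_log_exists:
  fixes u :: "complex \<Rightarrow> real"
  assumes [measurable]: "u \<in> borel_measurable circle" and bd: "\<And>z. \<bar>u z\<bar> \<le> B"
  obtains h where "bounded_outer_log h" "AE z in circle. Re (h z) = u z"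
proof -
  have B: "0 \<le> B" using bd[of undefined] by linarith
  obtain t :: "nat \<Rightarrow> complex \<Rightarrow> complex" where t: "\<And>n. trig_poly (t n)" "\<And>n z. cmod z = 1 \<Longrightarrow> cmod (t n z) \<le> B + 1"
    "AE z in circle. (\<lambda>n. t n z) \<longlonglongrightarrow> complex_of_real (u z)"
    using bounded_limit_trig_poly[of "\<lambda>z. complex_of_real (u z)" B] B bd by auto
  have "\<forall>n. \<exists>q. Im (coeff q 0) = 0 \<and> (\<forall>z. cmod z = 1 \<longrightarrow> Re (poly q z) = Re (t n z))"
    using trig_poly_analytic_part[OF t(1)] by blast
  then obtain q where q: "\<And>n. Im (coeff (q n) 0) = 0" "\<And>n z. cmod z = 1 \<Longrightarrow> Re (poly (q n) z) = Re (t n z)"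
    by metis
  have qB: "\<bar>Re (poly (q n) z)\<bar> \<le> B + 1" if "cmod z = 1" for n z
    using q(2)[OF that] t(2)[OF that, of n] abs_Re_le_cmod[of "t n z"] by (metis order_trans)
  have lim: "AE z in circle. (\<lambda>n. Re (poly (q n) z)) \<longlonglongrightarrow> u z"
    using t(3) AE_circle_norm
  proof eventually_elim
    case (elim z)
    then show ?case using tendsto_Re[OF elim(1)] by (simp add: q(2))
  qed
  define a where "a = (\<lambda>n. \<integral>\<^sup>+z. ennreal ((Re (poly (q n) z) - u z)\<^sup>2) \<partial>circle)"
  have "a \<longlonglongrightarrow> (\<integral>\<^sup>+z. ennreal (0\<^sup>2) \<partial>circle)"
    unfolding a_def
  proof (rule nn_integral_dominated_square_tendsto)
    show "AE z in circle. (\<lambda>n. Re (poly (q n) z) - u z) \<longlonglongrightarrow> 0"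
      using lim by eventually_elim (simp add: LIM_zero)
    show "AE z in circle. (Re (poly (q n) z) - u z)\<^sup>2 \<le> (B + 1 + B)\<^sup>2" for n
      using AE_circle_norm
    proof eventually_elim
      case (elim z)
      then show ?case
        using qB[of z n] bd[of z] by (intro abs_le_square_iff[THEN iffD1]) (simp add: abs_if split: if_splits)
    qed
  qed simp_all
  then have a: "a \<longlonglongrightarrow> 0" by simp
  have "(\<integral>\<^sup>+z. ennreal ((cmod (poly (q m) z - poly (q n) z))\<^sup>2) \<partial>circle) \<le> ennreal 4 * (a m + a n)" for m n
  proof -
    have "(\<integral>\<^sup>+z. ennreal ((cmod (poly (q m) z - poly (q n) z))\<^sup>2) \<partial>circle)
        \<le> 2 * (\<integral>\<^sup>+z. ennreal ((Re (poly (q m) z) - Re (poly (q n) z))\<^sup>2) \<partial>circle)"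
      using L2_norm_analytic_le_real_part[of "q m - q n"] q(1) by simp
    \<comment> \<open>One factor 2 is the passage from the real part to the whole function, the
      other the triangle inequality for squares; together they give the 4.\<close>
    also have "\<dots> \<le> 2 * (2 * a m + 2 * a n)"
      unfolding a_def by (intro mult_left_mono nn_integral_square_triangle) auto
    also have "\<dots> = ennreal 4 * (a m + a n)"
      by (simp add: distrib_left flip: mult.assoc)
    finally show ?thesis .
  qed
  then have cauchy: "\<exists>N. \<forall>m\<ge>N. \<forall>n\<ge>N. (\<integral>\<^sup>+z. ennreal ((cmod (poly (q m) z - poly (q n) z))\<^sup>2) \<partial>circle) \<le> ennreal e" if "e > 0" for e
    by (intro ennreal_cauchy_from_null[OF a that, of 4]) simp_all
  obtain r h where r: "strict_mono r" and [measurable]: "h \<in> borel_measurable circle"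
    and h: "AE z in circle. (\<lambda>n. poly (q (r n)) z) \<longlonglongrightarrow> h z"
    by (rule L2_cauchy_limit[of "\<lambda>n. poly (q n)", OF poly_measurable_circle cauchy])
  show thesis
  proof (rule that)
    show "bounded_outer_log h"
      unfolding bounded_outer_log_def
      using q(1) qB h by (intro conjI exI[of _ "\<lambda>n. q (r n)"] exI[of _ "B + 1"]) auto
    show "AE z in circle. Re (h z) = u z"
      using h lim
    proof eventually_elim
      case (elim z)
      have "(\<lambda>n. Re (poly (q (r n)) z)) \<longlonglongrightarrow> u z"
        using LIMSEQ_subseq_LIMSEQ[OF elim(2) r] by (simp add: o_def)
      then show ?case using tendsto_Re[OF elim(1)] LIMSEQ_unique by blast
    qed
  qed
qed

text \<open>The bound on the real parts is two-sided, so both exp h and exp (-h) are limits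
  dominated by exp B. The sign -1 serves division by the outer function.\<close>

lemma H1_exp_bounded_outer_log_mult:
  assumes "bounded_outer_log h" "f \<in> H1" "c \<in> {1, -1}"
  shows "(\<lambda>z. exp (c * h z) * f z) \<in> H1"
proof -
  from assms(1) obtain q B where q: "\<And>j z. cmod z = 1 \<Longrightarrow> \<bar>Re (poly (q j) z)\<bar> \<le> B"
      "AE z in circle. (\<lambda>j. poly (q j) z) \<longlonglongrightarrow> h z"
    and [measurable]: "h \<in> borel_measurable circle"
    unfolding bounded_outer_log_def by blast
  have [measurable]: "f \<in> borel_measurable circle" using H1_integrable[OF assms(2)] by simp
  show ?thesis
  proof (rule H1_dominated_limit)
    show "(\<lambda>z. exp (poly (smult c (q j)) z) * f z) \<in> H1" for j
      by (rule H1_exp_poly_mult[OF assms(2)])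
    show "AE z in circle. cmod (exp (poly (smult c (q j)) z) * f z) \<le> exp B * cmod (f z)" for j
      using AE_circle_norm
    proof eventually_elim
      case (elim z)
      have "Re (c * poly (q j) z) \<le> B" using q(1)[OF elim, of j] assms(3) by auto
      then show ?case by (simp add: norm_mult mult_right_mono)
    qed
    show "AE z in circle. (\<lambda>j. exp (poly (smult c (q j)) z) * f z) \<longlonglongrightarrow> exp (c * h z) * f z"
      using q(2) unfolding poly_smult by eventually_elim (intro tendsto_intros)
    show "integrable circle (\<lambda>z. exp B * cmod (f z))"
      using H1_integrable[OF assms(2)] by simp
  qed measurable
qed

text \<open>For y \<ge> 1 one has ln y = 2 ln (sqrt y) \<le> 2 sqrt y, and this is applied to x or
  to 1/x. It turns integrability of w and 1/w into square integrability of log w.\<close>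

lemma ln_square_le:
  fixes x :: real
  assumes "x > 0"
  shows "(ln x)\<^sup>2 \<le> 4 * (x + 1 / x)"
proof -
  have *: "(ln y)\<^sup>2 \<le> 4 * y" if "y \<ge> 1" for y :: real
  proof -
    have "ln y = 2 * ln (sqrt y)" using that by (simp add: ln_sqrt)
    also have "\<dots> \<le> 2 * sqrt y"
      using that ln_le_minus_one[of "sqrt y"] by simp
    finally have "(ln y)\<^sup>2 \<le> (2 * sqrt y)\<^sup>2"
      using that by (intro power_mono) auto
    then show ?thesis using that by (simp add: power_mult_distrib)
  qed
  show ?thesis
  proof (cases "x \<ge> 1")
    case True
    then show ?thesis using *[OF True] assms by (simp add: add_increasing2 distrib_left)
  next
    case False
    then have "(ln (1/x))\<^sup>2 \<le> 4 * (1/x)" using assms by (intro *) simp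
    then show ?thesis using assms by (simp add: ln_div add_increasing distrib_left)
  qed
qed

text \<open>The logarithm of \<open>w\<close> is square integrable, so it is the real part of an \<open>L\<^sup>2\<close> limit \<open>h\<close> of
  analytic polynomials, and \<open>W = exp h\<close>. Multiplication by \<open>W\<close> or by \<open>1/W\<close> preserves analyticity
  because this holds for the exponentials of the truncated logarithms, by domination.\<close>

lemma outer_function_exists:
  fixes w :: "complex \<Rightarrow> real"
  assumes [measurable]: "w \<in> borel_measurable circle" and pos: "AE z in circle. 0 < w z"
    and int: "integrable circle w" "integrable circle (\<lambda>z. 1 / w z)"
  obtains W where "W \<in> borel_measurable circle" "\<And>z. W z \<noteq> 0" "AE z in circle. cmod (W z) = w z"
    "\<And>f. f \<in> H1 \<Longrightarrow> integrable circle (\<lambda>z. of_real (w z) * f z) \<Longrightarrow> (\<lambda>z. W z * f z) \<in> H1"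
    "\<And>f. f \<in> H1 \<Longrightarrow> integrable circle (\<lambda>z. f z / of_real (w z)) \<Longrightarrow> (\<lambda>z. f z / W z) \<in> H1"
proof -
  \<comment> \<open>Truncation at level m makes the logarithm bounded, as
    \<open>bounded_outer_log_exists\<close> requires.\<close>
  define u where "u = (\<lambda>(m::nat) z. max (- real m) (min (real m) (ln (w z))))"
  have [measurable]: "u m \<in> borel_measurable circle" for m unfolding u_def by measurable
  have "\<exists>h. bounded_outer_log h \<and> (AE z in circle. Re (h z) = u m z)" for m
  proof -
    have "\<bar>u m z\<bar> \<le> real m" for z by (auto simp: u_def abs_le_iff)
    then show ?thesis using bounded_outer_log_exists[of "u m" "real m"] by (metis \<open>\<And>m. u m \<in> borel_measurable circle\<close>)
  qed
  then obtain h where h: "\<And>m. bounded_outer_log (h m)" "\<And>m. AE z in circle. Re (h m z) = u m z"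
    by metis
  have hm [measurable]: "h m \<in> borel_measurable circle" for m
    using h(1)[of m] by (simp add: bounded_outer_log_def)
  have ulim: "(\<lambda>m. u m z) \<longlonglongrightarrow> ln (w z)" for z
  proof (rule tendsto_eventually)
    have "\<forall>\<^sub>F m in sequentially. \<bar>ln (w z)\<bar> \<le> real m"
      using filterlim_real_sequentially by (simp add: filterlim_at_top)
    then show "\<forall>\<^sub>F m in sequentially. u m z = ln (w z)"
      by eventually_elim (auto simp: u_def)
  qed
  have uabs: "\<bar>u m z\<bar> \<le> \<bar>ln (w z)\<bar>" "\<bar>u m z - ln (w z)\<bar> \<le> \<bar>ln (w z)\<bar>" for m z
    by (auto simp: u_def)
  define a where "a = (\<lambda>m. \<integral>\<^sup>+z. ennreal ((u m z - ln (w z))\<^sup>2) \<partial>circle)"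
  have "a \<longlonglongrightarrow> (\<integral>\<^sup>+z. ennreal (0\<^sup>2) \<partial>circle)"
    unfolding a_def
  proof (rule nn_integral_dominated_square_tendsto)
    show "AE z in circle. (\<lambda>m. u m z - ln (w z)) \<longlonglongrightarrow> 0"
      by (simp add: LIM_zero[OF ulim])
    show "AE z in circle. (u m z - ln (w z))\<^sup>2 \<le> 4 * (w z + 1 / w z)" for m
      using pos
    proof eventually_elim
      case (elim z)
      have "(u m z - ln (w z))\<^sup>2 \<le> (ln (w z))\<^sup>2"
        using uabs(2) by (rule abs_le_square_iff[THEN iffD1])
      then show ?case using ln_square_le[OF elim] by simp
    qed
    show "integrable circle (\<lambda>z. 4 * (w z + 1 / w z))"
      by (intro Bochner_Integration.integrable_mult_right Bochner_Integration.integrable_add int)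
  qed simp_all
  then have a: "a \<longlonglongrightarrow> 0" by simp
  have "(\<integral>\<^sup>+z. ennreal ((cmod (h m z - h n z))\<^sup>2) \<partial>circle) \<le> ennreal 4 * (a m + a n)" for m n
  proof -
    have "(\<integral>\<^sup>+z. ennreal ((cmod (h m z - h n z))\<^sup>2) \<partial>circle)
        \<le> 2 * (\<integral>\<^sup>+z. ennreal ((Re (h m z) - Re (h n z))\<^sup>2) \<partial>circle)"
      by (rule bounded_outer_log_L2[OF h(1) h(1)])
    also have "(\<integral>\<^sup>+z. ennreal ((Re (h m z) - Re (h n z))\<^sup>2) \<partial>circle) = (\<integral>\<^sup>+z. ennreal ((u m z - u n z)\<^sup>2) \<partial>circle)"
    proof (rule nn_integral_cong_AE)
      show "AE z in circle. ennreal ((Re (h m z) - Re (h n z))\<^sup>2) = ennreal ((u m z - u n z)\<^sup>2)"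
        using h(2)[of m] h(2)[of n] by eventually_elim simp
    qed
    also have "2 * \<dots> \<le> 2 * (2 * a m + 2 * a n)"
      unfolding a_def by (intro mult_left_mono nn_integral_square_triangle) auto
    also have "\<dots> = ennreal 4 * (a m + a n)"
      by (simp add: distrib_left flip: mult.assoc)
    finally show ?thesis .
  qed
  then have cauchy: "\<exists>N. \<forall>m\<ge>N. \<forall>n\<ge>N. (\<integral>\<^sup>+z. ennreal ((cmod (h m z - h n z))\<^sup>2) \<partial>circle) \<le> ennreal e" if "e > 0" for e
    by (intro ennreal_cauchy_from_null[OF a that, of 4]) simp_all
  obtain r H where r: "strict_mono r" and [measurable]: "H \<in> borel_measurable circle"
    and H: "AE z in circle. (\<lambda>n. h (r n) z) \<longlonglongrightarrow> H z"
    by (rule L2_cauchy_limit[of h, OF hm cauchy])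
  have all: "AE z in circle. \<forall>m. Re (h m z) = u m z"
    using h(2) by (simp add: AE_all_countable)
  have ReH: "AE z in circle. Re (H z) = ln (w z)"
    using H all
  proof eventually_elim
    case (elim z)
    have "(\<lambda>n. u (r n) z) \<longlonglongrightarrow> ln (w z)"
      using LIMSEQ_subseq_LIMSEQ[OF ulim r] by (simp add: o_def)
    then show ?case using tendsto_Re[OF elim(1)] elim(2) LIMSEQ_unique by force
  qed
  \<comment> \<open>Both signs at once. The truncated logarithm lies between 0 and log w, so c times
    it has an exponential of at most max 1 (w^c) \<le> 1 + w^c. This is the origin of the majorant
    |f| + w^c |f|.\<close>
  have mult: "(\<lambda>z. exp (c * H z) * f z) \<in> H1"
    if f: "f \<in> H1" and c: "c \<in> {1, -1}" and fi: "integrable circle (\<lambda>z. of_real (w z powr Re c) * f z)" for c f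
  proof (rule H1_dominated_limit)
    have [measurable]: "f \<in> borel_measurable circle" using H1_integrable[OF f] by simp
    show "(\<lambda>z. exp (c * h (r n) z) * f z) \<in> H1" for n
      by (rule H1_exp_bounded_outer_log_mult[OF h(1) f c])
    show "(\<lambda>z. exp (c * H z) * f z) \<in> borel_measurable circle" by measurable
    show "AE z in circle. (\<lambda>n. exp (c * h (r n) z) * f z) \<longlonglongrightarrow> exp (c * H z) * f z"
      using H by eventually_elim (intro tendsto_intros)
    show "integrable circle (\<lambda>z. cmod (f z) + cmod (of_real (w z powr Re c) * f z))"
      using fi H1_integrable[OF f] by simp
    show "AE z in circle. cmod (exp (c * h (r n) z) * f z) \<le> cmod (f z) + cmod (of_real (w z powr Re c) * f z)" for n
      using all pos
    proof eventually_elim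
      case (elim z)
      have "Re (c * h (r n) z) = Re c * u (r n) z" using c elim(1) by auto
      moreover have "Re c * u (r n) z \<le> max 0 (Re c * ln (w z))"
        using c by (auto simp: u_def)
      ultimately have "exp (Re (c * h (r n) z)) \<le> max 1 (exp (Re c * ln (w z)))"
        by (auto simp: max_def split: if_splits)
      also have "\<dots> \<le> 1 + w z powr Re c" using elim(2) by (simp add: powr_def)
      finally have "exp (Re (c * h (r n) z)) * cmod (f z) \<le> (1 + w z powr Re c) * cmod (f z)"
        by (rule mult_right_mono) simp
      then show ?case by (simp add: norm_mult distrib_right)
    qed
  qed
  show thesis
  proof (rule that[of "\<lambda>z. exp (H z)"])
    show "AE z in circle. cmod (exp (H z)) = w z"
      using ReH pos by eventually_elim simp
    fix f assume f: "f \<in> H1"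
    have [measurable]: "f \<in> borel_measurable circle" using H1_integrable[OF f] by simp
    show "(\<lambda>z. exp (H z) * f z) \<in> H1" if "integrable circle (\<lambda>z. of_real (w z) * f z)"
    proof -
      have "integrable circle (\<lambda>z. of_real (w z powr Re 1) * f z)"
        using that by (rule integrable_cong_AE[THEN iffD1, rotated -1]) (use pos in auto)
      then show ?thesis using mult[OF f, of 1] by simp
    qed
    show "(\<lambda>z. f z / exp (H z)) \<in> H1" if "integrable circle (\<lambda>z. f z / of_real (w z))"
    proof -
      have "integrable circle (\<lambda>z. of_real (w z powr Re (-1)) * f z)"
        using that
        by (rule integrable_cong_AE[THEN iffD1, rotated -1])
           (use pos in \<open>auto simp: powr_minus divide_inverse mult.commute\<close>)
      then have "(\<lambda>z. exp (- H z) * f z) \<in> H1" using mult[OF f, of "-1"] by simp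
      then show ?thesis by (simp add: exp_minus field_simps)
    qed
  qed (simp_all)
qed

section \<open>Banach function norms\<close>

text \<open>A real-valued norm, convenient for differences and limits. It agrees with
  \<open>bfs_norm\<close> on the space \<open>bfs\<close> only, since infinite norms are sent to
  0.\<close>

definition bnorm :: "((complex \<Rightarrow> ennreal) \<Rightarrow> ennreal) \<Rightarrow> (complex \<Rightarrow> complex) \<Rightarrow> real" where
  "bnorm \<rho> f = enn2real (bfs_norm \<rho> f)"

lemma bnorm_nonneg [simp]: "0 \<le> bnorm \<rho> f"
  by (simp add: bnorm_def)

lemma bfs_norm_eq_bnorm: "f \<in> bfs \<rho> \<Longrightarrow> bfs_norm \<rho> f = ennreal (bnorm \<rho> f)"
  by (simp add: bnorm_def bfs_def less_top)

lemma bfs_measurable: "f \<in> bfs \<rho> \<Longrightarrow> f \<in> borel_measurable circle"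
  by (simp add: bfs_def)

lemma bnorm_leI: "bfs_norm \<rho> f \<le> ennreal c \<Longrightarrow> 0 \<le> c \<Longrightarrow> bnorm \<rho> f \<le> c"
  unfolding bnorm_def by (rule enn2real_leI)

context banach_function_norm
begin

lemma bfs_norm_mono_AE:
  assumes "f \<in> borel_measurable circle" "g \<in> borel_measurable circle" "AE z in circle. cmod (g z) \<le> cmod (f z)"
  shows "bfs_norm \<rho> g \<le> bfs_norm \<rho> f"
  unfolding bfs_norm_def using assms by (intro mono) (auto intro: ennreal_leI)

lemma bfs_norm_cong_AE:
  assumes "f \<in> borel_measurable circle" "g \<in> borel_measurable circle" "AE z in circle. cmod (f z) = cmod (g z)"
  shows "bfs_norm \<rho> f = bfs_norm \<rho> g"
  using assms by (intro antisym bfs_norm_mono_AE) auto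

lemma bfs_norm_add:
  assumes [measurable]: "f \<in> borel_measurable circle" "g \<in> borel_measurable circle"
  shows "bfs_norm \<rho> (\<lambda>z. f z + g z) \<le> bfs_norm \<rho> f + bfs_norm \<rho> g"
proof -
  have "bfs_norm \<rho> (\<lambda>z. f z + g z) \<le> \<rho> (\<lambda>z. ennreal (cmod (f z)) + ennreal (cmod (g z)))"
    unfolding bfs_norm_def
    by (intro mono) (auto simp: norm_triangle_ineq intro!: ennreal_leI simp flip: ennreal_plus)
  also have "\<dots> \<le> bfs_norm \<rho> f + bfs_norm \<rho> g"
    unfolding bfs_norm_def by (intro triangle) measurable
  finally show ?thesis .
qed

lemma bfs_norm_cmult:
  assumes [measurable]: "f \<in> borel_measurable circle"
  shows "bfs_norm \<rho> (\<lambda>z. c * f z) = ennreal (cmod c) * bfs_norm \<rho> f"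
  unfolding bfs_norm_def by (simp add: norm_mult ennreal_mult scale)

lemma bfs_norm_0: "bfs_norm \<rho> (\<lambda>_. 0) = 0"
  unfolding bfs_norm_def by (subst eq_0_iff) auto

lemma bfs_norm_sum:
  assumes "\<And>i. i \<in> I \<Longrightarrow> f i \<in> borel_measurable circle"
  shows "bfs_norm \<rho> (\<lambda>z. \<Sum>i\<in>I. f i z) \<le> (\<Sum>i\<in>I. bfs_norm \<rho> (f i))"
  using assms
proof (induction I rule: infinite_finite_induct)
  case (insert i I)
  have "bfs_norm \<rho> (\<lambda>z. f i z + (\<Sum>i\<in>I. f i z)) \<le> bfs_norm \<rho> (f i) + bfs_norm \<rho> (\<lambda>z. \<Sum>i\<in>I. f i z)"
    using insert by (intro bfs_norm_add borel_measurable_sum) auto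
  also have "\<dots> \<le> bfs_norm \<rho> (f i) + (\<Sum>i\<in>I. bfs_norm \<rho> (f i))"
    using insert by (intro add_left_mono) auto
  finally show ?case using insert by simp
qed (auto simp: bfs_norm_0)

lemma bfs_norm_mult_le:
  assumes "a \<in> borel_measurable circle" "f \<in> borel_measurable circle"
    and "AE z in circle. cmod (a z) \<le> B" "0 \<le> B"
  shows "bfs_norm \<rho> (\<lambda>z. a z * f z) \<le> ennreal B * bfs_norm \<rho> f"
proof -
  have [measurable]: "a \<in> borel_measurable circle" "f \<in> borel_measurable circle" by fact+
  have "bfs_norm \<rho> (\<lambda>z. a z * f z) \<le> bfs_norm \<rho> (\<lambda>z. of_real B * f z)"
  proof (rule bfs_norm_mono_AE)
    show "AE z in circle. cmod (a z * f z) \<le> cmod (of_real B * f z)"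
      using assms(3) by eventually_elim (use assms(4) in \<open>simp add: norm_mult mult_right_mono\<close>)
  qed measurable
  also have "\<dots> = ennreal B * bfs_norm \<rho> f"
    using assms(4) by (subst bfs_norm_cmult) auto
  finally show ?thesis .
qed

lemma bfs_norm_unimodular_mult:
  assumes [measurable]: "a \<in> borel_measurable circle" "f \<in> borel_measurable circle"
    and "AE z in circle. cmod (a z) = 1"
  shows "bfs_norm \<rho> (\<lambda>z. a z * f z) = bfs_norm \<rho> f"
  using assms(3) by (intro bfs_norm_cong_AE) (auto simp: norm_mult)

lemma bfs_0: "(\<lambda>_. 0) \<in> bfs \<rho>"
  by (simp add: bfs_def bfs_norm_0)

lemma bfs_add: "f \<in> bfs \<rho> \<Longrightarrow> g \<in> bfs \<rho> \<Longrightarrow> (\<lambda>z. f z + g z) \<in> bfs \<rho>"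
  using bfs_norm_add[of f g] by (auto simp: bfs_def intro: le_less_trans)

lemma bfs_cmult: "f \<in> bfs \<rho> \<Longrightarrow> (\<lambda>z. c * f z) \<in> bfs \<rho>"
  by (auto simp: bfs_def bfs_norm_cmult ennreal_mult_less_top)

lemma bfs_diff: "f \<in> bfs \<rho> \<Longrightarrow> g \<in> bfs \<rho> \<Longrightarrow> (\<lambda>z. f z - g z) \<in> bfs \<rho>"
  using bfs_add[of f "\<lambda>z. (-1) * g z"] bfs_cmult[of g "-1"] by simp

lemma bfs_sum: "(\<And>i. i \<in> I \<Longrightarrow> f i \<in> bfs \<rho>) \<Longrightarrow> (\<lambda>z. \<Sum>i\<in>I. f i z) \<in> bfs \<rho>"
  by (induction I rule: infinite_finite_induct) (auto intro: bfs_add bfs_0)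

lemma bfs_mono_AE:
  assumes "f \<in> bfs \<rho>" "g \<in> borel_measurable circle" "AE z in circle. cmod (g z) \<le> cmod (f z)"
  shows "g \<in> bfs \<rho>"
  using assms bfs_norm_mono_AE[of f g] by (auto simp: bfs_def intro: le_less_trans)

lemma bfs_cong_AE:
  assumes "f \<in> bfs \<rho>" "g \<in> borel_measurable circle" "AE z in circle. f z = g z"
  shows "g \<in> bfs \<rho>"
  using assms by (intro bfs_mono_AE[OF assms(1,2)]) auto

lemma bfs_mult_bounded:
  assumes "f \<in> bfs \<rho>" "a \<in> borel_measurable circle" "AE z in circle. cmod (a z) \<le> B" "0 \<le> B"
  shows "(\<lambda>z. a z * f z) \<in> bfs \<rho>"
proof -
  have "bfs_norm \<rho> (\<lambda>z. a z * f z) \<le> ennreal B * bfs_norm \<rho> f"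
    using assms by (intro bfs_norm_mult_le) (auto simp: bfs_def)
  also have "\<dots> < \<infinity>" using assms by (simp add: bfs_def ennreal_mult_less_top)
  finally show ?thesis
    using borel_measurable_times[OF assms(2) bfs_measurable[OF assms(1)]] by (simp add: bfs_def)
qed

lemma bfs_bounded:
  assumes "a \<in> borel_measurable circle" "AE z in circle. cmod (a z) \<le> B" "0 \<le> B"
  shows "a \<in> bfs \<rho>"
proof -
  have "(\<lambda>_. 1) \<in> bfs \<rho>" using one_finite by (simp add: bfs_def bfs_norm_def)
  from bfs_mult_bounded[OF this assms] show ?thesis by simp
qed

lemma bfs_powi_mult: "f \<in> bfs \<rho> \<Longrightarrow> (\<lambda>z. z powi k * f z) \<in> bfs \<rho>"
  using AE_circle_norm by (intro bfs_mult_bounded[where B = 1]) (auto simp: norm_power_int elim: eventually_mono)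

lemma bnorm_powi_mult: "f \<in> borel_measurable circle \<Longrightarrow> bnorm \<rho> (\<lambda>z. z powi k * f z) = bnorm \<rho> f"
  unfolding bnorm_def using AE_circle_norm
  by (subst bfs_norm_unimodular_mult) (auto simp: norm_power_int elim: eventually_mono)

lemma bnorm_add: "f \<in> bfs \<rho> \<Longrightarrow> g \<in> bfs \<rho> \<Longrightarrow> bnorm \<rho> (\<lambda>z. f z + g z) \<le> bnorm \<rho> f + bnorm \<rho> g"
  using bfs_norm_add[of f g] bfs_norm_eq_bnorm[of f \<rho>] bfs_norm_eq_bnorm[of g \<rho>]
  by (intro bnorm_leI) (auto simp: bfs_def)

lemma bnorm_cmult: "f \<in> borel_measurable circle \<Longrightarrow> bnorm \<rho> (\<lambda>z. c * f z) = cmod c * bnorm \<rho> f"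
  by (simp add: bnorm_def bfs_norm_cmult enn2real_mult)

lemma bnorm_0: "bnorm \<rho> (\<lambda>_. 0) = 0"
  by (simp add: bnorm_def bfs_norm_0)

lemma bnorm_diff: "f \<in> bfs \<rho> \<Longrightarrow> g \<in> bfs \<rho> \<Longrightarrow> bnorm \<rho> (\<lambda>z. f z - g z) \<le> bnorm \<rho> f + bnorm \<rho> g"
  using bnorm_add[of f "\<lambda>z. (-1) * g z"] bfs_cmult[of g "-1"] bnorm_cmult[of g "-1"] by (simp add: bfs_measurable)

lemma bnorm_mono_AE:
  assumes "f \<in> bfs \<rho>" "g \<in> borel_measurable circle" "AE z in circle. cmod (g z) \<le> cmod (f z)"
  shows "bnorm \<rho> g \<le> bnorm \<rho> f"
  unfolding bnorm_def using assms bfs_norm_mono_AE[of f g]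
  by (intro enn2real_mono) (auto simp: bfs_def)

lemma bnorm_cong_AE:
  assumes "f \<in> borel_measurable circle" "g \<in> borel_measurable circle" "AE z in circle. cmod (f z) = cmod (g z)"
  shows "bnorm \<rho> f = bnorm \<rho> g"
  unfolding bnorm_def using bfs_norm_cong_AE[OF assms] by simp

lemma bnorm_triangle_AE:
  assumes "f \<in> bfs \<rho>" "g \<in> bfs \<rho>" "h \<in> borel_measurable circle" "AE z in circle. h z = f z + g z"
  shows "bnorm \<rho> h \<le> bnorm \<rho> f + bnorm \<rho> g"
proof -
  have "bnorm \<rho> h = bnorm \<rho> (\<lambda>z. f z + g z)"
    using assms(3,4) by (intro bnorm_cong_AE bfs_measurable[OF bfs_add[OF assms(1,2)]]) auto
  then show ?thesis using bnorm_add[OF assms(1,2)] by simp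
qed

lemma bnorm_mult_le:
  assumes "a \<in> borel_measurable circle" "f \<in> bfs \<rho>"
    and "AE z in circle. cmod (a z) \<le> B" "0 \<le> B"
  shows "bnorm \<rho> (\<lambda>z. a z * f z) \<le> B * bnorm \<rho> f"
  using bfs_norm_mult_le[OF assms(1) bfs_measurable[OF assms(2)] assms(3,4)] assms(4)
  by (intro bnorm_leI) (simp_all add: bfs_norm_eq_bnorm[OF assms(2)] ennreal_mult)

lemma bnorm_eq_0_iff:
  assumes "f \<in> bfs \<rho>"
  shows "bnorm \<rho> f = 0 \<longleftrightarrow> (AE z in circle. f z = 0)"
proof -
  have "bnorm \<rho> f = 0 \<longleftrightarrow> bfs_norm \<rho> f = 0"
    using assms by (auto simp: bnorm_def bfs_def enn2real_eq_0_iff)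
  also have "\<dots> \<longleftrightarrow> (AE z in circle. f z = 0)"
    unfolding bfs_norm_def using bfs_measurable[OF assms] by (subst eq_0_iff) auto
  finally show ?thesis .
qed

lemma bfs_norm_tendsto_0_iff:
  assumes "\<And>n. F n \<in> bfs \<rho>"
  shows "(\<lambda>n. bfs_norm \<rho> (F n)) \<longlonglongrightarrow> 0 \<longleftrightarrow> (\<lambda>n. bnorm \<rho> (F n)) \<longlonglongrightarrow> 0"
  by (simp add: bfs_norm_eq_bnorm[OF assms] ennreal_tendsto_0_iff)

section \<open>Embedding into L^1 and continuity of the Fourier coefficients\<close>

lemma bfs_L1_bound:
  obtains C where "0 < C" "\<And>f. f \<in> bfs \<rho> \<Longrightarrow> integrable circle f \<and> (\<integral>z. cmod (f z) \<partial>circle) \<le> C * bnorm \<rho> f"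
proof -
  obtain C :: real where C: "0 < C" "\<And>f. f \<in> borel_measurable circle \<Longrightarrow> (\<integral>\<^sup>+ z. f z \<partial>circle) \<le> ennreal C * \<rho> f"
    using L1_embedding by blast
  have "integrable circle f \<and> (\<integral>z. cmod (f z) \<partial>circle) \<le> C * bnorm \<rho> f" if f: "f \<in> bfs \<rho>" for f
  proof -
    have [measurable]: "f \<in> borel_measurable circle" using f by (rule bfs_measurable)
    have "(\<integral>\<^sup>+ z. ennreal (cmod (f z)) \<partial>circle) \<le> ennreal C * bfs_norm \<rho> f"
      unfolding bfs_norm_def by (rule C) measurable
    also have "\<dots> = ennreal (C * bnorm \<rho> f)"
      using C(1) by (simp add: bfs_norm_eq_bnorm[OF f] ennreal_mult)
    finally have le: "(\<integral>\<^sup>+ z. ennreal (cmod (f z)) \<partial>circle) \<le> ennreal (C * bnorm \<rho> f)" .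
    have int: "integrable circle f"
      using le by (intro integrableI_bounded) (auto intro: le_less_trans)
    have "ennreal (\<integral>z. cmod (f z) \<partial>circle) \<le> ennreal (C * bnorm \<rho> f)"
      using le int by (subst (asm) nn_integral_eq_integral) auto
    then show ?thesis using int C(1) by (simp add: ennreal_le_iff)
  qed
  with C(1) show thesis using that by blast
qed

lemma bfs_integrable: "f \<in> bfs \<rho> \<Longrightarrow> integrable circle f"
  using bfs_L1_bound by metis

lemma bfs_fourier_coeff_bound:
  obtains C where "0 < C" "\<And>f k. f \<in> bfs \<rho> \<Longrightarrow> cmod (fourier_coeff f k) \<le> C * bnorm \<rho> f"
proof -
  obtain C where "0 < C" "\<And>f. f \<in> bfs \<rho> \<Longrightarrow> integrable circle f \<and> (\<integral>z. cmod (f z) \<partial>circle) \<le> C * bnorm \<rho> f"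
    using bfs_L1_bound by blast
  then show thesis
    using norm_fourier_coeff_le order_trans by (intro that[of C]) blast+
qed

lemma fourier_coeff_bfs_tendsto:
  assumes "\<And>n. F n \<in> bfs \<rho>" "f \<in> bfs \<rho>" "(\<lambda>n. bnorm \<rho> (\<lambda>z. F n z - f z)) \<longlonglongrightarrow> 0"
  shows "(\<lambda>n. fourier_coeff (F n) k) \<longlonglongrightarrow> fourier_coeff f k"
proof -
  obtain C where C: "0 < C" "\<And>f k. f \<in> bfs \<rho> \<Longrightarrow> cmod (fourier_coeff f k) \<le> C * bnorm \<rho> f"
    using bfs_fourier_coeff_bound by blast
  have "(\<lambda>n. C * bnorm \<rho> (\<lambda>z. F n z - f z)) \<longlonglongrightarrow> C * 0"
    by (intro tendsto_intros assms)
  then have lim: "(\<lambda>n. C * bnorm \<rho> (\<lambda>z. F n z - f z)) \<longlonglongrightarrow> 0" by simp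
  have "(\<lambda>n. fourier_coeff (F n) k - fourier_coeff f k) \<longlonglongrightarrow> 0"
  proof (rule Lim_null_comparison[OF always_eventually lim], rule allI)
    fix n
    show "cmod (fourier_coeff (F n) k - fourier_coeff f k) \<le> C * bnorm \<rho> (\<lambda>z. F n z - f z)"
      using C(2)[OF bfs_diff[OF assms(1)[of n] assms(2)], of k]
      by (simp add: fourier_coeff_diff bfs_integrable assms)
  qed
  then show ?thesis by (simp add: LIM_zero_iff)
qed

lemma hardy_iff: "f \<in> hardy \<rho> \<longleftrightarrow> f \<in> bfs \<rho> \<and> f \<in> H1"
  by (auto simp: hardy_def H1_def bfs_integrable)

lemma hardy_closed:
  assumes "\<And>n. F n \<in> hardy \<rho>" "f \<in> bfs \<rho>" "(\<lambda>n. bnorm \<rho> (\<lambda>z. F n z - f z)) \<longlonglongrightarrow> 0"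
  shows "f \<in> hardy \<rho>"
proof -
  have "fourier_coeff f k = 0" if "k < 0" for k
  proof -
    have "(\<lambda>n. fourier_coeff (F n) k) \<longlonglongrightarrow> fourier_coeff f k"
      using assms by (intro fourier_coeff_bfs_tendsto) (auto simp: hardy_def)
    moreover have "fourier_coeff (F n) k = 0" for n
      using assms(1)[of n] that by (simp add: hardy_def)
    ultimately show ?thesis by (simp add: LIMSEQ_const_iff)
  qed
  then show ?thesis using assms(2) by (simp add: hardy_def)
qed

text \<open>The monotone convergence axiom is applied to the infima \<open>G n\<close> of the tails,
  which increase to |f| and lie below |F n|.\<close>

lemma bfs_norm_le_of_AE_limit:
  assumes [measurable]: "\<And>n. F n \<in> borel_measurable circle" "f \<in> borel_measurable circle"
    and lim: "AE z in circle. (\<lambda>n. F n z) \<longlonglongrightarrow> f z" and bd: "\<And>n. bfs_norm \<rho> (F n) \<le> c"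
  shows "bfs_norm \<rho> f \<le> c"
proof -
  define G where "G = (\<lambda>n z. INF k\<in>{n..}. ennreal (cmod (F k z)))"
  have [measurable]: "G n \<in> borel_measurable circle" for n
    unfolding G_def by measurable
  have Glim: "AE z in circle. incseq (\<lambda>n. G n z) \<and> (\<lambda>n. G n z) \<longlonglongrightarrow> ennreal (cmod (f z))"
    using lim
  proof eventually_elim
    case (elim z)
    have inc: "incseq (\<lambda>n. G n z)"
      unfolding G_def incseq_def by (auto intro!: INF_superset_mono)
    have "(SUP n. G n z) = liminf (\<lambda>n. ennreal (cmod (F n z)))"
      unfolding G_def by (rule liminf_SUP_INF[symmetric])
    also have "\<dots> = ennreal (cmod (f z))"
      by (intro lim_imp_Liminf tendsto_intros elim) auto
    finally show ?case using inc LIMSEQ_SUP[OF inc] by simp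
  qed
  have "(\<lambda>n. \<rho> (G n)) \<longlonglongrightarrow> \<rho> (\<lambda>z. ennreal (cmod (f z)))"
    using fatou[of G "\<lambda>z. ennreal (cmod (f z))", OF _ _ Glim] by simp
  moreover have "\<rho> (G n) \<le> c" for n
  proof -
    have "\<rho> (G n) \<le> bfs_norm \<rho> (F n)"
      unfolding bfs_norm_def by (intro mono) (auto simp: G_def intro!: INF_lower)
    from order_trans[OF this bd] show ?thesis .
  qed
  ultimately show ?thesis
    unfolding bfs_norm_def by (intro LIMSEQ_le_const2) auto
qed

text \<open>By homogeneity \<open>f\<close> is normalised; a function of norm 0 cannot be, but it
  vanishes a.e.\<close>

lemma hoelder_associate:
  assumes [measurable]: "f \<in> borel_measurable circle" "g \<in> borel_measurable circle" and fin: "\<rho> f < \<infinity>"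
  shows "(\<integral>\<^sup>+z. f z * g z \<partial>circle) \<le> \<rho> f * assoc_norm \<rho> g"
proof (cases "\<rho> f = 0")
  case True
  then have "AE z in circle. f z = 0" by (simp add: eq_0_iff)
  then have "(\<integral>\<^sup>+z. f z * g z \<partial>circle) = (\<integral>\<^sup>+z. 0 \<partial>circle)"
    by (intro nn_integral_cong_AE) auto
  then show ?thesis by simp
next
  case False
  define r where "r = enn2real (\<rho> f)"
  have r: "\<rho> f = ennreal r" "r > 0"
    using fin False by (auto simp: r_def less_top enn2real_positive_iff zero_less_iff_neq_zero)
  have "\<rho> (\<lambda>z. ennreal (1 / r) * f z) = ennreal (1/r) * ennreal r"
    using r by (simp add: scale)
  also have "\<dots> = 1" using r by (simp flip: ennreal_mult)
  finally have "(\<integral>\<^sup>+z. ennreal (1 / r) * f z * g z \<partial>circle) \<le> assoc_norm \<rho> g"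
    unfolding assoc_norm_def by (intro SUP_upper) auto
  then have "ennreal r * (ennreal (1 / r) * (\<integral>\<^sup>+z. f z * g z \<partial>circle)) \<le> ennreal r * assoc_norm \<rho> g"
    by (intro mult_left_mono) (simp_all add: mult.assoc nn_integral_cmult)
  moreover have "ennreal r * (ennreal (1 / r) * x) = x" for x
    using r by (simp flip: mult.assoc ennreal_mult)
  ultimately show ?thesis using r by simp
qed

end

section \<open>Weighted norms and the norm of L^1\<close>

lemma bfs_norm_weighted: "bfs_norm (weighted \<rho> w) f = bfs_norm \<rho> (\<lambda>z. of_real (w z) * f z)"
  unfolding bfs_norm_def weighted_def by (simp add: norm_mult ennreal_mult)

lemma bnorm_weighted: "bnorm (weighted \<rho> w) f = bnorm \<rho> (\<lambda>z. of_real (w z) * f z)"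
  by (simp add: bnorm_def bfs_norm_weighted)

context banach_function_norm
begin

text \<open>w \<in> X says that the constant 1 has finite weighted norm, and 1/w \<in> X' gives the
  embedding into L^1 by Hoelder's inequality for f = (w f) (1/w). Definiteness carries over because
  w > 0 a.e.\<close>

lemma weighted_banach_function_norm:
  fixes w :: "complex \<Rightarrow> real"
  assumes [measurable]: "w \<in> borel_measurable circle" and pos: "AE z in circle. 0 < w z"
    and w: "(\<lambda>z. complex_of_real (w z)) \<in> bfs \<rho>"
    and w': "(\<lambda>z. complex_of_real (1 / w z)) \<in> bfs (assoc_norm \<rho>)"
  shows "banach_function_norm (weighted \<rho> w)"
proof
  fix f g :: "complex \<Rightarrow> ennreal" and c :: real
  assume [measurable]: "f \<in> borel_measurable circle"
  show "weighted \<rho> w f = 0 \<longleftrightarrow> (AE z in circle. f z = 0)"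
  proof -
    have "weighted \<rho> w f = 0 \<longleftrightarrow> (AE z in circle. ennreal \<bar>w z\<bar> * f z = 0)"
      unfolding weighted_def by (rule eq_0_iff) measurable
    also have "\<dots> \<longleftrightarrow> (AE z in circle. f z = 0)"
      using pos by (intro iffI; elim eventually_rev_mp; eventually_elim) auto
    finally show ?thesis .
  qed
  show "weighted \<rho> w (\<lambda>z. ennreal c * f z) = ennreal c * weighted \<rho> w f" if "0 \<le> c"
    unfolding weighted_def using scale[of "\<lambda>z. ennreal \<bar>w z\<bar> * f z" c] that
    by (simp add: mult.left_commute)
  assume [measurable]: "g \<in> borel_measurable circle"
  show "weighted \<rho> w (\<lambda>z. f z + g z) \<le> weighted \<rho> w f + weighted \<rho> w g"
    unfolding weighted_def using triangle[of "\<lambda>z. ennreal \<bar>w z\<bar> * f z" "\<lambda>z. ennreal \<bar>w z\<bar> * g z"]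
    by (simp add: distrib_left)
  show "weighted \<rho> w g \<le> weighted \<rho> w f" if "AE z in circle. g z \<le> f z"
    unfolding weighted_def using that by (intro mono) (auto elim!: eventually_mono intro: mult_left_mono)
next
  fix F :: "nat \<Rightarrow> complex \<Rightarrow> ennreal" and f
  assume [measurable]: "\<And>n. F n \<in> borel_measurable circle" "f \<in> borel_measurable circle"
    and lim: "AE z in circle. incseq (\<lambda>n. F n z) \<and> (\<lambda>n. F n z) \<longlonglongrightarrow> f z"
  have "AE z in circle. incseq (\<lambda>n. ennreal \<bar>w z\<bar> * F n z) \<and> (\<lambda>n. ennreal \<bar>w z\<bar> * F n z) \<longlonglongrightarrow> ennreal \<bar>w z\<bar> * f z"
    using lim
  proof eventually_elim
    case (elim z)
    then show ?case
      by (auto simp: incseq_def intro!: mult_left_mono ennreal_tendsto_cmult)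
  qed
  then show "incseq (\<lambda>n. weighted \<rho> w (F n)) \<and> (\<lambda>n. weighted \<rho> w (F n)) \<longlonglongrightarrow> weighted \<rho> w f"
    unfolding weighted_def by (intro fatou) measurable
next
  show "weighted \<rho> w (\<lambda>_. 1) < \<infinity>"
    using w by (simp add: weighted_def bfs_def bfs_norm_def)
next
  \<comment> \<open>\<open>C\<close> is only known to be nonnegative. \<open>C + 1\<close> is a
    positive constant, and with it the right side is infinite whenever the weighted norm is.\<close>
  define C where "C = enn2real (assoc_norm \<rho> (\<lambda>z. ennreal (cmod (complex_of_real (1 / w z)))))"
  have C: "assoc_norm \<rho> (\<lambda>z. ennreal (cmod (complex_of_real (1 / w z)))) = ennreal C"
    using w' by (simp add: C_def bfs_def bfs_norm_def less_top)
  have "(\<integral>\<^sup>+ z. f z \<partial>circle) \<le> ennreal (C + 1) * weighted \<rho> w f" if [measurable]: "f \<in> borel_measurable circle" for f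
  proof (cases "weighted \<rho> w f < \<infinity>")
    case True
    have "(\<integral>\<^sup>+ z. f z \<partial>circle) = (\<integral>\<^sup>+ z. (ennreal \<bar>w z\<bar> * f z) * ennreal (cmod (complex_of_real (1 / w z))) \<partial>circle)"
    proof (rule nn_integral_cong_AE)
      show "AE z in circle. f z = (ennreal \<bar>w z\<bar> * f z) * ennreal (cmod (complex_of_real (1 / w z)))"
        using pos
      proof eventually_elim
        case (elim z)
        have "ennreal \<bar>w z\<bar> * ennreal (cmod (complex_of_real (1 / w z))) = 1"
          using elim by (simp add: norm_divide flip: ennreal_mult)
        then show ?case by (metis mult.commute mult.left_commute mult_1)
      qed
    qed
    also have "\<dots> \<le> weighted \<rho> w f * ennreal C"
      unfolding C[symmetric] weighted_def
      using True by (intro hoelder_associate) (simp_all add: weighted_def)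
    also have "\<dots> \<le> ennreal (C + 1) * weighted \<rho> w f"
      by (subst mult.commute) (intro mult_right_mono ennreal_leI, auto)
    finally show ?thesis .
  next
    case False
    then have "weighted \<rho> w f = \<infinity>" by (simp add: top.not_eq_extremum[symmetric])
    then have "ennreal (C + 1) * weighted \<rho> w f = \<infinity>"
      by (simp add: C_def ennreal_mult_top add_nonneg_pos not_le)
    then show ?thesis by simp
  qed
  moreover have "C + 1 > 0" by (simp add: C_def add_nonneg_pos)
  ultimately show "\<exists>C::real. 0 < C \<and> (\<forall>f\<in>borel_measurable circle. (\<integral>\<^sup>+ z. f z \<partial>circle) \<le> ennreal C * weighted \<rho> w f)"
    by blast
qed

end

text \<open>L^1 is itself a translation-invariant Banach function space, so the Fejer estimates
  shown for a general norm apply to it as well.\<close>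

interpretation L1: banach_function_norm "\<lambda>f. \<integral>\<^sup>+z. f z \<partial>circle"
proof
  fix F :: "nat \<Rightarrow> complex \<Rightarrow> ennreal" and f
  assume [measurable]: "\<And>n. F n \<in> borel_measurable circle" "f \<in> borel_measurable circle"
    and lim: "AE z in circle. incseq (\<lambda>n. F n z) \<and> (\<lambda>n. F n z) \<longlonglongrightarrow> f z"
  have inc: "incseq (\<lambda>n. \<integral>\<^sup>+z. F n z \<partial>circle)"
    unfolding incseq_def using lim by (auto intro!: nn_integral_mono_AE elim!: eventually_mono simp: incseq_def)
  have "(\<integral>\<^sup>+z. f z \<partial>circle) = (\<integral>\<^sup>+z. (SUP n. F n z) \<partial>circle)"
  proof (rule nn_integral_cong_AE)
    show "AE z in circle. f z = (SUP n. F n z)"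
      using lim by eventually_elim (blast intro: LIMSEQ_unique LIMSEQ_SUP)
  qed
  also have "\<dots> = (SUP n. \<integral>\<^sup>+z. F n z \<partial>circle)"
    using lim by (intro nn_integral_monotone_convergence_SUP_AE) (auto elim!: eventually_mono simp: incseq_Suc_iff)
  finally show "incseq (\<lambda>n. \<integral>\<^sup>+z. F n z \<partial>circle) \<and> (\<lambda>n. \<integral>\<^sup>+z. F n z \<partial>circle) \<longlonglongrightarrow> (\<integral>\<^sup>+z. f z \<partial>circle)"
    using inc LIMSEQ_SUP[OF inc] by simp
next
  show "\<exists>C::real. 0 < C \<and> (\<forall>f\<in>borel_measurable circle. (\<integral>\<^sup>+ z. f z \<partial>circle) \<le> ennreal C * (\<integral>\<^sup>+ z. f z \<partial>circle))"
    by (intro exI[of _ 1]) auto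
qed (auto simp: nn_integral_0_iff_AE nn_integral_cmult nn_integral_add nn_integral_mono_AE emeasure_circle)

lemma bfs_L1: "bfs (\<lambda>f. \<integral>\<^sup>+z. f z \<partial>circle) = {f. integrable circle f}"
  by (auto simp: bfs_def bfs_norm_def integrable_iff_bounded)

lemma bfs_norm_L1: "integrable circle f \<Longrightarrow> bfs_norm (\<lambda>f. \<integral>\<^sup>+z. f z \<partial>circle) f = ennreal (\<integral>z. cmod (f z) \<partial>circle)"
  unfolding bfs_norm_def by (intro nn_integral_eq_integral) auto

lemma translation_invariant_rotate:
  assumes "translation_invariant \<rho>" "f \<in> bfs \<rho>" "cmod c = 1"
  shows "bfs_norm \<rho> (\<lambda>z. f (z * c)) = bfs_norm \<rho> f"
proof -
  have "c \<noteq> 0" using assms(3) by auto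
  then have c: "c = cis (Arg c)" using cis_Arg[of c] assms(3) by (simp add: sgn_eq)
  have "bfs_norm \<rho> (translate (- Arg c) f) = bfs_norm \<rho> f"
    using assms(1,2) Arg_bounded[of c] by (auto simp: translation_invariant_def)
  then show ?thesis using c by (simp add: translate_def)
qed

lemma translation_invariant_L1: "translation_invariant (\<lambda>f. \<integral>\<^sup>+z. f z \<partial>circle)"
  unfolding translation_invariant_def bfs_norm_def translate_def
  by (auto simp: bfs_L1 intro!: nn_integral_rotation[where f = "\<lambda>z. ennreal (cmod (f z))" for f])

section \<open>Fejer means\<close>

text \<open>The squared modulus makes positivity evident; \<open>fejer_kernel_eq\<close> expands it
  into powers.\<close>

definition fejer_kernel :: "nat \<Rightarrow> complex \<Rightarrow> real" where
  "fejer_kernel n \<zeta> = (cmod (\<Sum>j\<le>n. \<zeta> ^ j))\<^sup>2 / real (n + 1)"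

text \<open>Grouped by k = i - j, this is the Cesaro mean with weights 1 - |k|/(n + 1) for |k| \<le>
  n. Written through coefficients, it is defined at every point and visibly of finite rank.\<close>

definition fejer_mean :: "nat \<Rightarrow> (complex \<Rightarrow> complex) \<Rightarrow> complex \<Rightarrow> complex" where
  "fejer_mean n g z =
     (\<Sum>i\<le>n. \<Sum>j\<le>n. fourier_coeff g (int i - int j) * z powi (int i - int j)) / of_nat (n + 1)"

text \<open>Riemann sums for the convolution with the Fejer kernel. They are convex combinations of
  rotations of \<open>g\<close>.\<close>

definition fejer_riemann :: "nat \<Rightarrow> nat \<Rightarrow> (complex \<Rightarrow> complex) \<Rightarrow> complex \<Rightarrow> complex" where
  "fejer_riemann n m g z = (\<Sum>l<m. of_real (fejer_kernel n (cis (2 * pi * real l / real m)) / real m)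
     * g (z * cis (- (2 * pi * real l / real m))))"

definition fejer_weight :: "nat \<Rightarrow> int \<Rightarrow> real" where
  "fejer_weight n k = (\<Sum>i\<le>n. \<Sum>j\<le>n. if int i - int j = k then 1 else 0) / real (n + 1)"

text \<open>There are n + 1 - |k| pairs of indices with difference k.\<close>

lemma fejer_weight_eq:
  assumes "\<bar>k\<bar> \<le> int n"
  shows "fejer_weight n k = 1 - of_int \<bar>k\<bar> / real (n + 1)"
proof -
  have *: "(\<Sum>i\<le>n. \<Sum>j\<le>n. if int i - int j = k then 1 else 0) = real (n + 1) - of_int \<bar>k\<bar>"
  proof (cases "k \<ge> 0")
    case True
    then obtain p where p: "k = int p" "p \<le> n" using assms by (metis nonneg_int_cases abs_of_nonneg of_nat_le_iff)
    have "(\<Sum>i\<le>n. \<Sum>j\<le>n. if int i - int j = k then 1 else 0) = (\<Sum>j\<le>n. \<Sum>i\<le>n. if i = j + p then 1 else (0::real))"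
    proof -
      have "(int i - int j = int p) = (i = j + p)" for i j by auto
      then show ?thesis by (subst sum.swap) (simp only: p)
    qed
    also have "\<dots> = (\<Sum>j\<le>n. if j \<le> n - p then 1 else 0)"
      using p(2) by (intro sum.cong) auto
    also have "\<dots> = real (card {j. j \<le> n \<and> j \<le> n - p})"
      by (simp add: sum.If_cases Int_def)
    also have "{j. j \<le> n \<and> j \<le> n - p} = {..n - p}" by auto
    finally show ?thesis using p by (simp add: of_nat_diff)
  next
    case False
    then obtain p where p: "k = - int p" "p \<le> n" "p > 0"
      using assms by (metis abs_of_neg neg_int_cases not_le of_nat_le_iff minus_minus)
    have "(\<Sum>i\<le>n. \<Sum>j\<le>n. if int i - int j = k then 1 else 0) = (\<Sum>i\<le>n. \<Sum>j\<le>n. if j = i + p then 1 else (0::real))"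
    proof -
      have "(int i - int j = - int p) = (j = i + p)" for i j by auto
      then show ?thesis by (simp only: p)
    qed
    also have "\<dots> = (\<Sum>i\<le>n. if i \<le> n - p then 1 else 0)"
      using p(2) by (intro sum.cong) auto
    also have "\<dots> = real (card {j. j \<le> n \<and> j \<le> n - p})"
      by (simp add: sum.If_cases Int_def)
    also have "{j. j \<le> n \<and> j \<le> n - p} = {..n - p}" by auto
    finally show ?thesis using p by (simp add: of_nat_diff)
  qed
  show ?thesis unfolding fejer_weight_def * by (simp add: field_simps)
qed

lemma fejer_weight_tendsto: "(\<lambda>n. fejer_weight n k) \<longlonglongrightarrow> 1"
proof (rule Lim_transform_eventually)
  have "(\<lambda>n. 1 - of_int \<bar>k\<bar> * inverse (real (Suc n))) \<longlonglongrightarrow> 1 - of_int \<bar>k\<bar> * 0"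
    by (intro tendsto_intros LIMSEQ_inverse_real_of_nat)
  then show "(\<lambda>n. 1 - of_int \<bar>k\<bar> * inverse (real (Suc n))) \<longlonglongrightarrow> 1" by simp
  show "\<forall>\<^sub>F n in sequentially. 1 - of_int \<bar>k\<bar> * inverse (real (Suc n)) = fejer_weight n k"
    using eventually_ge_at_top[of "nat \<bar>k\<bar>"]
    by eventually_elim (simp add: fejer_weight_eq divide_inverse)
qed

lemma fejer_kernel_nonneg: "0 \<le> fejer_kernel n \<zeta>"
  by (simp add: fejer_kernel_def)

lemma fejer_kernel_eq:
  assumes "cmod \<zeta> = 1"
  shows "of_real (fejer_kernel n \<zeta>) = (\<Sum>i\<le>n. \<Sum>j\<le>n. \<zeta> powi (int i - int j)) / of_nat (n + 1)"
proof -
  have "\<zeta> \<noteq> 0" using assms by auto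
  have "cnj \<zeta> = inverse \<zeta>"
    using assms by (simp add: inverse_eq_divide divide_conv_cnj)
  then have "\<zeta> ^ i * cnj (\<zeta> ^ j) = \<zeta> powi (int i - int j)" for i j
    using \<open>\<zeta> \<noteq> 0\<close> by (simp add: power_int_diff divide_inverse power_inverse)
  then have "complex_of_real ((cmod (\<Sum>j\<le>n. \<zeta> ^ j))\<^sup>2) = (\<Sum>i\<le>n. \<Sum>j\<le>n. \<zeta> powi (int i - int j))"
    unfolding complex_norm_square cnj_sum sum_product by simp
  then show ?thesis by (simp add: fejer_kernel_def)
qed

text \<open>A geometric sum. The condition |s| < m excludes the nonzero multiples of m, for which
  every term would be 1.\<close>

lemma sum_roots_of_unity_powi:
  assumes "\<bar>s\<bar> < int m"
  shows "(\<Sum>l<m. cis (2 * pi * real l / real m) powi s) = (if s = 0 then of_nat m else 0)"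
proof (cases "s = 0")
  case False
  have m: "m > 0" using assms by linarith
  define c where "c = cis (2 * pi * of_int s / real m)"
  have c: "cis (2 * pi * real l / real m) powi s = c ^ l" for l
  proof -
    have "of_int s * (2 * pi * real l / real m) = real l * (2 * pi * of_int s / real m)" by simp
    then show ?thesis unfolding c_def by (simp only: Complex.DeMoivre cis_power_int)
  qed
  have "c \<noteq> 1"
  proof
    assume "c = 1"
    then have "cos (2 * pi * of_int s / real m) = 1"
      by (simp add: c_def complex_eq_iff)
    then obtain n :: int where "2 * pi * of_int s / real m = of_int n * 2 * pi"
      using cos_one_2pi_int by blast
    then have "of_int s = (of_int n * real m :: real)"
      using m by (simp add: field_simps)
    then have "s = n * int m" by (metis of_int_eq_iff of_int_mult of_int_of_nat_eq)
    then have "\<bar>n\<bar> * int m < int m" "n \<noteq> 0" using assms False by (auto simp: abs_mult)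
    moreover have "1 \<le> \<bar>n\<bar>" using \<open>n \<noteq> 0\<close> by linarith
    ultimately show False using mult_right_mono[of 1 "\<bar>n\<bar>" "int m"] by simp
  qed
  moreover have "c ^ m = 1"
  proof -
    have "c ^ m = cis (2 * pi * of_int s)"
      using m by (simp add: c_def Complex.DeMoivre)
    also have "\<dots> = 1" by (simp add: cis_multiple_2pi)
    finally show ?thesis .
  qed
  ultimately have "(\<Sum>l<m. c ^ l) = 0"
    by (simp add: geometric_sum)
  then show ?thesis using False by (simp add: c)
qed simp

lemma fejer_mean_add:
  "integrable circle f \<Longrightarrow> integrable circle g \<Longrightarrow> fejer_mean n (\<lambda>z. f z + g z) z = fejer_mean n f z + fejer_mean n g z"
  by (simp add: fejer_mean_def fourier_coeff_add distrib_right sum.distrib add_divide_distrib)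

lemma fejer_mean_diff:
  "integrable circle f \<Longrightarrow> integrable circle g \<Longrightarrow> fejer_mean n (\<lambda>z. f z - g z) z = fejer_mean n f z - fejer_mean n g z"
  by (simp add: fejer_mean_def fourier_coeff_diff left_diff_distrib sum_subtractf diff_divide_distrib)

lemma fejer_riemann_add:
  "fejer_riemann n m (\<lambda>z. f z + g z) z = fejer_riemann n m f z + fejer_riemann n m g z"
  by (simp add: fejer_riemann_def distrib_left sum.distrib)

lemma fejer_riemann_diff:
  "fejer_riemann n m (\<lambda>z. f z - g z) z = fejer_riemann n m f z - fejer_riemann n m g z"
  by (simp add: fejer_riemann_def right_diff_distrib sum_subtractf)

lemma fejer_mean_monom: "fejer_mean n (\<lambda>z. c * z powi k) z = of_real (fejer_weight n k) * (c * z powi k)"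
proof -
  have "fejer_mean n (\<lambda>z. c * z powi k) z
      = (\<Sum>i\<le>n. \<Sum>j\<le>n. of_real (if int i - int j = k then 1 else 0) * (c * z powi k)) / of_nat (n + 1)"
    unfolding fejer_mean_def
    by (intro arg_cong[where f = "\<lambda>x. x / _"] sum.cong refl) (simp add: fourier_coeff_cmult fourier_coeff_powi)
  then show ?thesis
    unfolding sum_distrib_right[symmetric] by (simp add: fejer_weight_def)
qed

text \<open>The rule with \<open>m\<close> equidistant nodes integrates z^s exactly for |s| < m, and
  the exponents i - j - k that occur have modulus at most n + |k|. So the Riemann sum equals the
  mean and is not merely close to it.\<close>

lemma fejer_riemann_monom:
  assumes "int n + \<bar>k\<bar> < int m" "z \<noteq> 0"
  shows "fejer_riemann n m (\<lambda>z. c * z powi k) z = fejer_mean n (\<lambda>z. c * z powi k) z"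
proof -
  define \<omega> where "\<omega> = (\<lambda>l. cis (2 * pi * real l / real m))"
  have m: "m > 0" using assms by linarith
  have \<omega>: "cmod (\<omega> l) = 1" "\<omega> l \<noteq> 0" "cis (- (2 * pi * real l / real m)) = inverse (\<omega> l)"
    "cis (2 * pi * real l / real m) = \<omega> l" for l
    by (simp_all add: \<omega>_def cis_inverse)
  have "fejer_riemann n m (\<lambda>z. c * z powi k) z
      = (\<Sum>l<m. of_real (fejer_kernel n (\<omega> l)) / of_nat m * (c * (z powi k * \<omega> l powi (-k))))"
    unfolding fejer_riemann_def \<omega>(3,4)
    by (simp add: power_int_mult_distrib power_int_minus power_int_inverse)
  also have "\<dots> = c * z powi k / (of_nat m * of_nat (n + 1)) *
      (\<Sum>l<m. \<Sum>i\<le>n. \<Sum>j\<le>n. \<omega> l powi (int i - int j) * \<omega> l powi (-k))"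
    unfolding fejer_kernel_eq[OF \<omega>(1)] by (simp add: sum_distrib_left sum_distrib_right sum_divide_distrib mult_ac)
  also have "(\<Sum>l<m. \<Sum>i\<le>n. \<Sum>j\<le>n. \<omega> l powi (int i - int j) * \<omega> l powi (-k))
      = (\<Sum>l<m. \<Sum>i\<le>n. \<Sum>j\<le>n. \<omega> l powi (int i - int j - k))"
    using \<omega>(2) by (simp flip: power_int_add)
  also have "\<dots> = (\<Sum>i\<le>n. \<Sum>j\<le>n. \<Sum>l<m. \<omega> l powi (int i - int j - k))"
    by (subst sum.swap, rule sum.cong[OF refl], rule sum.swap)
  also have "\<dots> = (\<Sum>i\<le>n. \<Sum>j\<le>n. of_nat m * of_real (if int i - int j = k then 1 else 0))"
    unfolding \<omega>_def using assms(1) by (intro sum.cong refl, subst sum_roots_of_unity_powi) auto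
  also have "\<dots> = of_nat m * (of_nat (n + 1) * of_real (fejer_weight n k))"
    unfolding sum_distrib_left[symmetric] by (simp add: fejer_weight_def del: of_nat_add of_nat_Suc)
  finally show ?thesis
    unfolding fejer_mean_monom using m by (simp add: field_simps del: of_nat_Suc of_nat_add)
qed

lemma fejer_riemann_trig_poly:
  assumes "trig_poly t"
  shows "\<forall>\<^sub>F m in sequentially. \<forall>z. cmod z = 1 \<longrightarrow> fejer_riemann n m t z = fejer_mean n t z"
  using assms
proof induction
  case (monom c k)
  show ?case
    using eventually_gt_at_top[of "n + nat \<bar>k\<bar>"]
  proof eventually_elim
    case (elim m)
    show ?case
    proof (intro allI impI)
      fix z :: complex assume "cmod z = 1"
      then have "z \<noteq> 0" by auto
      with elim show "fejer_riemann n m (\<lambda>z. c * z powi k) z = fejer_mean n (\<lambda>z. c * z powi k) z"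
        by (intro fejer_riemann_monom) auto
    qed
  qed
next
  case (add s t)
  from add.IH show ?case
    by eventually_elim (simp add: fejer_riemann_add fejer_mean_add trig_poly_integrable add.hyps)
qed

text \<open>The left side is the Riemann sum of the constant function 1 at z = 1, and that sum is
  exact.\<close>

lemma sum_fejer_kernel_roots:
  assumes "n < m"
  shows "(\<Sum>l<m. fejer_kernel n (cis (2 * pi * real l / real m)) / real m) = 1"
proof -
  have "complex_of_real (\<Sum>l<m. fejer_kernel n (cis (2 * pi * real l / real m)) / real m)
      = fejer_riemann n m (\<lambda>z. 1 * z powi 0) 1"
    by (simp add: fejer_riemann_def)
  also have "\<dots> = fejer_mean n (\<lambda>z. 1 * z powi 0) 1"
    by (rule fejer_riemann_monom) (use assms in auto)
  also have "\<dots> = of_real (fejer_weight n 0) * (1 * 1 powi 0)"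
    by (rule fejer_mean_monom)
  also have "\<dots> = 1" by (simp add: fejer_weight_eq)
  finally show ?thesis by (simp only: of_real_eq_1_iff)
qed

text \<open>The weights are nonnegative with sum 1, and rotations preserve the norm. As the sum is
  finite, the triangle inequality does what Minkowski's integral inequality would do for a
  convolution.\<close>

lemma (in banach_function_norm) bfs_norm_fejer_riemann_le:
  assumes tr: "translation_invariant \<rho>" and g: "g \<in> bfs \<rho>" and nm: "n < m"
  shows "bfs_norm \<rho> (fejer_riemann n m g) \<le> bfs_norm \<rho> g"
proof -
  let ?F = "\<lambda>l. fejer_kernel n (cis (2 * pi * real l / real m)) / real m"
  have meas: "(\<lambda>z. g (z * cis x)) \<in> borel_measurable circle" for x
    using bfs_measurable[OF g] by (intro measurable_rotation) auto
  have "bfs_norm \<rho> (fejer_riemann n m g) \<le> (\<Sum>l<m. bfs_norm \<rho> (\<lambda>z. of_real (?F l) * g (z * cis (- (2 * pi * real l / real m)))))"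
    unfolding fejer_riemann_def
    by (rule bfs_norm_sum) (intro borel_measurable_times borel_measurable_const meas)
  also have "\<dots> = (\<Sum>l<m. ennreal (?F l) * bfs_norm \<rho> g)"
  proof (rule sum.cong[OF refl])
    fix l
    show "bfs_norm \<rho> (\<lambda>z. of_real (?F l) * g (z * cis (- (2 * pi * real l / real m)))) = ennreal (?F l) * bfs_norm \<rho> g"
      using fejer_kernel_nonneg[of n]
      by (subst bfs_norm_cmult[OF meas]) (simp add: translation_invariant_rotate[OF tr g] del: of_real_divide)
  qed
  also have "\<dots> = ennreal (\<Sum>l<m. ?F l) * bfs_norm \<rho> g"
    unfolding sum_distrib_right[symmetric] by (simp add: fejer_kernel_nonneg sum_ennreal)
  also have "\<dots> = bfs_norm \<rho> g" by (simp only: sum_fejer_kernel_roots[OF nm]) simp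
  finally show ?thesis .
qed

section \<open>Convergence of Riemann sums and Fejer means in L^1\<close>

lemma fejer_mean_continuous_on: "continuous_on (sphere 0 1) (fejer_mean n g)"
  unfolding fejer_mean_def[abs_def] divide_inverse by (intro continuous_intros) auto

lemma fejer_mean_integrable: "integrable circle (fejer_mean n g)"
  by (rule integrable_circle_continuous_on[OF fejer_mean_continuous_on])

lemma fejer_mean_measurable [measurable]: "fejer_mean n g \<in> borel_measurable circle"
  by (rule borel_measurable_circle_continuous_on[OF fejer_mean_continuous_on])

lemma fejer_riemann_measurable:
  "g \<in> borel_measurable circle \<Longrightarrow> fejer_riemann n m g \<in> borel_measurable circle"
  unfolding fejer_riemann_def[abs_def]
  by (intro borel_measurable_sum borel_measurable_times borel_measurable_const measurable_rotation) auto

lemma fejer_riemann_L1: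
  assumes "integrable circle g" "n < m"
  shows "integrable circle (fejer_riemann n m g)"
    and "(\<integral>z. cmod (fejer_riemann n m g z) \<partial>circle) \<le> (\<integral>z. cmod (g z) \<partial>circle)"
proof -
  have g: "g \<in> bfs (\<lambda>f. \<integral>\<^sup>+z. f z \<partial>circle)" using assms(1) by (simp add: bfs_L1)
  have le: "bfs_norm (\<lambda>f. \<integral>\<^sup>+z. f z \<partial>circle) (fejer_riemann n m g) \<le> bfs_norm (\<lambda>f. \<integral>\<^sup>+z. f z \<partial>circle) g"
    by (rule L1.bfs_norm_fejer_riemann_le[OF translation_invariant_L1 g assms(2)])
  have "fejer_riemann n m g \<in> bfs (\<lambda>f. \<integral>\<^sup>+z. f z \<partial>circle)"
    using g le fejer_riemann_measurable[of g n m] by (auto simp: bfs_def)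
  then show i: "integrable circle (fejer_riemann n m g)" by (simp add: bfs_L1)
  show "(\<integral>z. cmod (fejer_riemann n m g z) \<partial>circle) \<le> (\<integral>z. cmod (g z) \<partial>circle)"
    using le by (simp add: bfs_norm_L1[OF i] bfs_norm_L1[OF assms(1)])
qed

text \<open>Crude in \<open>n\<close>, but \<open>n\<close> stays fixed while the number of nodes
  grows.\<close>

lemma norm_fejer_mean_le:
  assumes "cmod z = 1"
  shows "cmod (fejer_mean n g z) \<le> real (n + 1) * (\<integral>z. cmod (g z) \<partial>circle)"
proof -
  let ?I = "\<integral>z. cmod (g z) \<partial>circle"
  have "cmod (\<Sum>i\<le>n. \<Sum>j\<le>n. fourier_coeff g (int i - int j) * z powi (int i - int j)) \<le> (\<Sum>i\<le>n. \<Sum>j\<le>n. ?I)"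
    by (intro order_trans[OF norm_sum] sum_mono)
       (simp add: norm_mult norm_power_int assms norm_fourier_coeff_le)
  also have "\<dots> = real (n + 1) * ?I * real (n + 1)" by simp
  finally show ?thesis
    by (simp add: fejer_mean_def norm_divide field_simps del: of_nat_Suc of_nat_add)
qed

lemma integral_norm_le_of_bound:
  assumes "f \<in> borel_measurable circle" "\<And>z. cmod z = 1 \<Longrightarrow> cmod (f z) \<le> B"
  shows "(\<integral>z. cmod (f z) \<partial>circle) \<le> 2 * pi * B"
proof -
  have "0 \<le> B" using order_trans[OF norm_ge_zero assms(2)[of 1]] by simp
  then have "(\<integral>z. cmod (f z) \<partial>circle) \<le> (\<integral>z. B \<partial>circle)"
    using assms norm_circle_eq_1
    by (intro integral_mono integrable_norm integrable_circle_bounded[where B = B]) (auto intro!: AE_I2)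
  then show ?thesis by (simp add: measure_circle)
qed

lemma integral_norm_triangle3:
  assumes "integrable circle a" "integrable circle b" "integrable circle c"
    and "\<And>z. z \<in> space circle \<Longrightarrow> f z = a z + b z + c z" and "f \<in> borel_measurable circle"
  shows "(\<integral>z. cmod (f z) \<partial>circle) \<le> (\<integral>z. cmod (a z) \<partial>circle) + (\<integral>z. cmod (b z) \<partial>circle) + (\<integral>z. cmod (c z) \<partial>circle)"
proof -
  have "integrable circle (\<lambda>z. a z + b z + c z)" using assms by simp
  then have "integrable circle f"
    using assms(4) by (subst Bochner_Integration.integrable_cong[OF refl, of circle f]) auto
  then have "(\<integral>z. cmod (f z) \<partial>circle) \<le> (\<integral>z. cmod (a z) + cmod (b z) + cmod (c z) \<partial>circle)"
    using assms by (intro integral_mono) (auto intro!: norm_triangle_le add_mono norm_triangle_ineq)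
  also have "\<dots> = (\<integral>z. cmod (a z) \<partial>circle) + (\<integral>z. cmod (b z) \<partial>circle) + (\<integral>z. cmod (c z) \<partial>circle)"
    using assms by simp
  finally show ?thesis .
qed

text \<open>For a trigonometric polynomial \<open>t\<close> near \<open>g\<close> the two
  expressions agree on the circle as soon as \<open>m\<close> is large, so only the remainder g - t
  has to be estimated.\<close>

lemma fejer_riemann_tendsto_L1:
  assumes g: "integrable circle g"
  shows "(\<lambda>m. \<integral>z. cmod (fejer_riemann n m g z - fejer_mean n g z) \<partial>circle) \<longlonglongrightarrow> 0"
proof (rule LIMSEQ_I)
  fix e :: real assume e: "e > 0"
  \<comment> \<open>Two bounds on the remainder in L^1: 1 for the Riemann sum, which is a
    contraction, and 2 pi (n + 1) for the mean.\<close>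
  define C where "C = 1 + 2 * pi * real (n + 1)"
  have C: "C > 0" by (simp add: C_def add_pos_nonneg)
  obtain t where t: "trig_poly t" "(\<integral>z. cmod (g z - t z) \<partial>circle) < e / C"
    using integrable_approx_trig_poly[OF g, of "e / C"] e C by auto
  have gt: "integrable circle (\<lambda>z. g z - t z)" using g trig_poly_integrable[OF t(1)] by simp
  have "\<forall>\<^sub>F m in sequentially. n < m \<and> (\<forall>z. cmod z = 1 \<longrightarrow> fejer_riemann n m t z = fejer_mean n t z)"
    by (intro eventually_conj eventually_gt_at_top fejer_riemann_trig_poly t)
  then obtain M where M: "\<And>m. m \<ge> M \<Longrightarrow> n < m \<and> (\<forall>z. cmod z = 1 \<longrightarrow> fejer_riemann n m t z = fejer_mean n t z)"
    by (auto simp: eventually_sequentially)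
  have "(\<integral>z. cmod (fejer_riemann n m g z - fejer_mean n g z) \<partial>circle) < e" if "m \<ge> M" for m
  proof -
    note Mm = M[OF that]
    have i: "integrable circle (\<lambda>z. fejer_riemann n m (\<lambda>z. g z - t z) z)"
      "integrable circle (\<lambda>z. fejer_mean n (\<lambda>z. g z - t z) z)"
      using fejer_riemann_L1(1)[OF gt] Mm fejer_mean_integrable by auto
    have eq: "fejer_riemann n m g z - fejer_mean n g z = fejer_riemann n m (\<lambda>z. g z - t z) z - fejer_mean n (\<lambda>z. g z - t z) z"
      if "z \<in> space circle" for z
      using Mm norm_circle_eq_1[OF that] g trig_poly_integrable[OF t(1)]
      by (simp add: fejer_riemann_diff fejer_mean_diff)
    have "(\<integral>z. cmod (fejer_riemann n m g z - fejer_mean n g z) \<partial>circle)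
        = (\<integral>z. cmod (fejer_riemann n m (\<lambda>z. g z - t z) z - fejer_mean n (\<lambda>z. g z - t z) z) \<partial>circle)"
      by (intro Bochner_Integration.integral_cong refl) (simp add: eq)
    also have "\<dots> \<le> (\<integral>z. cmod (fejer_riemann n m (\<lambda>z. g z - t z) z) + cmod (fejer_mean n (\<lambda>z. g z - t z) z) \<partial>circle)"
      using i by (intro integral_mono norm_triangle_ineq4) auto
    also have "\<dots> = (\<integral>z. cmod (fejer_riemann n m (\<lambda>z. g z - t z) z) \<partial>circle) + (\<integral>z. cmod (fejer_mean n (\<lambda>z. g z - t z) z) \<partial>circle)"
      using i by simp
    also have "\<dots> \<le> (\<integral>z. cmod (g z - t z) \<partial>circle) + 2 * pi * (real (n + 1) * (\<integral>z. cmod (g z - t z) \<partial>circle))"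
      using Mm by (intro add_mono fejer_riemann_L1(2)[OF gt] integral_norm_le_of_bound norm_fejer_mean_le) auto
    also have "\<dots> = C * (\<integral>z. cmod (g z - t z) \<partial>circle)" by (simp add: C_def algebra_simps)
    also have "\<dots> < e" using t(2) C by (simp add: field_simps)
    finally show ?thesis .
  qed
  then show "\<exists>M. \<forall>m\<ge>M. norm ((\<integral>z. cmod (fejer_riemann n m g z - fejer_mean n g z) \<partial>circle) - 0) < e"
    by auto
qed

text \<open>The Riemann sums converge in L^1, hence a.e. along a subsequence, and
  \<open>bfs_norm_le_of_AE_limit\<close> carries the contraction bound to the limit. The index shift
  by \<open>Suc n\<close> provides more than n nodes.\<close>

lemma (in banach_function_norm) bfs_norm_fejer_mean_le:
  assumes tr: "translation_invariant \<rho>" and g: "g \<in> bfs \<rho>"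
  shows "bfs_norm \<rho> (fejer_mean n g) \<le> bfs_norm \<rho> g"
proof -
  have gi: "integrable circle g" using g by (rule bfs_integrable)
  have lim: "(\<lambda>m. \<integral>z. cmod (fejer_riemann n (m + Suc n) g z - fejer_mean n g z) \<partial>circle) \<longlonglongrightarrow> 0"
    using LIMSEQ_ignore_initial_segment[OF fejer_riemann_tendsto_L1[OF gi]] .
  have int: "integrable circle (\<lambda>z. fejer_riemann n (m + Suc n) g z - fejer_mean n g z)" for m
    using fejer_riemann_L1(1)[OF gi, of n "m + Suc n"] fejer_mean_integrable by simp
  obtain r where r: "strict_mono r"
    "AE z in circle. (\<lambda>m. fejer_riemann n (r m + Suc n) g z - fejer_mean n g z) \<longlonglongrightarrow> 0"
    using tendsto_L1_AE_subseq[OF int lim] by blast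
  show ?thesis
  proof (rule bfs_norm_le_of_AE_limit)
    show "fejer_riemann n (r m + Suc n) g \<in> borel_measurable circle" for m
      by (rule fejer_riemann_measurable[OF bfs_measurable[OF g]])
    show "AE z in circle. (\<lambda>m. fejer_riemann n (r m + Suc n) g z) \<longlonglongrightarrow> fejer_mean n g z"
      using r(2) by eventually_elim (rule LIM_zero_cancel)
    show "bfs_norm \<rho> (fejer_riemann n (r m + Suc n) g) \<le> bfs_norm \<rho> g" for m
      by (rule bfs_norm_fejer_riemann_le[OF tr g]) simp
  qed measurable
qed

lemma fejer_mean_L1:
  assumes "integrable circle g"
  shows "(\<integral>z. cmod (fejer_mean n g z) \<partial>circle) \<le> (\<integral>z. cmod (g z) \<partial>circle)"
  using L1.bfs_norm_fejer_mean_le[OF translation_invariant_L1, of g n] assms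
  by (simp add: bfs_L1 bfs_norm_L1 fejer_mean_integrable)

lemma fejer_mean_trig_poly_tendsto:
  assumes "trig_poly t"
  shows "(\<lambda>n. \<integral>z. cmod (fejer_mean n t z - t z) \<partial>circle) \<longlonglongrightarrow> 0"
  using assms
proof induction
  case (monom c k)
  have "(\<integral>z. cmod (fejer_mean n (\<lambda>z. c * z powi k) z - c * z powi k) \<partial>circle) = \<bar>fejer_weight n k - 1\<bar> * cmod c * (2 * pi)" for n
  proof -
    have "(\<integral>z. cmod (fejer_mean n (\<lambda>z. c * z powi k) z - c * z powi k) \<partial>circle) = (\<integral>z. \<bar>fejer_weight n k - 1\<bar> * cmod c \<partial>circle)"
    proof (rule Bochner_Integration.integral_cong[OF refl])
      fix z assume z: "z \<in> space circle"
      have "fejer_mean n (\<lambda>z. c * z powi k) z - c * z powi k = of_real (fejer_weight n k - 1) * (c * z powi k)"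
        by (simp add: fejer_mean_monom algebra_simps)
      then show "cmod (fejer_mean n (\<lambda>z. c * z powi k) z - c * z powi k) = \<bar>fejer_weight n k - 1\<bar> * cmod c"
        using norm_circle_eq_1[OF z] by (simp only: norm_mult norm_of_real norm_power_int power_int_1_left mult_1_right)
    qed
    then show ?thesis by (simp add: measure_circle)
  qed
  moreover have "(\<lambda>n. \<bar>fejer_weight n k - 1\<bar> * cmod c * (2 * pi)) \<longlonglongrightarrow> \<bar>1 - 1\<bar> * cmod c * (2 * pi)"
    by (intro tendsto_intros fejer_weight_tendsto)
  ultimately show ?case by simp
next
  case (add s t)
  have "(\<lambda>n. (\<integral>z. cmod (fejer_mean n s z - s z) \<partial>circle) + (\<integral>z. cmod (fejer_mean n t z - t z) \<partial>circle)) \<longlonglongrightarrow> 0 + 0"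
    by (intro tendsto_intros add.IH)
  then have lim: "(\<lambda>n. (\<integral>z. cmod (fejer_mean n s z - s z) \<partial>circle) + (\<integral>z. cmod (fejer_mean n t z - t z) \<partial>circle)) \<longlonglongrightarrow> 0"
    by simp
  note i = trig_poly_integrable[OF add.hyps(1)] trig_poly_integrable[OF add.hyps(2)]
  show ?case
  proof (rule tendsto_sandwich[OF always_eventually always_eventually tendsto_const lim]; rule allI)
    fix n
    have "(\<integral>z. cmod (fejer_mean n (\<lambda>z. s z + t z) z - (s z + t z)) \<partial>circle)
        \<le> (\<integral>z. cmod (fejer_mean n s z - s z) + cmod (fejer_mean n t z - t z) \<partial>circle)"
      using i fejer_mean_integrable
      by (intro integral_mono) (auto simp: fejer_mean_add add_diff_add norm_triangle_ineq)
    then show "(\<integral>z. cmod (fejer_mean n (\<lambda>z. s z + t z) z - (s z + t z)) \<partial>circle)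
        \<le> (\<integral>z. cmod (fejer_mean n s z - s z) \<partial>circle) + (\<integral>z. cmod (fejer_mean n t z - t z) \<partial>circle)"
      using i fejer_mean_integrable by simp
  qed simp
qed

lemma fejer_mean_tendsto_L1:
  assumes g: "integrable circle g"
  shows "(\<lambda>n. \<integral>z. cmod (fejer_mean n g z - g z) \<partial>circle) \<longlonglongrightarrow> 0"
proof (rule LIMSEQ_I)
  fix e :: real assume e: "e > 0"
  obtain t where t: "trig_poly t" "(\<integral>z. cmod (g z - t z) \<partial>circle) < e / 3"
    using integrable_approx_trig_poly[OF g, of "e / 3"] e by auto
  note ti = trig_poly_integrable[OF t(1)]
  obtain M where M: "\<And>n. n \<ge> M \<Longrightarrow> (\<integral>z. cmod (fejer_mean n t z - t z) \<partial>circle) < e / 3"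
    using LIMSEQ_D[OF fejer_mean_trig_poly_tendsto[OF t(1)], of "e/3"] e by auto
  have "(\<integral>z. cmod (fejer_mean n g z - g z) \<partial>circle) < e" if "n \<ge> M" for n
  proof -
    have "(\<integral>z. cmod (fejer_mean n g z - g z) \<partial>circle) \<le> (\<integral>z. cmod (fejer_mean n (\<lambda>z. g z - t z) z) \<partial>circle)
        + (\<integral>z. cmod (fejer_mean n t z - t z) \<partial>circle) + (\<integral>z. cmod (t z - g z) \<partial>circle)"
      using g ti fejer_mean_integrable by (intro integral_norm_triangle3) (auto simp: fejer_mean_diff)
    also have "\<dots> \<le> (\<integral>z. cmod (g z - t z) \<partial>circle) + (\<integral>z. cmod (fejer_mean n t z - t z) \<partial>circle) + (\<integral>z. cmod (g z - t z) \<partial>circle)"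
      using fejer_mean_L1[of "\<lambda>z. g z - t z" n] g ti by (simp add: norm_minus_commute)
    also have "\<dots> < e" using t(2) M[OF that] by simp
    finally show ?thesis .
  qed
  then show "\<exists>M. \<forall>n\<ge>M. norm ((\<integral>z. cmod (fejer_mean n g z - g z) \<partial>circle) - 0) < e"
    by auto
qed

text \<open>The negative coefficients of \<open>f\<close> vanish, so \<open>h\<close> times a Fejer
  mean of \<open>f\<close> is a combination of functions z^k h with k \<ge> 0. As \<open>h\<close>
  is bounded, these products converge to h f in L^1.\<close>

lemma H1_bounded_mult:
  assumes h: "h \<in> H1" "AE z in circle. cmod (h z) \<le> B" and f: "f \<in> H1"
  shows "(\<lambda>z. h z * f z) \<in> H1"
proof -
  have [measurable]: "h \<in> borel_measurable circle" "f \<in> borel_measurable circle"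
    using H1_integrable[OF h(1)] H1_integrable[OF f] by auto
  have "AE z in circle. 0 \<le> B" using h(2) by eventually_elim (meson norm_ge_zero order_trans)
  then have B: "0 \<le> B" by (simp add: eventually_const ae_filter_eq_bot_iff emeasure_circle)
  have hint: "integrable circle (\<lambda>z. h z * k z)" if "integrable circle k" for k
  proof (rule Bochner_Integration.integrable_bound)
    show "integrable circle (\<lambda>z. of_real B * k z)" using that by simp
    show "(\<lambda>z. h z * k z) \<in> borel_measurable circle" using that by measurable
    show "AE z in circle. norm (h z * k z) \<le> norm (of_real B * k z)"
      using h(2) by eventually_elim (use B in \<open>simp add: norm_mult mult_right_mono\<close>)
  qed
  show ?thesis
  proof (rule H1_limit)
    fix n
    have "(\<lambda>z. \<Sum>i\<le>n. \<Sum>j\<le>n. (fourier_coeff f (int i - int j) / of_nat (n + 1)) * (z powi (int i - int j) * h z)) \<in> H1"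
    proof (intro H1_sum)
      fix i j
      show "(\<lambda>z. (fourier_coeff f (int i - int j) / of_nat (n + 1)) * (z powi (int i - int j) * h z)) \<in> H1"
      proof (cases "int i - int j < 0")
        case True
        then show ?thesis using f H1_0 by (simp add: H1_def)
      next
        case False
        then show ?thesis by (intro H1_cmult H1_powi_mult h) auto
      qed
    qed
    then show "(\<lambda>z. h z * fejer_mean n f z) \<in> H1"
      by (simp add: fejer_mean_def sum_distrib_left sum_distrib_right sum_divide_distrib mult_ac)
  next
    show "integrable circle (\<lambda>z. h z * f z)" by (rule hint[OF H1_integrable[OF f]])
    have lim: "(\<lambda>n. B * (\<integral>z. cmod (fejer_mean n f z - f z) \<partial>circle)) \<longlonglongrightarrow> 0"
      using tendsto_mult_left[OF fejer_mean_tendsto_L1[OF H1_integrable[OF f]], of B] by simp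
    show "(\<lambda>n. \<integral>z. cmod (h z * fejer_mean n f z - h z * f z) \<partial>circle) \<longlonglongrightarrow> 0"
    proof (rule tendsto_sandwich[OF always_eventually always_eventually tendsto_const lim]; rule allI)
      fix n
      have d: "integrable circle (\<lambda>z. fejer_mean n f z - f z)"
        using H1_integrable[OF f] fejer_mean_integrable by simp
      have "(\<integral>z. cmod (h z * fejer_mean n f z - h z * f z) \<partial>circle) \<le> (\<integral>z. B * cmod (fejer_mean n f z - f z) \<partial>circle)"
      proof (rule integral_mono_AE)
        show "integrable circle (\<lambda>z. cmod (h z * fejer_mean n f z - h z * f z))"
          using hint[OF d] by (simp add: right_diff_distrib)
        show "integrable circle (\<lambda>z. B * cmod (fejer_mean n f z - f z))" using d by simp
        show "AE z in circle. cmod (h z * fejer_mean n f z - h z * f z) \<le> B * cmod (fejer_mean n f z - f z)"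
          using h(2) by eventually_elim (simp add: norm_mult mult_right_mono flip: right_diff_distrib)
      qed
      then show "(\<integral>z. cmod (h z * fejer_mean n f z - h z * f z) \<partial>circle) \<le> B * (\<integral>z. cmod (fejer_mean n f z - f z) \<partial>circle)"
        by simp
    qed simp
  qed
qed

lemma fourier_coeff_fejer_mean:
  "fourier_coeff (fejer_mean n g) k = of_real (fejer_weight n k) * fourier_coeff g k"
proof -
  have "fejer_mean n g = (\<lambda>z. \<Sum>i\<le>n. \<Sum>j\<le>n. (fourier_coeff g (int i - int j) / of_nat (n + 1)) * z powi (int i - int j))"
    by (simp add: fejer_mean_def fun_eq_iff sum_divide_distrib)
  then have "fourier_coeff (fejer_mean n g) k
      = (\<Sum>i\<le>n. \<Sum>j\<le>n. (fourier_coeff g (int i - int j) / of_nat (n + 1)) * (if k = int i - int j then 1 else 0))"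
    by (simp add: fourier_coeff_sum fourier_coeff_cmult fourier_coeff_powi del: of_nat_add of_nat_Suc times_divide_eq_left)
  also have "\<dots> = (\<Sum>i\<le>n. \<Sum>j\<le>n. of_real (if int i - int j = k then 1 else 0) * (fourier_coeff g k / of_nat (n + 1)))"
    by (intro sum.cong refl) auto
  also have "\<dots> = of_real (fejer_weight n k) * fourier_coeff g k"
    unfolding sum_distrib_right[symmetric] by (simp add: fejer_weight_def)
  finally show ?thesis .
qed

section \<open>Hardy spaces, closed subspaces and the Riesz projection\<close>

context banach_function_norm
begin

lemma hardy_add: "f \<in> hardy \<rho> \<Longrightarrow> g \<in> hardy \<rho> \<Longrightarrow> (\<lambda>z. f z + g z) \<in> hardy \<rho>"
  by (auto simp: hardy_iff intro: bfs_add H1_add)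

lemma hardy_diff: "f \<in> hardy \<rho> \<Longrightarrow> g \<in> hardy \<rho> \<Longrightarrow> (\<lambda>z. f z - g z) \<in> hardy \<rho>"
  by (auto simp: hardy_iff intro: bfs_diff H1_diff)

lemma hardy_cmult: "f \<in> hardy \<rho> \<Longrightarrow> (\<lambda>z. c * f z) \<in> hardy \<rho>"
  by (auto simp: hardy_iff intro: bfs_cmult H1_cmult)

lemma hardy_0: "(\<lambda>_. 0) \<in> hardy \<rho>"
  by (simp add: hardy_iff bfs_0 H1_0)

lemma hardy_sum: "(\<And>i. i \<in> I \<Longrightarrow> f i \<in> hardy \<rho>) \<Longrightarrow> (\<lambda>z. \<Sum>i\<in>I. f i z) \<in> hardy \<rho>"
  by (auto simp: hardy_iff intro: bfs_sum H1_sum)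

lemma hardy_powi_mult: "f \<in> hardy \<rho> \<Longrightarrow> 0 \<le> k \<Longrightarrow> (\<lambda>z. z powi k * f z) \<in> hardy \<rho>"
  by (auto simp: hardy_iff intro: bfs_powi_mult H1_powi_mult)

lemma hardy_bounded_mult:
  assumes "h \<in> H1" "AE z in circle. cmod (h z) \<le> B" "0 \<le> B" "f \<in> hardy \<rho>"
  shows "(\<lambda>z. h z * f z) \<in> hardy \<rho>"
  using assms bfs_mult_bounded[of f h B] H1_bounded_mult[of h B f] H1_integrable[of h]
  by (auto simp: hardy_iff)

lemma hardy_bfs: "f \<in> hardy \<rho> \<Longrightarrow> f \<in> bfs \<rho>"
  by (simp add: hardy_def)

lemma hardy_measurable: "f \<in> hardy \<rho> \<Longrightarrow> f \<in> borel_measurable circle"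
  by (simp add: hardy_def bfs_def)

lemma hardy_cong_AE:
  assumes "f \<in> hardy \<rho>" "g \<in> borel_measurable circle" "AE z in circle. f z = g z"
  shows "g \<in> hardy \<rho>"
  using assms bfs_cong_AE[of f g] H1_cong_AE[of f g] by (auto simp: hardy_iff)

section \<open>Closed subspaces of finite codimension\<close>

lemma closed_linear_subspaceI:
  assumes "M \<subseteq> hardy \<rho>" "(\<lambda>_. 0) \<in> M"
    and "\<And>f g. f \<in> M \<Longrightarrow> g \<in> M \<Longrightarrow> (\<lambda>z. f z + g z) \<in> M" "\<And>c f. f \<in> M \<Longrightarrow> (\<lambda>z. c * f z) \<in> M"
    and "\<And>F f. (\<And>n. F n \<in> M) \<Longrightarrow> f \<in> hardy \<rho> \<Longrightarrow> (\<lambda>n. bnorm \<rho> (\<lambda>z. F n z - f z)) \<longlonglongrightarrow> 0 \<Longrightarrow> f \<in> M"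
  shows "closed_linear_subspace (hardy \<rho>) (bfs_norm \<rho>) M"
  unfolding closed_linear_subspace_def
proof (intro conjI ballI allI impI)
  fix F :: "nat \<Rightarrow> complex \<Rightarrow> complex" and f
  assume F: "(\<forall>n. F n \<in> M) \<and> f \<in> hardy \<rho> \<and> (\<lambda>n. bfs_norm \<rho> (\<lambda>z. F n z - f z)) \<longlonglongrightarrow> 0"
  then have "(\<lambda>z. F n z - f z) \<in> bfs \<rho>" for n
    using assms(1) by (intro bfs_diff hardy_bfs) auto
  then have "(\<lambda>n. bnorm \<rho> (\<lambda>z. F n z - f z)) \<longlonglongrightarrow> 0"
    using F bfs_norm_tendsto_0_iff[of "\<lambda>n z. F n z - f z"] by simp
  then show "f \<in> M"
    using F by (intro assms(5)[of F f]) auto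
qed (use assms in auto)

lemma closed_linear_subspaceD:
  assumes "closed_linear_subspace (hardy \<rho>) (bfs_norm \<rho>) M"
  shows "M \<subseteq> hardy \<rho>" "(\<lambda>_. 0) \<in> M"
    and "\<And>f g. f \<in> M \<Longrightarrow> g \<in> M \<Longrightarrow> (\<lambda>z. f z + g z) \<in> M" "\<And>c f. f \<in> M \<Longrightarrow> (\<lambda>z. c * f z) \<in> M"
    and "\<And>f g. f \<in> M \<Longrightarrow> g \<in> M \<Longrightarrow> (\<lambda>z. f z - g z) \<in> M"
    and "\<And>F f. (\<And>n. F n \<in> M) \<Longrightarrow> f \<in> hardy \<rho> \<Longrightarrow> (\<lambda>n. bnorm \<rho> (\<lambda>z. F n z - f z)) \<longlonglongrightarrow> 0 \<Longrightarrow> f \<in> M"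
proof -
  note M = assms[unfolded closed_linear_subspace_def]
  show 1: "M \<subseteq> hardy \<rho>" and "(\<lambda>_. 0) \<in> M" using M by auto
  show 2: "(\<lambda>z. f z + g z) \<in> M" if "f \<in> M" "g \<in> M" for f g using M that by auto
  show 3: "(\<lambda>z. c * f z) \<in> M" if "f \<in> M" for c f using M that by auto
  show "(\<lambda>z. f z - g z) \<in> M" if "f \<in> M" "g \<in> M" for f g
    using 2[OF that(1) 3[OF that(2), of "-1"]] by simp
  fix F :: "nat \<Rightarrow> complex \<Rightarrow> complex" and f
  assume F: "\<And>n. F n \<in> M" "f \<in> hardy \<rho>" "(\<lambda>n. bnorm \<rho> (\<lambda>z. F n z - f z)) \<longlonglongrightarrow> 0"
  have "(\<lambda>z. F n z - f z) \<in> bfs \<rho>" for n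
    using 1 F by (intro bfs_diff hardy_bfs) auto
  then have "(\<lambda>n. bfs_norm \<rho> (\<lambda>z. F n z - f z)) \<longlonglongrightarrow> 0"
    using F(3) by (simp add: bfs_norm_tendsto_0_iff)
  then show "f \<in> M" using M F by blast
qed

text \<open>A vector outside a closed subspace has positive distance from it. Scaling by -t turns
  this into a bound for the coefficient of \<open>b\<close>.\<close>

lemma closed_subspace_distance:
  assumes M: "closed_linear_subspace (hardy \<rho>) (bfs_norm \<rho>) M" and b: "b \<in> hardy \<rho>" "b \<notin> M"
  obtains \<delta> where "0 < \<delta>" "\<And>m t. m \<in> M \<Longrightarrow> cmod t * \<delta> \<le> bnorm \<rho> (\<lambda>z. m z + t * b z)"
proof -
  note MD = closed_linear_subspaceD[OF M]
  have "\<exists>n. \<forall>m\<in>M. inverse (real (Suc n)) \<le> bnorm \<rho> (\<lambda>z. m z - b z)"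
  proof (rule ccontr)
    assume "\<not> ?thesis"
    then obtain F where F: "\<And>n. F n \<in> M" "\<And>n. bnorm \<rho> (\<lambda>z. F n z - b z) < inverse (real (Suc n))"
      by (metis not_le)
    have "(\<lambda>n. bnorm \<rho> (\<lambda>z. F n z - b z)) \<longlonglongrightarrow> 0"
      by (rule tendsto_sandwich[OF always_eventually always_eventually tendsto_const LIMSEQ_inverse_real_of_nat])
         (simp, blast intro: less_imp_le F(2))
    then show False using MD(6)[of F, OF F(1) b(1)] b(2) by simp
  qed
  then obtain n where n: "\<And>m. m \<in> M \<Longrightarrow> inverse (real (Suc n)) \<le> bnorm \<rho> (\<lambda>z. m z - b z)" by blast
  show thesis
  proof (rule that)
    show "0 < inverse (real (Suc n))" by simp
    fix m t assume m: "m \<in> M"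
    show "cmod t * inverse (real (Suc n)) \<le> bnorm \<rho> (\<lambda>z. m z + t * b z)"
    proof (cases "t = 0")
      case False
      have "(\<lambda>z. (- 1 / t) * m z) \<in> M" by (rule MD(4)[OF m])
      from n[OF this] have "cmod t * inverse (real (Suc n)) \<le> cmod t * bnorm \<rho> (\<lambda>z. (- 1 / t) * m z - b z)"
        by (rule mult_left_mono) simp
      also have "\<dots> = bnorm \<rho> (\<lambda>z. (- t) * ((- 1 / t) * m z - b z))"
      proof -
        have "(\<lambda>z. (- 1 / t) * m z - b z) \<in> borel_measurable circle"
          using m b MD(1) by (intro hardy_measurable hardy_diff hardy_cmult) auto
        then show ?thesis by (simp only: bnorm_cmult norm_minus_cancel)
      qed
      also have "(\<lambda>z. (- t) * ((- 1 / t) * m z - b z)) = (\<lambda>z. m z + t * b z)"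
        using False by (auto simp: fun_eq_iff field_simps)
      finally show ?thesis .
    qed simp
  qed
qed

text \<open>If vectors m_n + t_n b converge, then \<open>closed_subspace_distance\<close> makes t_n
  a Cauchy sequence of scalars. Subtracting its limit times \<open>b\<close> leaves a limit of
  elements of M, which lies in M.\<close>

lemma closed_subspace_add_line:
  assumes M: "closed_linear_subspace (hardy \<rho>) (bfs_norm \<rho>) M" and b: "b \<in> hardy \<rho>"
  shows "closed_linear_subspace (hardy \<rho>) (bfs_norm \<rho>) {f. \<exists>t. (\<lambda>z. f z - t * b z) \<in> M}"
proof (cases "b \<in> M")
  case True
  note MD = closed_linear_subspaceD[OF M]
  have "{f. \<exists>t. (\<lambda>z. f z - t * b z) \<in> M} = M"
  proof (intro equalityI subsetI)
    fix f assume "f \<in> {f. \<exists>t. (\<lambda>z. f z - t * b z) \<in> M}"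
    then obtain t where "(\<lambda>z. f z - t * b z) \<in> M" by auto
    from MD(3)[OF this MD(4)[OF True, of t]] show "f \<in> M" by simp
  next
    fix f assume "f \<in> M"
    then show "f \<in> {f. \<exists>t. (\<lambda>z. f z - t * b z) \<in> M}" by (auto intro: exI[of _ 0])
  qed
  then show ?thesis using M by simp
next
  case False
  note MD = closed_linear_subspaceD[OF M]
  obtain \<delta> where \<delta>: "0 < \<delta>" "\<And>m t. m \<in> M \<Longrightarrow> cmod t * \<delta> \<le> bnorm \<rho> (\<lambda>z. m z + t * b z)"
    using closed_subspace_distance[OF M b False] by blast
  show ?thesis
  proof (rule closed_linear_subspaceI)
    show sub: "{f. \<exists>t. (\<lambda>z. f z - t * b z) \<in> M} \<subseteq> hardy \<rho>"
    proof
      fix f assume "f \<in> {f. \<exists>t. (\<lambda>z. f z - t * b z) \<in> M}"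
      then obtain t where "(\<lambda>z. f z - t * b z) \<in> hardy \<rho>" using MD(1) by auto
      from hardy_add[OF this hardy_cmult[OF b, of t]] show "f \<in> hardy \<rho>" by simp
    qed
    show "(\<lambda>_. 0) \<in> {f. \<exists>t. (\<lambda>z. f z - t * b z) \<in> M}"
      using MD(2) by (auto intro: exI[of _ 0])
    show "(\<lambda>z. f z + g z) \<in> {f. \<exists>t. (\<lambda>z. f z - t * b z) \<in> M}"
      if "f \<in> {f. \<exists>t. (\<lambda>z. f z - t * b z) \<in> M}" "g \<in> {f. \<exists>t. (\<lambda>z. f z - t * b z) \<in> M}" for f g
    proof -
      from that obtain s t where "(\<lambda>z. f z - s * b z) \<in> M" "(\<lambda>z. g z - t * b z) \<in> M" by auto
      from MD(3)[OF this] show ?thesis by (auto intro!: exI[of _ "s + t"] simp: algebra_simps)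
    qed
    show "(\<lambda>z. c * f z) \<in> {f. \<exists>t. (\<lambda>z. f z - t * b z) \<in> M}"
      if "f \<in> {f. \<exists>t. (\<lambda>z. f z - t * b z) \<in> M}" for c f
    proof -
      from that obtain s where "(\<lambda>z. f z - s * b z) \<in> M" by auto
      from MD(4)[OF this, of c] show ?thesis by (auto intro!: exI[of _ "c * s"] simp: algebra_simps)
    qed
  next
    fix F f assume F: "\<And>n. F n \<in> {f. \<exists>t. (\<lambda>z. f z - t * b z) \<in> M}" and f: "f \<in> hardy \<rho>"
      and lim: "(\<lambda>n. bnorm \<rho> (\<lambda>z. F n z - f z)) \<longlonglongrightarrow> 0"
    from F obtain t where t: "\<And>n. (\<lambda>z. F n z - t n * b z) \<in> M"
      by (simp del: Collect_mem_eq) metis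
    have FH: "F n \<in> hardy \<rho>" for n
    proof -
      from t[of n] MD(1) have "(\<lambda>z. F n z - t n * b z) \<in> hardy \<rho>" by auto
      from hardy_add[OF this hardy_cmult[OF b, of "t n"]] show ?thesis by simp
    qed
    have Fd: "(\<lambda>z. F n z - f z) \<in> bfs \<rho>" for n
      by (intro bfs_diff hardy_bfs FH f)
    have diff: "cmod (t m - t n) * \<delta> \<le> bnorm \<rho> (\<lambda>z. F m z - f z) + bnorm \<rho> (\<lambda>z. F n z - f z)" for m n
    proof -
      have "cmod (t m - t n) * \<delta> \<le> bnorm \<rho> (\<lambda>z. ((F m z - t m * b z) - (F n z - t n * b z)) + (t m - t n) * b z)"
        by (rule \<delta>(2)[OF MD(5)[OF t t]])
      also have "(\<lambda>z. ((F m z - t m * b z) - (F n z - t n * b z)) + (t m - t n) * b z) = (\<lambda>z. (F m z - f z) - (F n z - f z))"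
        by (simp add: fun_eq_iff algebra_simps)
      also have "bnorm \<rho> \<dots> \<le> bnorm \<rho> (\<lambda>z. F m z - f z) + bnorm \<rho> (\<lambda>z. F n z - f z)"
        by (rule bnorm_diff[OF Fd Fd])
      finally show ?thesis .
    qed
    have "Cauchy t"
    proof (rule CauchyI)
      fix e :: real assume "e > 0"
      then obtain N where N: "\<And>n. n \<ge> N \<Longrightarrow> bnorm \<rho> (\<lambda>z. F n z - f z) < e * \<delta> / 2"
        using LIMSEQ_D[OF lim, of "e * \<delta> / 2"] \<delta>(1) by auto
      have "norm (t m - t n) < e" if "m \<ge> N" "n \<ge> N" for m n
      proof -
        have "cmod (t m - t n) * \<delta> < e * \<delta>"
          using diff[of m n] N[OF that(1)] N[OF that(2)] by simp
        then show ?thesis using \<delta>(1) by simp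
      qed
      then show "\<exists>M. \<forall>m\<ge>M. \<forall>n\<ge>M. norm (t m - t n) < e" by blast
    qed
    then obtain s where s: "t \<longlonglongrightarrow> s" using Cauchy_convergent convergent_def by blast
    have bb: "bnorm \<rho> (\<lambda>z. (F n z - t n * b z) - (f z - s * b z)) \<le> bnorm \<rho> (\<lambda>z. F n z - f z) + cmod (t n - s) * bnorm \<rho> b" for n
    proof -
      have "(\<lambda>z. (F n z - t n * b z) - (f z - s * b z)) = (\<lambda>z. (F n z - f z) - (t n - s) * b z)"
        by (simp add: fun_eq_iff algebra_simps)
      then show ?thesis
        using bnorm_diff[OF Fd bfs_cmult[OF hardy_bfs[OF b]], of n "t n - s"] by (simp add: bnorm_cmult hardy_measurable[OF b])
    qed
    have "(\<lambda>n. bnorm \<rho> (\<lambda>z. F n z - f z) + cmod (t n - s) * bnorm \<rho> b) \<longlonglongrightarrow> 0 + cmod (s - s) * bnorm \<rho> b"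
      by (intro tendsto_intros lim s)
    then have lim2: "(\<lambda>n. bnorm \<rho> (\<lambda>z. F n z - f z) + cmod (t n - s) * bnorm \<rho> b) \<longlonglongrightarrow> 0" by simp
    have "(\<lambda>n. bnorm \<rho> (\<lambda>z. (F n z - t n * b z) - (f z - s * b z))) \<longlonglongrightarrow> 0"
      by (rule tendsto_sandwich[OF always_eventually always_eventually tendsto_const lim2])
         (simp, blast intro: bb)
    then have "(\<lambda>z. f z - s * b z) \<in> M"
      using MD(6)[of "\<lambda>n z. F n z - t n * b z", OF t] hardy_diff[OF f hardy_cmult[OF b]] by blast
    then show "f \<in> {f. \<exists>t. (\<lambda>z. f z - t * b z) \<in> M}" by auto
  qed
qed

lemma closed_subspace_add_span:
  assumes M: "closed_linear_subspace (hardy \<rho>) (bfs_norm \<rho>) M" and "finite B" "B \<subseteq> hardy \<rho>"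
  shows "closed_linear_subspace (hardy \<rho>) (bfs_norm \<rho>) {f. \<exists>c. (\<lambda>z. f z - (\<Sum>b\<in>B. c b * b z)) \<in> M}"
  using assms(2,3)
proof (induction B rule: finite_induct)
  case empty
  then show ?case using M by simp
next
  case (insert b B)
  let ?S = "{f. \<exists>c. (\<lambda>z. f z - (\<Sum>b\<in>B. c b * b z)) \<in> M}"
  have "{f. \<exists>t. (\<lambda>z. f z - t * b z) \<in> ?S} = {f. \<exists>c. (\<lambda>z. f z - (\<Sum>b\<in>insert b B. c b * b z)) \<in> M}"
  proof (intro equalityI subsetI)
    fix f assume "f \<in> {f. \<exists>t. (\<lambda>z. f z - t * b z) \<in> ?S}"
    then obtain t c where tc: "(\<lambda>z. f z - t * b z - (\<Sum>b\<in>B. c b * b z)) \<in> M" by auto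
    have "(\<Sum>b'\<in>insert b B. (c(b := t)) b' * b' z) = t * b z + (\<Sum>b\<in>B. c b * b z)" for z
      using insert.hyps by (auto intro!: sum.cong)
    then have "(\<lambda>z. f z - (\<Sum>b'\<in>insert b B. (c(b := t)) b' * b' z)) \<in> M"
      using tc by (simp add: diff_diff_eq)
    then show "f \<in> {f. \<exists>c. (\<lambda>z. f z - (\<Sum>b\<in>insert b B. c b * b z)) \<in> M}" by blast
  next
    fix f assume "f \<in> {f. \<exists>c. (\<lambda>z. f z - (\<Sum>b\<in>insert b B. c b * b z)) \<in> M}"
    then obtain c where "(\<lambda>z. f z - (\<Sum>b\<in>insert b B. c b * b z)) \<in> M" by auto
    then have "(\<lambda>z. f z - c b * b z - (\<Sum>b\<in>B. c b * b z)) \<in> M"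
      using insert.hyps by (simp add: diff_diff_eq)
    then show "f \<in> {f. \<exists>t. (\<lambda>z. f z - t * b z) \<in> ?S}" by blast
  qed
  moreover have "closed_linear_subspace (hardy \<rho>) (bfs_norm \<rho>) {f. \<exists>t. (\<lambda>z. f z - t * b z) \<in> ?S}"
    using insert by (intro closed_subspace_add_line) auto
  ultimately show ?case by simp
qed

text \<open>The coordinates refer to a spanning set of the quotient of minimal size.\<close>

lemma finite_codimension_coordinates:
  assumes M: "closed_linear_subspace (hardy \<rho>) (bfs_norm \<rho>) M" and fc: "finite_codimension (hardy \<rho>) M"
  shows "\<exists>B \<phi>. finite B \<and> B \<subseteq> hardy \<rho> \<and> (\<forall>f\<in>hardy \<rho>. (\<lambda>z. f z - (\<Sum>b\<in>B. \<phi> b f * b z)) \<in> M) \<and>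
    (\<forall>b\<in>B. \<forall>f\<in>hardy \<rho>. \<forall>g\<in>hardy \<rho>. \<phi> b (\<lambda>z. f z + g z) = \<phi> b f + \<phi> b g) \<and>
    (\<forall>b\<in>B. \<forall>c. \<forall>f\<in>hardy \<rho>. \<phi> b (\<lambda>z. c * f z) = c * \<phi> b f) \<and>
    (\<forall>b\<in>B. \<exists>C\<ge>0. \<forall>f\<in>hardy \<rho>. cmod (\<phi> b f) \<le> C * bnorm \<rho> f)"
proof -
  note MD = closed_linear_subspaceD[OF M]
  define Q where "Q = (\<lambda>B. finite B \<and> B \<subseteq> hardy \<rho> \<and> (\<forall>f\<in>hardy \<rho>. \<exists>c. (\<lambda>z. f z - (\<Sum>b\<in>B. c b * b z)) \<in> M))"
  have "\<exists>B. Q B" using fc by (auto simp: Q_def finite_codimension_def)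
  then obtain B where B: "Q B" "\<And>B'. Q B' \<Longrightarrow> card B \<le> card B'"
    using ex_has_least_nat[of Q _ card] by blast
  have Bf: "finite B" "B \<subseteq> hardy \<rho>" "\<And>f. f \<in> hardy \<rho> \<Longrightarrow> \<exists>c. (\<lambda>z. f z - (\<Sum>b\<in>B. c b * b z)) \<in> M"
    using B(1) by (auto simp: Q_def)
  \<comment> \<open>The sum of M and the span of the basis vectors other than \<open>b\<close>. It
    is closed, and its distance from \<open>b\<close> will bound the coordinate of
    \<open>b\<close>.\<close>
  define S where "S = (\<lambda>b. {f. \<exists>c. (\<lambda>z. f z - (\<Sum>b\<in>B - {b}. c b * b z)) \<in> M})"
  have S: "closed_linear_subspace (hardy \<rho>) (bfs_norm \<rho>) (S b)" for b
    unfolding S_def using Bf by (intro closed_subspace_add_span[OF M]) auto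
  \<comment> \<open>If \<open>b\<close> lay in \<open>S b\<close>, it could be dropped from the
    spanning set, against minimality.\<close>
  have bS: "b \<notin> S b" if b: "b \<in> B" for b
  proof
    assume "b \<in> S b"
    then obtain d where d: "(\<lambda>z. b z - (\<Sum>b\<in>B - {b}. d b * b z)) \<in> M" by (auto simp: S_def)
    have "Q (B - {b})"
      unfolding Q_def
    proof (intro conjI ballI)
      fix f assume "f \<in> hardy \<rho>"
      then obtain c where c: "(\<lambda>z. f z - (\<Sum>b\<in>B. c b * b z)) \<in> M" using Bf(3) by blast
      have "(\<lambda>z. (f z - (\<Sum>b\<in>B. c b * b z)) + c b * (b z - (\<Sum>b\<in>B - {b}. d b * b z))) \<in> M"
        by (rule MD(3)[OF c MD(4)[OF d]])
      also have "(\<lambda>z. (f z - (\<Sum>b\<in>B. c b * b z)) + c b * (b z - (\<Sum>b\<in>B - {b}. d b * b z)))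
          = (\<lambda>z. f z - (\<Sum>b'\<in>B - {b}. (c b' + c b * d b') * b' z))"
        using sum.remove[OF Bf(1) b, of "\<lambda>b. c b * b z" for z]
        by (simp add: fun_eq_iff algebra_simps sum.distrib sum_distrib_left)
      finally show "\<exists>c. (\<lambda>z. f z - (\<Sum>b\<in>B - {b}. c b * b z)) \<in> M"
        by (rule exI[of _ "\<lambda>b'. c b' + c b * d b'"])
    qed (use Bf in auto)
    then have "card B \<le> card (B - {b})" by (rule B(2))
    then show False using card_Diff1_less[OF Bf(1) b] by simp
  qed
  have ex: "\<exists>c. (\<lambda>z. f z - (\<Sum>b\<in>B. c b * b z)) \<in> M" if "f \<in> hardy \<rho>" for f
    using Bf(3)[OF that] .
  define \<phi> where "\<phi> = (\<lambda>b f. (SOME c. (\<lambda>z. f z - (\<Sum>b\<in>B. c b * b z)) \<in> M) b)"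
  have \<phi>M: "(\<lambda>z. f z - (\<Sum>b\<in>B. \<phi> b f * b z)) \<in> M" if "f \<in> hardy \<rho>" for f
    unfolding \<phi>_def using someI_ex[OF ex[OF that]] .
  \<comment> \<open>The coefficients are picked by choice. Their uniqueness modulo
    \<open>S b\<close> is what makes each of them a linear function of \<open>f\<close>.\<close>
  have inS: "(\<lambda>z. f z - t * b z) \<in> S b \<Longrightarrow> b \<in> B \<Longrightarrow> f \<in> hardy \<rho> \<Longrightarrow> \<phi> b f = t" for f t b
  proof -
    assume t: "(\<lambda>z. f z - t * b z) \<in> S b" and b: "b \<in> B" and f: "f \<in> hardy \<rho>"
    have "(\<lambda>z. (f z - \<phi> b f * b z) - (\<Sum>b\<in>B - {b}. \<phi> b f * b z)) \<in> M"
      using \<phi>M[OF f] sum.remove[OF Bf(1) b, of "\<lambda>b. \<phi> b f * b z" for z] by (simp add: diff_diff_eq)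
    then have "(\<lambda>z. f z - \<phi> b f * b z) \<in> S b" by (auto simp: S_def intro!: exI[of _ "\<lambda>b. \<phi> b f"])
    from closed_linear_subspaceD(5)[OF S this t]
    have *: "(\<lambda>z. (t - \<phi> b f) * b z) \<in> S b" by (simp add: algebra_simps)
    show "\<phi> b f = t"
    proof (rule ccontr)
      assume "\<phi> b f \<noteq> t"
      with closed_linear_subspaceD(4)[OF S *, of "1 / (t - \<phi> b f)"] have "b \<in> S b"
        by simp
      then show False using bS[OF b] by simp
    qed
  qed
  have \<phi>S: "(\<lambda>z. f z - \<phi> b f * b z) \<in> S b" if "b \<in> B" "f \<in> hardy \<rho>" for b f
  proof -
    have "(\<lambda>z. (f z - \<phi> b f * b z) - (\<Sum>b\<in>B - {b}. \<phi> b f * b z)) \<in> M"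
      using \<phi>M[OF that(2)] sum.remove[OF Bf(1) that(1), of "\<lambda>b. \<phi> b f * b z" for z] by (simp add: diff_diff_eq)
    then show ?thesis by (auto simp: S_def intro!: exI[of _ "\<lambda>b. \<phi> b f"])
  qed
  show ?thesis
  proof (intro exI[of _ B] exI[of _ \<phi>] conjI ballI allI)
    show "finite B" "B \<subseteq> hardy \<rho>" by (rule Bf)+
    show "(\<lambda>z. f z - (\<Sum>b\<in>B. \<phi> b f * b z)) \<in> M" if "f \<in> hardy \<rho>" for f by (rule \<phi>M[OF that])
  next
    fix b f g assume b: "b \<in> B" and f: "f \<in> hardy \<rho>" and g: "g \<in> hardy \<rho>"
    have "(\<lambda>z. (f z + g z) - (\<phi> b f + \<phi> b g) * b z) \<in> S b"
      using closed_linear_subspaceD(3)[OF S \<phi>S[OF b f] \<phi>S[OF b g]] by (simp add: algebra_simps)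
    then show "\<phi> b (\<lambda>z. f z + g z) = \<phi> b f + \<phi> b g"
      by (rule inS[OF _ b hardy_add[OF f g]])
  next
    fix b c f assume b: "b \<in> B" and f: "f \<in> hardy \<rho>"
    have "(\<lambda>z. c * f z - (c * \<phi> b f) * b z) \<in> S b"
      using closed_linear_subspaceD(4)[OF S \<phi>S[OF b f], of c] by (simp add: algebra_simps)
    then show "\<phi> b (\<lambda>z. c * f z) = c * \<phi> b f"
      by (rule inS[OF _ b hardy_cmult[OF f]])
  next
    fix b assume b: "b \<in> B"
    obtain \<delta> where \<delta>: "0 < \<delta>" "\<And>m t. m \<in> S b \<Longrightarrow> cmod t * \<delta> \<le> bnorm \<rho> (\<lambda>z. m z + t * b z)"
      using closed_subspace_distance[OF S _ bS[OF b]] b Bf(2) by blast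
    have "cmod (\<phi> b f) \<le> (1 / \<delta>) * bnorm \<rho> f" if "f \<in> hardy \<rho>" for f
      using \<delta>(2)[OF \<phi>S[OF b that], of "\<phi> b f"] \<delta>(1) by (simp add: field_simps)
    then show "\<exists>C\<ge>0. \<forall>f\<in>hardy \<rho>. cmod (\<phi> b f) \<le> C * bnorm \<rho> f"
      using \<delta>(1) by (intro exI[of _ "1 / \<delta>"]) auto
  qed
qed

text \<open>\<open>compact_operator\<close> does not state boundedness. It follows by normalisation:
  unit vectors whose images have norms above n leave no convergent subsequence of images.\<close>

lemma compact_operator_bounded:
  assumes K: "compact_operator (hardy \<rho>) (bfs_norm \<rho>) K"
  obtains C where "0 \<le> C" "\<And>f. f \<in> hardy \<rho> \<Longrightarrow> bnorm \<rho> (K f) \<le> C * bnorm \<rho> f"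
proof -
  have lin: "linear_operator (hardy \<rho>) K" using K by (simp add: compact_operator_def)
  have KH: "K f \<in> hardy \<rho>" if "f \<in> hardy \<rho>" for f using lin that by (auto simp: linear_operator_def)
  have Kc: "AE z in circle. K (\<lambda>x. c * f x) z = c * K f z" if "f \<in> hardy \<rho>" for c f
    using lin that by (simp add: linear_operator_def)
  have Kcong: "AE z in circle. K f z = K g z" if "f \<in> hardy \<rho>" "g \<in> hardy \<rho>" "AE z in circle. f z = g z" for f g
    using lin that by (simp add: linear_operator_def)
  have "\<exists>n::nat. \<forall>f\<in>hardy \<rho>. bnorm \<rho> (K f) \<le> real n * bnorm \<rho> f"
  proof (rule ccontr)
    assume "\<not> ?thesis"
    then obtain F where F: "\<And>n. F n \<in> hardy \<rho>" "\<And>n. real n * bnorm \<rho> (F n) < bnorm \<rho> (K (F n))"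
      by (metis not_le)
    \<comment> \<open>A vector of norm 0 vanishes a.e. As \<open>K\<close> respects a.e. equality
      and scalar multiples, its image then has norm 0 as well.\<close>
    have pos: "bnorm \<rho> (F n) > 0" for n
    proof (rule ccontr)
      assume "\<not> ?thesis"
      then have "bnorm \<rho> (F n) = 0" using bnorm_nonneg[of \<rho> "F n"] by linarith
      then have "AE z in circle. F n z = 0 * F n z"
        using bnorm_eq_0_iff[OF hardy_bfs[OF F(1)]] by simp
      from Kcong[OF F(1) hardy_cmult[OF F(1)] this] have "AE z in circle. K (F n) z = 0"
        using Kc[OF F(1), of 0 n] by eventually_elim simp
      then have "bnorm \<rho> (K (F n)) = 0"
        using bnorm_eq_0_iff[OF hardy_bfs[OF KH[OF F(1)]]] by simp
      then show False using F(2)[of n] \<open>bnorm \<rho> (F n) = 0\<close> by simp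
    qed
    define G where "G = (\<lambda>n z. of_real (1 / bnorm \<rho> (F n)) * F n z)"
    have GH: "G n \<in> hardy \<rho>" for n unfolding G_def by (rule hardy_cmult[OF F(1)])
    have G1: "bnorm \<rho> (G n) = 1" for n
      unfolding G_def using pos[of n] by (subst bnorm_cmult[OF hardy_measurable[OF F(1)]]) (simp add: norm_divide)
    have GK: "bnorm \<rho> (K (G n)) > real n" for n
    proof -
      have "bnorm \<rho> (K (G n)) = bnorm \<rho> (\<lambda>z. of_real (1 / bnorm \<rho> (F n)) * K (F n) z)"
        unfolding G_def using Kc[OF F(1), of "of_real (1 / bnorm \<rho> (F n))" n]
        by (intro bnorm_cong_AE hardy_measurable KH hardy_cmult F(1)) auto
      also have "\<dots> = bnorm \<rho> (K (F n)) / bnorm \<rho> (F n)"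
        using pos[of n] by (subst bnorm_cmult[OF hardy_measurable[OF KH[OF F(1)]]]) (simp add: norm_divide)
      also have "\<dots> > real n" using F(2)[of n] pos[of n] by (simp add: field_simps)
      finally show ?thesis .
    qed
    have "\<forall>n. bfs_norm \<rho> (G n) \<le> ennreal 1"
      using bfs_norm_eq_bnorm[OF hardy_bfs[OF GH]] G1 by simp
    then obtain r g where r: "strict_mono r" "g \<in> hardy \<rho>" "(\<lambda>n. bfs_norm \<rho> (\<lambda>z. K (G (r n)) z - g z)) \<longlonglongrightarrow> 0"
      using K GH unfolding compact_operator_def by blast
    have d: "(\<lambda>z. K (G (r n)) z - g z) \<in> bfs \<rho>" for n
      by (intro bfs_diff hardy_bfs KH GH r(2))
    then have "(\<lambda>n. bnorm \<rho> (\<lambda>z. K (G (r n)) z - g z)) \<longlonglongrightarrow> 0"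
      using r(3) by (simp add: bfs_norm_tendsto_0_iff)
    then obtain N where N: "\<And>n. n \<ge> N \<Longrightarrow> bnorm \<rho> (\<lambda>z. K (G (r n)) z - g z) < 1"
      using LIMSEQ_D[of _ 0 1] by force
    obtain n where n: "n \<ge> N" "real n > 1 + bnorm \<rho> g"
      by (metis reals_Archimedean2 less_le_trans max.cobounded1 max.cobounded2 of_nat_le_iff le_less_trans)
    have "bnorm \<rho> (K (G (r n))) \<le> bnorm \<rho> (\<lambda>z. K (G (r n)) z - g z) + bnorm \<rho> g"
      using bnorm_add[OF d[of n] hardy_bfs[OF r(2)]] by simp
    also have "\<dots> < real n" using N[OF n(1)] n(2) by simp
    also have "\<dots> \<le> real (r n)" using seq_suble[OF r(1), of n] by simp
    finally show False using GK[of "r n"] by simp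
  qed
  then show thesis using that of_nat_0_le_iff by blast
qed

end

section \<open>The Riesz projection\<close>

locale riesz_space = banach_function_norm +
  assumes riesz: "riesz_bounded \<rho>"
begin

text \<open>The norm bound is assumed for some function with the right coefficients, while
  \<open>riesz_projection\<close> picks one by choice; both agree a.e. because coefficients
  determine a function. The value |C| + 1 makes the constant positive.\<close>

lemma riesz_projection_bounded:
  obtains C where "0 < C" "\<And>f. f \<in> bfs \<rho> \<Longrightarrow> is_riesz_projection \<rho> f (riesz_projection \<rho> f)"
    "\<And>f. f \<in> bfs \<rho> \<Longrightarrow> bnorm \<rho> (riesz_projection \<rho> f) \<le> C * bnorm \<rho> f"
proof -
  obtain C :: real where C: "\<And>f. f \<in> bfs \<rho> \<Longrightarrow> \<exists>g. is_riesz_projection \<rho> f g \<and> bfs_norm \<rho> g \<le> ennreal C * bfs_norm \<rho> f"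
    using riesz unfolding riesz_bounded_def by blast
  have P: "is_riesz_projection \<rho> f (riesz_projection \<rho> f)" if "f \<in> bfs \<rho>" for f
    unfolding riesz_projection_def using C[OF that] by (metis someI_ex)
  have bd: "bnorm \<rho> (riesz_projection \<rho> f) \<le> (\<bar>C\<bar> + 1) * bnorm \<rho> f" if f: "f \<in> bfs \<rho>" for f
  proof -
    obtain g where g: "is_riesz_projection \<rho> f g" "bfs_norm \<rho> g \<le> ennreal C * bfs_norm \<rho> f" using C[OF f] by blast
    have Pf: "riesz_projection \<rho> f \<in> bfs \<rho>" and gb: "g \<in> bfs \<rho>"
      using P[OF f] g(1) by (auto simp: is_riesz_projection_def)
    have "AE z in circle. riesz_projection \<rho> f z = g z"
      using P[OF f] g(1) by (intro fourier_coeff_eq_imp_AE bfs_integrable Pf gb) (simp add: is_riesz_projection_def)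
    then have "bnorm \<rho> (riesz_projection \<rho> f) = bnorm \<rho> g"
      using Pf gb by (intro bnorm_cong_AE) (auto dest: bfs_measurable)
    also have "\<dots> \<le> (\<bar>C\<bar> + 1) * bnorm \<rho> f"
    proof (rule bnorm_leI)
      have "ennreal C * bfs_norm \<rho> f \<le> ennreal (\<bar>C\<bar> + 1) * ennreal (bnorm \<rho> f)"
        unfolding bfs_norm_eq_bnorm[OF f] by (intro mult_right_mono ennreal_leI) auto
      then show "bfs_norm \<rho> g \<le> ennreal ((\<bar>C\<bar> + 1) * bnorm \<rho> f)"
        using g(2) by (simp add: ennreal_mult)
    qed simp
    finally show ?thesis .
  qed
  show thesis by (rule that[of "\<bar>C\<bar> + 1"]) (use P bd in auto)
qed

lemma riesz_projection_is: "f \<in> bfs \<rho> \<Longrightarrow> is_riesz_projection \<rho> f (riesz_projection \<rho> f)"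
  using riesz_projection_bounded by metis

lemma riesz_projection_hardy: "f \<in> bfs \<rho> \<Longrightarrow> riesz_projection \<rho> f \<in> hardy \<rho>"
  using riesz_projection_is[of f] by (auto simp: is_riesz_projection_def hardy_def)

lemma riesz_projection_eqI:
  assumes "f \<in> bfs \<rho>" "g \<in> hardy \<rho>" "\<And>k. 0 \<le> k \<Longrightarrow> fourier_coeff g k = fourier_coeff f k"
  shows "AE z in circle. riesz_projection \<rho> f z = g z"
proof (rule fourier_coeff_eq_imp_AE)
  show "fourier_coeff (riesz_projection \<rho> f) k = fourier_coeff g k" for k
    using riesz_projection_is[OF assms(1)] assms(2) assms(3)[of k] by (simp add: is_riesz_projection_def hardy_def)
qed (use riesz_projection_hardy[OF assms(1)] assms(2) in \<open>auto intro: bfs_integrable hardy_bfs\<close>)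

lemma riesz_projection_hardy_id: "f \<in> hardy \<rho> \<Longrightarrow> AE z in circle. riesz_projection \<rho> f z = f z"
  by (rule riesz_projection_eqI) (auto intro: hardy_bfs)

lemma riesz_projection_coeff:
  "f \<in> bfs \<rho> \<Longrightarrow> 0 \<le> k \<Longrightarrow> fourier_coeff (riesz_projection \<rho> f) k = fourier_coeff f k"
  using riesz_projection_is[of f] by (simp add: is_riesz_projection_def)

lemma riesz_projection_add:
  assumes "f \<in> bfs \<rho>" "g \<in> bfs \<rho>"
  shows "AE z in circle. riesz_projection \<rho> (\<lambda>z. f z + g z) z = riesz_projection \<rho> f z + riesz_projection \<rho> g z"
proof (rule riesz_projection_eqI)
  fix k :: int assume "0 \<le> k"
  then show "fourier_coeff (\<lambda>z. riesz_projection \<rho> f z + riesz_projection \<rho> g z) k = fourier_coeff (\<lambda>z. f z + g z) k"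
    using assms by (simp add: fourier_coeff_add bfs_integrable hardy_bfs riesz_projection_hardy riesz_projection_coeff)
qed (auto intro!: bfs_add hardy_add riesz_projection_hardy assms)

lemma riesz_projection_cmult:
  assumes "f \<in> bfs \<rho>"
  shows "AE z in circle. riesz_projection \<rho> (\<lambda>z. c * f z) z = c * riesz_projection \<rho> f z"
proof (rule riesz_projection_eqI)
  fix k :: int assume "0 \<le> k"
  then show "fourier_coeff (\<lambda>z. c * riesz_projection \<rho> f z) k = fourier_coeff (\<lambda>z. c * f z) k"
    using assms by (simp add: fourier_coeff_cmult riesz_projection_coeff)
qed (auto intro!: bfs_cmult hardy_cmult riesz_projection_hardy assms)

lemma riesz_projection_cong_AE:
  assumes "f \<in> bfs \<rho>" "g \<in> bfs \<rho>" "AE z in circle. f z = g z"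
  shows "AE z in circle. riesz_projection \<rho> f z = riesz_projection \<rho> g z"
proof (rule riesz_projection_eqI[OF assms(1) riesz_projection_hardy[OF assms(2)]])
  fix k :: int assume "0 \<le> k"
  then show "fourier_coeff (riesz_projection \<rho> g) k = fourier_coeff f k"
    using assms fourier_coeff_cong_AE[of f g k] by (simp add: riesz_projection_coeff bfs_measurable)
qed

end

section \<open>Symbols in C + Hinf\<close>

lemma trig_poly_factor:
  assumes "trig_poly t"
  shows "\<exists>(m::nat) p. \<forall>z. z \<noteq> 0 \<longrightarrow> t z = z powi (- int m) * poly p z"
  using assms
proof induction
  case (monom c k)
  show ?case
  proof (cases "k \<ge> 0")
    case True
    then show ?thesis
      by (intro exI[of _ 0] exI[of _ "Polynomial.monom c (nat k)"]) (auto simp: poly_monom power_int_def)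
  next
    case False
    then show ?thesis by (intro exI[of _ "nat (- k)"] exI[of _ "[:c:]"]) auto
  qed
next
  case (add s t)
  then obtain m p n q where mp: "\<forall>z. z \<noteq> 0 \<longrightarrow> s z = z powi (- int m) * poly p z"
    "\<forall>z. z \<noteq> 0 \<longrightarrow> t z = z powi (- int n) * poly q z" by auto
  have "s z + t z = z powi (- int (m + n)) * poly (Polynomial.monom 1 n * p + Polynomial.monom 1 m * q) z" if "z \<noteq> 0" for z
    using mp that by (simp add: poly_monom power_int_diff power_int_minus field_simps power_add)
  then show ?case by blast
qed

lemma AE_norm_le_Linf_norm:
  assumes "Linf_norm a < \<infinity>"
  shows "AE z in circle. cmod (a z) \<le> enn2real (Linf_norm a)"
proof -
  have "AE z in circle. ennreal (cmod (a z)) \<le> Linf_norm a"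
    unfolding Linf_norm_def by (rule esssup_AE)
  moreover have "Linf_norm a = ennreal (enn2real (Linf_norm a))"
    using assms by (simp add: less_top)
  ultimately show ?thesis
    by (metis (mono_tags, lifting) eventually_mono ennreal_le_iff enn2real_nonneg)
qed

lemma Linf_norm_leI:
  assumes "a \<in> borel_measurable circle" "AE z in circle. cmod (a z) \<le> c"
  shows "Linf_norm a \<le> ennreal c"
  unfolding Linf_norm_def using assms by (intro esssup_I) (auto intro: ennreal_leI)

lemma Hinf_H1:
  assumes "g \<in> Hinf"
  shows "g \<in> H1"
proof -
  have g: "g \<in> borel_measurable circle" "Linf_norm g < \<infinity>" "\<forall>k<0. fourier_coeff g k = 0"
    using assms by (auto simp: Hinf_def Linf_def)
  from integrable_circle_bounded[OF g(1) AE_norm_le_Linf_norm[OF g(2)]] g(3)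
  show ?thesis by (simp add: H1_def)
qed

lemma C_plus_Hinf_measurable: "a \<in> C_plus_Hinf \<Longrightarrow> a \<in> borel_measurable circle"
  by (simp add: C_plus_Hinf_def)

lemma C_plus_Hinf_bounded:
  assumes "a \<in> C_plus_Hinf"
  shows "Linf_norm a < \<infinity>"
proof -
  from assms obtain f g where fg: "continuous_on (sphere 0 1) f" "g \<in> Hinf" "AE z in circle. a z = f z + g z"
    by (auto simp: C_plus_Hinf_def)
  have "compact (f ` sphere 0 1)" by (intro compact_continuous_image fg) auto
  then obtain B where B: "\<forall>x\<in>f ` sphere 0 1. cmod x \<le> B" using compact_imp_bounded bounded_iff by blast
  have "AE z in circle. cmod (g z) \<le> enn2real (Linf_norm g)"
    using fg(2) by (intro AE_norm_le_Linf_norm) (simp add: Hinf_def Linf_def)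
  then have "AE z in circle. cmod (a z) \<le> B + enn2real (Linf_norm g)"
    using fg(3) AE_circle_norm
  proof eventually_elim
    case (elim z)
    then have "cmod (f z) \<le> B" using B by auto
    then show ?case using elim norm_triangle_ineq[of "f z" "g z"] by simp
  qed
  from Linf_norm_leI[OF C_plus_Hinf_measurable[OF assms] this] show ?thesis
    using ennreal_less_top by (auto intro: le_less_trans)
qed

text \<open>The continuous part is uniformly close to a trigonometric polynomial, whose negative
  powers are cleared by z^m. Since |h| = |a - d| on the circle, \<open>h\<close> is bounded in terms
  of \<open>a\<close> itself and not of its two summands.\<close>

lemma C_plus_Hinf_decomposition:
  assumes a: "a \<in> C_plus_Hinf" and e: "e > 0"
  obtains m h d where "h \<in> H1" "d \<in> borel_measurable circle" "AE z in circle. cmod (d z) \<le> e"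
    "AE z in circle. a z = z powi (- int m) * h z + d z"
    "AE z in circle. cmod (h z) \<le> enn2real (Linf_norm a) + e"
proof -
  from a obtain f g where fg: "continuous_on (sphere 0 1) f" "g \<in> Hinf" "AE z in circle. a z = f z + g z"
    by (auto simp: C_plus_Hinf_def)
  obtain t where t: "trig_poly t" "\<And>z. cmod z = 1 \<Longrightarrow> cmod (f z - t z) < e"
    using continuous_approx_trig_poly[OF fg(1) e] by blast
  obtain m p where mp: "\<And>z. z \<noteq> 0 \<Longrightarrow> t z = z powi (- int m) * poly p z"
    using trig_poly_factor[OF t(1)] by blast
  define h where "h = (\<lambda>z. poly p z * 1 + z powi int m * g z)"
  define d where "d = (\<lambda>z. a z - z powi (- int m) * h z)"
  have h: "h \<in> H1"
    unfolding h_def by (intro H1_add H1_poly_mult H1_const H1_powi_mult Hinf_H1 fg) auto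
  have [measurable]: "a \<in> borel_measurable circle" "h \<in> borel_measurable circle"
    using C_plus_Hinf_measurable[OF a] H1_integrable[OF h] by auto
  have d: "AE z in circle. cmod (d z) \<le> e"
    using fg(3) AE_circle_norm
  proof eventually_elim
    case (elim z)
    then have "z \<noteq> 0" by auto
    then have "z powi (- int m) * h z = t z + g z"
      using mp[of z] by (simp add: h_def distrib_left power_int_minus)
    then have "d z = f z - t z" using elim by (simp add: d_def)
    then show ?case using t(2)[OF elim(2)] by simp
  qed
  have "AE z in circle. cmod (h z) \<le> enn2real (Linf_norm a) + e"
    using d AE_norm_le_Linf_norm[OF C_plus_Hinf_bounded[OF a]] AE_circle_norm
  proof eventually_elim
    case (elim z)
    have "cmod (h z) = cmod (z powi (- int m) * h z)"
      using elim by (simp add: norm_mult norm_power_int)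
    also have "z powi (- int m) * h z = a z - d z" by (simp add: d_def)
    also have "cmod \<dots> \<le> cmod (a z) + cmod (d z)" by (rule norm_triangle_ineq4)
    finally show ?case using elim by simp
  qed
  then show thesis
    by (intro that[OF h _ d]) (auto simp: d_def)
qed

section \<open>Toeplitz operators\<close>

context riesz_space
begin

lemma toeplitz_in_hardy:
  assumes "a \<in> borel_measurable circle" "AE z in circle. cmod (a z) \<le> B" "0 \<le> B" "f \<in> hardy \<rho>"
  shows "toeplitz \<rho> a f \<in> hardy \<rho>"
  unfolding toeplitz_def using assms by (intro riesz_projection_hardy bfs_mult_bounded[OF hardy_bfs])

lemma toeplitz_diff:
  assumes "a \<in> borel_measurable circle" "AE z in circle. cmod (a z) \<le> B" "0 \<le> B" "f \<in> hardy \<rho>" "g \<in> hardy \<rho>"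
  shows "AE z in circle. toeplitz \<rho> a (\<lambda>z. f z - g z) z = toeplitz \<rho> a f z - toeplitz \<rho> a g z"
proof -
  have af: "(\<lambda>z. a z * f z) \<in> bfs \<rho>" and ag: "(\<lambda>z. a z * g z) \<in> bfs \<rho>"
    using assms by (auto intro!: bfs_mult_bounded[OF hardy_bfs])
  have "(\<lambda>z. a z * (f z - g z)) = (\<lambda>z. a z * f z + (-1) * (a z * g z))"
    by (simp add: fun_eq_iff algebra_simps)
  then show ?thesis
    unfolding toeplitz_def
    using riesz_projection_add[OF af bfs_cmult[OF ag, of "-1"]] riesz_projection_cmult[OF ag, of "-1"]
    by (auto elim!: eventually_elim2)
qed

lemma toeplitz_cmult:
  assumes "a \<in> borel_measurable circle" "AE z in circle. cmod (a z) \<le> B" "0 \<le> B" "f \<in> hardy \<rho>"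
  shows "AE z in circle. toeplitz \<rho> a (\<lambda>z. c * f z) z = c * toeplitz \<rho> a f z"
proof -
  have af: "(\<lambda>z. a z * f z) \<in> bfs \<rho>"
    using assms by (auto intro!: bfs_mult_bounded[OF hardy_bfs])
  show ?thesis
    unfolding toeplitz_def using riesz_projection_cmult[OF af, of c] by (simp add: mult.left_commute)
qed

lemma toeplitz_split:
  assumes a: "a \<in> borel_measurable circle" and h: "h \<in> H1" "AE z in circle. cmod (h z) \<le> B" "0 \<le> B"
    and d: "d \<in> borel_measurable circle" "AE z in circle. cmod (d z) \<le> e" "0 \<le> e"
    and eq: "AE z in circle. a z = z powi (- int m) * h z + d z" and f: "f \<in> hardy \<rho>"
  shows "AE z in circle. toeplitz \<rho> a f z
    = riesz_projection \<rho> (\<lambda>z. z powi (- int m) * (h z * f z)) z + riesz_projection \<rho> (\<lambda>z. d z * f z) z"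
proof -
  have hf: "(\<lambda>z. z powi (- int m) * (h z * f z)) \<in> bfs \<rho>"
    by (intro bfs_powi_mult hardy_bfs hardy_bounded_mult[OF h f])
  have df: "(\<lambda>z. d z * f z) \<in> bfs \<rho>"
    by (rule bfs_mult_bounded[OF hardy_bfs[OF f] d])
  have "AE z in circle. z powi (- int m) * (h z * f z) + d z * f z = a z * f z"
    using eq by eventually_elim (simp add: algebra_simps)
  moreover from this have "(\<lambda>z. a z * f z) \<in> bfs \<rho>"
    using a by (intro bfs_cong_AE[OF bfs_add[OF hf df]] borel_measurable_times hardy_measurable[OF f]) auto
  ultimately have "AE z in circle. riesz_projection \<rho> (\<lambda>z. z powi (- int m) * (h z * f z) + d z * f z) z = toeplitz \<rho> a f z"
    unfolding toeplitz_def by (intro riesz_projection_cong_AE bfs_add hf df)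
  then show ?thesis
    using riesz_projection_add[OF hf df] by eventually_elim simp
qed

text \<open>For n \<ge> m the function z^(n - m) h f is analytic and is left unchanged by the
  projection. Only \<open>d\<close> contributes to the difference, at most (C + 1) e times the norm
  of \<open>f\<close>: C for the projected part and 1 for the direct one.\<close>

lemma toeplitz_shift_tendsto:
  assumes a: "a \<in> C_plus_Hinf" and f: "f \<in> hardy \<rho>"
  shows "(\<lambda>n. bnorm \<rho> (\<lambda>z. toeplitz \<rho> a (\<lambda>z. z powi int n * f z) z - z powi int n * (a z * f z))) \<longlonglongrightarrow> 0"
proof (rule LIMSEQ_I)
  fix r :: real assume r: "r > 0"
  obtain C where C: "0 < C" "\<And>f. f \<in> bfs \<rho> \<Longrightarrow> bnorm \<rho> (riesz_projection \<rho> f) \<le> C * bnorm \<rho> f"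
    using riesz_projection_bounded by metis
  \<comment> \<open>The 1 added to the norm of \<open>f\<close> keeps the denominator positive for f
    = 0 and makes the final estimate strict.\<close>
  define e where "e = r / ((C + 1) * (bnorm \<rho> f + 1))"
  have pos: "(C + 1) * (bnorm \<rho> f + 1) > 0" using C(1) by (intro mult_pos_pos add_pos_nonneg add_nonneg_pos) auto
  have e: "e > 0" using r pos by (simp add: e_def)
  have er: "(C + 1) * (e * bnorm \<rho> f) < r"
  proof -
    have "(C + 1) * (e * bnorm \<rho> f) < (C + 1) * (e * (bnorm \<rho> f + 1))"
      using C(1) e by (intro mult_strict_left_mono) auto
    also have "\<dots> = e * ((C + 1) * (bnorm \<rho> f + 1))" by simp
    also have "\<dots> = r" using pos by (metis e_def less_irrefl nonzero_eq_divide_eq)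
    finally show ?thesis .
  qed
  obtain m h d where h: "h \<in> H1" and [measurable]: "d \<in> borel_measurable circle" and d: "AE z in circle. cmod (d z) \<le> e"
    and eq: "AE z in circle. a z = z powi (- int m) * h z + d z"
    and hb: "AE z in circle. cmod (h z) \<le> enn2real (Linf_norm a) + e"
    by (rule C_plus_Hinf_decomposition[OF a e])
  have [measurable]: "a \<in> borel_measurable circle" by (rule C_plus_Hinf_measurable[OF a])
  have ab: "AE z in circle. cmod (a z) \<le> enn2real (Linf_norm a)"
    by (rule AE_norm_le_Linf_norm[OF C_plus_Hinf_bounded[OF a]])
  have hB: "0 \<le> enn2real (Linf_norm a) + e" using e by (simp add: add_nonneg_nonneg)
  have "bnorm \<rho> (\<lambda>z. toeplitz \<rho> a (\<lambda>z. z powi int n * f z) z - z powi int n * (a z * f z)) < r" if n: "n \<ge> m" for n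
  proof -
    define x where "x = (\<lambda>z. z powi int n * f z)"
    have x: "x \<in> hardy \<rho>" unfolding x_def by (rule hardy_powi_mult[OF f]) simp
    have xn: "bnorm \<rho> x = bnorm \<rho> f" unfolding x_def by (rule bnorm_powi_mult[OF hardy_measurable[OF f]])
    have dx: "(\<lambda>z. d z * x z) \<in> bfs \<rho>" using e by (intro bfs_mult_bounded[OF hardy_bfs[OF x] _ d]) auto
    have hx: "(\<lambda>z. z powi (- int m) * (h z * x z)) \<in> bfs \<rho>"
      by (intro bfs_powi_mult hardy_bfs hardy_bounded_mult[OF h hb hB x])
    have "AE z in circle. z powi (int n - int m) * (h z * f z) = z powi (- int m) * (h z * x z)"
      using AE_circle_norm
    proof eventually_elim
      case (elim z)
      then have "z \<noteq> 0" by auto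
      have "z powi (int n - int m) = z powi (- int m + int n)" by simp
      also have "\<dots> = z powi (- int m) * z powi int n"
        by (rule power_int_add) (use \<open>z \<noteq> 0\<close> in simp)
      finally have "z powi (int n - int m) = z powi (- int m) * z powi int n" .
      then show ?case by (simp only: x_def mult_ac)
    qed
    note AE_eq = this
    have "(\<lambda>z. z powi (int n - int m) * (h z * f z)) \<in> hardy \<rho>"
      using n by (intro hardy_powi_mult hardy_bounded_mult[OF h hb hB f]) auto
    from hardy_cong_AE[OF this bfs_measurable[OF hx] AE_eq]
    have "AE z in circle. riesz_projection \<rho> (\<lambda>z. z powi (- int m) * (h z * x z)) z = z powi (- int m) * (h z * x z)"
      by (rule riesz_projection_hardy_id)
    then have "AE z in circle. (toeplitz \<rho> a x z - a z * x z) = riesz_projection \<rho> (\<lambda>z. d z * x z) z + (-1) * (d z * x z)"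
      using toeplitz_split[OF _ h hb hB _ d _ eq x] e eq
      by (auto elim!: eventually_elim2 simp: algebra_simps)
    then have "bnorm \<rho> (\<lambda>z. toeplitz \<rho> a x z - a z * x z)
        \<le> bnorm \<rho> (riesz_projection \<rho> (\<lambda>z. d z * x z)) + bnorm \<rho> (\<lambda>z. (-1) * (d z * x z))"
    proof (intro bnorm_triangle_AE bfs_cmult dx hardy_bfs[OF riesz_projection_hardy[OF dx]])
      have [measurable]: "x \<in> borel_measurable circle" "toeplitz \<rho> a x \<in> borel_measurable circle"
        by (auto intro!: hardy_measurable x toeplitz_in_hardy[OF C_plus_Hinf_measurable[OF a] ab])
      show "(\<lambda>z. toeplitz \<rho> a x z - a z * x z) \<in> borel_measurable circle" by measurable
    qed
    also have "\<dots> \<le> C * bnorm \<rho> (\<lambda>z. d z * x z) + bnorm \<rho> (\<lambda>z. d z * x z)"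
      using C(2)[OF dx] bnorm_cmult[OF bfs_measurable[OF dx], of "-1"] by simp
    also have "\<dots> = (C + 1) * bnorm \<rho> (\<lambda>z. d z * x z)" by (simp add: algebra_simps)
    also have "\<dots> \<le> (C + 1) * (e * bnorm \<rho> f)"
      using C(1) e bnorm_mult_le[OF _ hardy_bfs[OF x] d] by (intro mult_left_mono) (auto simp: xn)
    also have "\<dots> < r" by (rule er)
    finally show ?thesis by (simp add: x_def mult.left_commute)
  qed
  then show "\<exists>m. \<forall>n\<ge>m. norm (bnorm \<rho> (\<lambda>z. toeplitz \<rho> a (\<lambda>z. z powi int n * f z) z - z powi int n * (a z * f z)) - 0) < r"
    by auto
qed

end

section \<open>Weak convergence of the shifts\<close>

context banach_function_norm
begin

lemma dual_iff:
  "\<phi> \<in> dual (bfs \<rho>) (bfs_norm \<rho>) \<longleftrightarrow>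
     (\<forall>f\<in>bfs \<rho>. \<forall>g\<in>bfs \<rho>. \<phi> (\<lambda>x. f x + g x) = \<phi> f + \<phi> g) \<and>
     (\<forall>c. \<forall>f\<in>bfs \<rho>. \<phi> (\<lambda>x. c * f x) = c * \<phi> f) \<and> (\<exists>C\<ge>0. \<forall>f\<in>bfs \<rho>. cmod (\<phi> f) \<le> C * bnorm \<rho> f)"
proof -
  have "(\<exists>C::real. \<forall>f\<in>bfs \<rho>. ennreal (cmod (\<phi> f)) \<le> ennreal C * bfs_norm \<rho> f)
      \<longleftrightarrow> (\<exists>C\<ge>0. \<forall>f\<in>bfs \<rho>. cmod (\<phi> f) \<le> C * bnorm \<rho> f)" (is "?L \<longleftrightarrow> ?R")
  proof
    assume ?L
    then obtain C :: real where C: "\<And>f. f \<in> bfs \<rho> \<Longrightarrow> ennreal (cmod (\<phi> f)) \<le> ennreal C * bfs_norm \<rho> f" by blast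
    have "cmod (\<phi> f) \<le> \<bar>C\<bar> * bnorm \<rho> f" if f: "f \<in> bfs \<rho>" for f
    proof -
      have "ennreal (cmod (\<phi> f)) \<le> ennreal \<bar>C\<bar> * ennreal (bnorm \<rho> f)"
        using C[OF f] unfolding bfs_norm_eq_bnorm[OF f]
        by (rule order_trans) (intro mult_right_mono ennreal_leI, auto)
      then show ?thesis by (simp flip: ennreal_mult)
    qed
    then show ?R by (intro exI[of _ "\<bar>C\<bar>"]) auto
  next
    assume ?R
    then obtain C where C: "C \<ge> 0" "\<And>f. f \<in> bfs \<rho> \<Longrightarrow> cmod (\<phi> f) \<le> C * bnorm \<rho> f" by blast
    have "ennreal (cmod (\<phi> f)) \<le> ennreal C * bfs_norm \<rho> f" if f: "f \<in> bfs \<rho>" for f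
      using C(2)[OF f] C(1) unfolding bfs_norm_eq_bnorm[OF f] by (simp flip: ennreal_mult)
    then show ?L by blast
  qed
  then show ?thesis by (simp add: dual_def)
qed

lemma fourier_coeff_in_dual: "(\<lambda>f. fourier_coeff f k) \<in> dual (bfs \<rho>) (bfs_norm \<rho>)"
proof -
  obtain C where C: "0 < C" "\<And>f k. f \<in> bfs \<rho> \<Longrightarrow> cmod (fourier_coeff f k) \<le> C * bnorm \<rho> f"
    using bfs_fourier_coeff_bound by blast
  then show ?thesis
    unfolding dual_iff by (auto simp: fourier_coeff_add fourier_coeff_cmult bfs_integrable intro!: exI[of _ C])
qed

text \<open>A cluster point of the functionals \<open>\<phi> \<mapsto> \<phi> (z\<^sup>n f)\<close> in the bidual is, by reflexivity, an
  evaluation at an element all of whose Fourier coefficients vanish.\<close>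

lemma reflexive_shift_weakly_null:
  assumes refl: "reflexive_space (bfs \<rho>) (bfs_norm \<rho>)"
    and \<phi>: "\<phi> \<in> dual (bfs \<rho>) (bfs_norm \<rho>)" and f: "f \<in> bfs \<rho>"
  shows "(\<lambda>n. \<phi> (\<lambda>z. z powi int n * f z)) \<longlonglongrightarrow> 0"
proof (rule ccontr)
  assume contr: "\<not> ?thesis"
  let ?D = "dual (bfs \<rho>) (bfs_norm \<rho>)"
  define x where "x = (\<lambda>n::nat. \<lambda>z. z powi int n * f z)"
  have x: "x n \<in> bfs \<rho>" "bnorm \<rho> (x n) = bnorm \<rho> f" for n
    unfolding x_def by (rule bfs_powi_mult[OF f], rule bnorm_powi_mult[OF bfs_measurable[OF f]])
  \<comment> \<open>Evaluations at z^n f, set to 0 off the dual. Thus every coordinate stays in a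
    fixed disc, and the product of these discs is compact by Tychonoff's theorem.\<close>
  define g where "g = (\<lambda>n \<psi>. if \<psi> \<in> ?D then \<psi> (x n) else 0)"
  have "\<exists>b. \<forall>n. cmod (g n \<psi>) \<le> b" for \<psi>
  proof (cases "\<psi> \<in> ?D")
    case True
    then obtain C where "\<forall>f\<in>bfs \<rho>. cmod (\<psi> f) \<le> C * bnorm \<rho> f" unfolding dual_iff by blast
    then have "cmod (g n \<psi>) \<le> C * bnorm \<rho> f" for n
      using x[of n] True by (auto simp: g_def)
    then show ?thesis by blast
  qed (auto simp: g_def)
  then obtain b where b: "\<And>n \<psi>. cmod (g n \<psi>) \<le> b \<psi>" by metis
  define K where "K = PiE UNIV (\<lambda>\<psi>. cball (0::complex) (b \<psi>))"
  have "compactin (product_topology (\<lambda>_. euclidean) UNIV) K"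
    unfolding K_def compactin_PiE by simp
  then have compact: "compact K" by (simp add: euclidean_product_topology)
  obtain \<epsilon> where \<epsilon>: "\<epsilon> > 0" "\<And>N. \<exists>n\<ge>N. \<epsilon> \<le> cmod (\<phi> (x n))"
    using contr unfolding LIMSEQ_iff x_def by (auto simp: not_less)
  \<comment> \<open>The negated claim leaves infinitely many indices in \<open>A\<close>. A filter
    along them is used, since a product of uncountably many discs need not be sequentially
    compact.\<close>
  define A where "A = {n. \<epsilon> \<le> cmod (\<phi> (x n))}"
  define Fi where "Fi = filtermap g (inf sequentially (principal A))"
  have "inf sequentially (principal A) \<noteq> bot"
  proof
    assume "inf sequentially (principal A) = bot"
    then have "eventually (\<lambda>_. False) (inf sequentially (principal A))" by simp
    then obtain N where "\<And>n. n \<ge> N \<Longrightarrow> n \<notin> A"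
      by (auto simp: eventually_inf_principal eventually_sequentially)
    then show False using \<epsilon>(2)[of N] by (auto simp: A_def)
  qed
  then have "Fi \<noteq> bot" by (simp add: Fi_def filtermap_bot_iff)
  moreover have "eventually (\<lambda>\<Phi>. \<Phi> \<in> K) Fi"
    unfolding Fi_def eventually_filtermap using b by (auto simp: K_def intro!: always_eventually)
  ultimately obtain \<Phi> where \<Phi>: "inf (nhds \<Phi>) Fi \<noteq> bot"
    using compact unfolding compact_filter by blast
  \<comment> \<open>Closed conditions that hold eventually along \<open>A\<close> pass to \<Phi>.
    Linearity, boundedness, smallness at a coefficient functional and the lower bound at \<phi> are
    all of this kind.\<close>
  have cluster: "\<Phi> \<in> S" if "closed S" "\<forall>\<^sub>F n in sequentially. n \<in> A \<longrightarrow> g n \<in> S" for S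
  proof (rule ccontr)
    assume "\<Phi> \<notin> S"
    then have "eventually (\<lambda>\<Psi>. \<Psi> \<in> - S) (nhds \<Phi>)"
      using that(1) by (intro eventually_nhds_in_open) auto
    moreover have "eventually (\<lambda>\<Psi>. \<Psi> \<in> S) Fi"
      unfolding Fi_def eventually_filtermap eventually_inf_principal using that(2) by simp
    ultimately have "eventually (\<lambda>_. False) (inf (nhds \<Phi>) Fi)"
      unfolding eventually_inf by (intro exI[of _ "\<lambda>\<Psi>. \<Psi> \<in> - S"] exI[of _ "\<lambda>\<Psi>. \<Psi> \<in> S"]) auto
    then show False using \<Phi> by (simp add: eventually_False)
  qed
  have cluster': "\<Phi> \<in> S" if "closed S" "\<And>n. g n \<in> S" for S
    using that by (intro cluster) auto
  have \<Phi>_add: "\<Phi> (\<lambda>x. \<psi> x + \<eta> x) = \<Phi> \<psi> + \<Phi> \<eta>" if "\<psi> \<in> ?D" "\<eta> \<in> ?D" for \<psi> \<eta>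
  proof -
    have "(\<lambda>x. \<psi> x + \<eta> x) \<in> ?D"
    proof -
      obtain C C' where "C \<ge> 0" "\<forall>f\<in>bfs \<rho>. cmod (\<psi> f) \<le> C * bnorm \<rho> f" "C' \<ge> 0" "\<forall>f\<in>bfs \<rho>. cmod (\<eta> f) \<le> C' * bnorm \<rho> f"
        using \<open>\<psi> \<in> ?D\<close> \<open>\<eta> \<in> ?D\<close> unfolding dual_iff by blast
      then have "\<exists>C\<ge>0. \<forall>f\<in>bfs \<rho>. cmod (\<psi> f + \<eta> f) \<le> C * bnorm \<rho> f"
        by (intro exI[of _ "C + C'"]) (auto simp: distrib_right intro!: norm_triangle_le add_mono)
      then show ?thesis using that by (simp add: dual_iff algebra_simps)
    qed
    then have in_S: "g n \<in> {\<Psi>. \<Psi> (\<lambda>x. \<psi> x + \<eta> x) = \<Psi> \<psi> + \<Psi> \<eta>}" for n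
      using that by (simp add: g_def)
    have cl: "closed {\<Psi>::((complex \<Rightarrow> complex) \<Rightarrow> complex) \<Rightarrow> complex. \<Psi> (\<lambda>x. \<psi> x + \<eta> x) = \<Psi> \<psi> + \<Psi> \<eta>}"
      by (intro closed_Collect_eq continuous_on_add continuous_on_product_coordinates)
    from cluster'[OF cl in_S] show ?thesis by simp
  qed
  have \<Phi>_cmult: "\<Phi> (\<lambda>x. c * \<psi> x) = c * \<Phi> \<psi>" if "\<psi> \<in> ?D" for \<psi> c
  proof -
    have "(\<lambda>x. c * \<psi> x) \<in> ?D"
    proof -
      obtain C where "C \<ge> 0" "\<forall>f\<in>bfs \<rho>. cmod (\<psi> f) \<le> C * bnorm \<rho> f"
        using \<open>\<psi> \<in> ?D\<close> unfolding dual_iff by blast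
      then have "\<exists>C\<ge>0. \<forall>f\<in>bfs \<rho>. cmod (c * \<psi> f) \<le> C * bnorm \<rho> f"
        by (intro exI[of _ "cmod c * C"]) (auto simp: norm_mult mult.assoc intro!: mult_left_mono)
      then show ?thesis using that by (simp add: dual_iff algebra_simps)
    qed
    then have in_S: "g n \<in> {\<Psi>. \<Psi> (\<lambda>x. c * \<psi> x) = c * \<Psi> \<psi>}" for n
      using that by (simp add: g_def)
    have cl: "closed {\<Psi>::((complex \<Rightarrow> complex) \<Rightarrow> complex) \<Rightarrow> complex. \<Psi> (\<lambda>x. c * \<psi> x) = c * \<Psi> \<psi>}"
      by (intro closed_Collect_eq continuous_on_mult continuous_on_const continuous_on_product_coordinates)
    from cluster'[OF cl in_S] show ?thesis by simp
  qed
  \<comment> \<open>The 1 keeps the divisor positive for f = 0; x n / R lies in the unit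
    ball.\<close>
  define R where "R = bnorm \<rho> f + 1"
  have R: "R > 0" by (simp add: R_def add_nonneg_pos)
  have \<Phi>_bound: "ennreal (cmod (\<Phi> \<psi>)) \<le> ennreal R * dual_norm (bfs \<rho>) (bfs_norm \<rho>) \<psi>" if \<psi>: "\<psi> \<in> ?D" for \<psi>
  proof (cases "dual_norm (bfs \<rho>) (bfs_norm \<rho>) \<psi> = top")
    case True
    then show ?thesis using R by (simp add: ennreal_mult_top)
  next
    case False
    define d where "d = enn2real (dual_norm (bfs \<rho>) (bfs_norm \<rho>) \<psi>)"
    have d: "dual_norm (bfs \<rho>) (bfs_norm \<rho>) \<psi> = ennreal d" "d \<ge> 0" using False by (auto simp: d_def less_top)
    have "cmod (\<psi> (x n)) \<le> R * d" for n
    proof -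
      define y where "y = (\<lambda>z. of_real (1 / R) * x n z)"
      have y: "y \<in> bfs \<rho>" unfolding y_def by (rule bfs_cmult[OF x(1)])
      have "bnorm \<rho> y = bnorm \<rho> f / R"
        unfolding y_def using R x by (subst bnorm_cmult) (auto simp: norm_divide intro: bfs_measurable)
      also have "\<dots> \<le> 1" using R by (simp add: R_def)
      finally have "bfs_norm \<rho> y \<le> 1" by (simp add: bfs_norm_eq_bnorm[OF y])
      then have "ennreal (cmod (\<psi> y)) \<le> dual_norm (bfs \<rho>) (bfs_norm \<rho>) \<psi>"
        unfolding dual_norm_def using y by (intro SUP_upper) auto
      then have "cmod (\<psi> y) \<le> d" using d by simp
      moreover have "\<psi> y = of_real (1 / R) * \<psi> (x n)"
      proof -
        have "\<forall>c. \<forall>f\<in>bfs \<rho>. \<psi> (\<lambda>x. c * f x) = c * \<psi> f" using \<psi> unfolding dual_iff by blast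
        then show ?thesis unfolding y_def using x(1) by blast
      qed
      ultimately show ?thesis using R by (simp add: norm_mult norm_divide field_simps)
    qed
    then have in_S: "g n \<in> {\<Psi>. cmod (\<Psi> \<psi>) \<le> R * d}" for n using \<psi> by (simp add: g_def)
    have cl: "closed {\<Psi>::((complex \<Rightarrow> complex) \<Rightarrow> complex) \<Rightarrow> complex. cmod (\<Psi> \<psi>) \<le> R * d}"
      by (intro closed_Collect_le continuous_on_norm continuous_on_const continuous_on_product_coordinates)
    from cluster'[OF cl in_S] have "cmod (\<Phi> \<psi>) \<le> R * d" by simp
    then show ?thesis using R d by (simp flip: ennreal_mult)
  qed
  have "\<Phi> \<in> dual ?D (dual_norm (bfs \<rho>) (bfs_norm \<rho>))"
    unfolding dual_def[of ?D] using \<Phi>_add \<Phi>_cmult \<Phi>_bound by blast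
  \<comment> \<open>Reflexivity is used here. The coefficient functionals identify
    \<open>f0\<close>: along z^n f they tend to 0 by the Riemann-Lebesgue lemma, so
    \<open>f0\<close> vanishes a.e.\<close>
  then obtain f0 where f0: "f0 \<in> bfs \<rho>" "\<And>\<psi>. \<psi> \<in> ?D \<Longrightarrow> \<Phi> \<psi> = \<psi> f0"
    using refl unfolding reflexive_space_def by blast
  have "fourier_coeff f0 k = 0" for k
  proof -
    let ?\<psi> = "\<lambda>f. fourier_coeff f k"
    have "(\<lambda>n. ?\<psi> (x n)) \<longlonglongrightarrow> 0"
      unfolding x_def fourier_coeff_mult_powi by (rule riemann_lebesgue[OF bfs_integrable[OF f]])
    then have lim: "(\<lambda>n. g n ?\<psi>) \<longlonglongrightarrow> 0"
      using fourier_coeff_in_dual by (simp add: g_def)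
    have "cmod (\<Phi> ?\<psi>) \<le> 0 + e" if e: "e > 0" for e
    proof -
      have "\<forall>\<^sub>F n in sequentially. cmod (g n ?\<psi>) < e"
        using tendsto_norm_zero[OF lim] e by (rule order_tendstoD)
      then have ev: "\<forall>\<^sub>F n in sequentially. n \<in> A \<longrightarrow> g n \<in> {\<Psi>. cmod (\<Psi> ?\<psi>) \<le> e}"
        by eventually_elim simp
      have cl: "closed {\<Psi>::((complex \<Rightarrow> complex) \<Rightarrow> complex) \<Rightarrow> complex. cmod (\<Psi> ?\<psi>) \<le> e}"
        by (intro closed_Collect_le continuous_on_norm continuous_on_const continuous_on_product_coordinates)
      from cluster[OF cl ev] show ?thesis by simp
    qed
    then have "cmod (\<Phi> ?\<psi>) \<le> 0" by (rule field_le_epsilon)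
    then show ?thesis using f0(2)[OF fourier_coeff_in_dual] by simp
  qed
  then have "AE z in circle. f0 z = 0"
    by (intro fourier_coeff_eq_0_imp_AE bfs_integrable f0)
  then have "bnorm \<rho> f0 = 0" using bnorm_eq_0_iff[OF f0(1)] by simp
  moreover obtain C where "\<forall>f\<in>bfs \<rho>. cmod (\<phi> f) \<le> C * bnorm \<rho> f" using \<phi> unfolding dual_iff by blast
  ultimately have "\<phi> f0 = 0" using f0(1) by fastforce
  then have "\<Phi> \<phi> = 0" using f0(2)[OF \<phi>] by simp
  moreover have "\<Phi> \<in> {\<Psi>. \<epsilon> \<le> cmod (\<Psi> \<phi>)}"
  proof (rule cluster)
    show "closed {\<Psi>::((complex \<Rightarrow> complex) \<Rightarrow> complex) \<Rightarrow> complex. \<epsilon> \<le> cmod (\<Psi> \<phi>)}"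
      by (intro closed_Collect_le continuous_on_norm continuous_on_const continuous_on_product_coordinates)
    show "\<forall>\<^sub>F n in sequentially. n \<in> A \<longrightarrow> g n \<in> {\<Psi>. \<epsilon> \<le> cmod (\<Psi> \<phi>)}"
      using \<phi> by (auto simp: A_def g_def)
  qed
  ultimately show False using \<epsilon>(1) by simp
qed

end

section \<open>Lower bounds\<close>

context banach_function_norm
begin

lemma bnorm_dominated3:
  assumes "f1 \<in> bfs \<rho>" "f2 \<in> bfs \<rho>" "f3 \<in> bfs \<rho>" "h \<in> borel_measurable circle"
    and "AE z in circle. cmod (h z) \<le> cmod (f1 z) + cmod (f2 z) + cmod (f3 z)"
  shows "bnorm \<rho> h \<le> bnorm \<rho> f1 + bnorm \<rho> f2 + bnorm \<rho> f3"
proof -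
  have n: "(\<lambda>z. complex_of_real (cmod (f z))) \<in> bfs \<rho>" "bnorm \<rho> (\<lambda>z. complex_of_real (cmod (f z))) = bnorm \<rho> f"
    if "f \<in> bfs \<rho>" for f
    using that by (auto simp: bfs_def bfs_norm_def bnorm_def)
  note s = bfs_add[OF bfs_add[OF n(1)[OF assms(1)] n(1)[OF assms(2)]] n(1)[OF assms(3)]]
  have "bnorm \<rho> h \<le> bnorm \<rho> (\<lambda>z. complex_of_real (cmod (f1 z)) + complex_of_real (cmod (f2 z)) + complex_of_real (cmod (f3 z)))"
    using assms(5) by (intro bnorm_mono_AE[OF s assms(4)]) (auto simp flip: of_real_add)
  also have "\<dots> \<le> bnorm \<rho> f1 + bnorm \<rho> f2 + bnorm \<rho> f3"
    using bnorm_add[OF bfs_add[OF n(1)[OF assms(1)] n(1)[OF assms(2)]] n(1)[OF assms(3)]]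
      bnorm_add[OF n(1)[OF assms(1)] n(1)[OF assms(2)]] n(2)[OF assms(1)] n(2)[OF assms(2)] n(2)[OF assms(3)]
    by simp
  finally show ?thesis .
qed

lemma op_norm_finite_bound:
  assumes "op_norm M (bfs_norm \<rho>) A \<noteq> \<infinity>" "f \<in> M" "f \<in> bfs \<rho>" "bnorm \<rho> f \<le> 1"
  shows "bnorm \<rho> (A f) \<le> enn2real (op_norm M (bfs_norm \<rho>) A)"
proof (rule bnorm_leI)
  have "bfs_norm \<rho> (A f) \<le> op_norm M (bfs_norm \<rho>) A"
    unfolding op_norm_def using assms by (intro SUP_upper) (simp add: bfs_norm_eq_bnorm)
  also have "\<dots> = ennreal (enn2real (op_norm M (bfs_norm \<rho>) A))"
    using assms(1) by (simp add: less_top)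
  finally show "bfs_norm \<rho> (A f) \<le> ennreal (enn2real (op_norm M (bfs_norm \<rho>) A))" .
qed simp

lemma op_norm_leI:
  assumes "0 \<le> c" "M \<subseteq> bfs \<rho>" "\<And>f. f \<in> M \<Longrightarrow> A f \<in> bfs \<rho>" "\<And>f. f \<in> M \<Longrightarrow> bnorm \<rho> (A f) \<le> c * bnorm \<rho> f"
  shows "op_norm M (bfs_norm \<rho>) A \<le> ennreal c"
  unfolding op_norm_def
proof (rule SUP_least)
  fix f assume "f \<in> {f \<in> M. bfs_norm \<rho> f \<le> 1}"
  then have f: "f \<in> M" "f \<in> bfs \<rho>" "bfs_norm \<rho> f \<le> 1" using assms(2) by auto
  then have "bnorm \<rho> f \<le> 1" by (simp add: bfs_norm_eq_bnorm)
  then have "bnorm \<rho> (A f) \<le> c" using assms(4)[OF f(1)] assms(1) mult_left_mono[of "bnorm \<rho> f" 1 c] by simp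
  then show "bfs_norm \<rho> (A f) \<le> ennreal c"
    by (simp add: bfs_norm_eq_bnorm[OF assms(3)[OF f(1)]] ennreal_leI)
qed

text \<open>Test functions are bounded outer functions with modulus 1 where \<open>\<bar>a\<bar>\<close> is large and
  \<open>\<epsilon>\<close> elsewhere.\<close>

lemma multiplier_bound_hardy:
  assumes [measurable]: "a \<in> borel_measurable circle" and ab: "AE z in circle. cmod (a z) \<le> B" "0 \<le> B"
    and c: "0 \<le> c" and le: "\<And>f. f \<in> hardy \<rho> \<Longrightarrow> bnorm \<rho> f \<le> 1 \<Longrightarrow> bnorm \<rho> (\<lambda>z. a z * f z) \<le> c"
  shows "AE z in circle. cmod (a z) \<le> c"
proof (rule ccontr)
  assume contr: "\<not> ?thesis"
  \<comment> \<open>If the bound c + 1/(n + 1) held a.e. for every n, it would hold for all n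
    simultaneously off one null set, and so would the bound c.\<close>
  have "\<exists>n. \<not> (AE z in circle. cmod (a z) \<le> c + inverse (real (Suc n)))"
  proof (rule ccontr)
    assume "\<not> ?thesis"
    then have "AE z in circle. \<forall>n. cmod (a z) \<le> c + inverse (real (Suc n))" by (simp add: AE_all_countable)
    then have "AE z in circle. cmod (a z) \<le> c"
    proof eventually_elim
      case (elim z)
      have "(\<lambda>n. c + inverse (real (Suc n))) \<longlonglongrightarrow> c + 0" by (intro tendsto_intros LIMSEQ_inverse_real_of_nat)
      then show ?case using elim by (intro LIMSEQ_le_const[of _ c]) auto
    qed
    then show False using contr by simp
  qed
  then obtain \<delta> where \<delta>: "\<delta> > 0" "\<not> (AE z in circle. cmod (a z) \<le> c + \<delta>)"
    by (metis inverse_positive_iff_positive of_nat_0_less_iff zero_less_Suc)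
  define E where "E = {z \<in> space circle. cmod (a z) > c + \<delta>}"
  have [measurable]: "E \<in> sets circle" unfolding E_def by measurable
  define i where "i = (\<lambda>z. indicator E z :: complex)"
  have [measurable]: "i \<in> borel_measurable circle" unfolding i_def by measurable
  have i: "i \<in> bfs \<rho>" by (rule bfs_bounded[where B = 1]) (auto simp: i_def indicator_def)
  have one: "(\<lambda>_. 1) \<in> bfs \<rho>" by (rule bfs_bounded[where B = 1]) auto
  have "\<not> (AE z in circle. i z = 0)"
  proof
    assume "AE z in circle. i z = 0"
    then have "AE z in circle. cmod (a z) \<le> c + \<delta>"
      using AE_space by eventually_elim (auto simp: i_def E_def indicator_def split: if_splits)
    with \<delta>(2) show False ..
  qed
  then have s: "bnorm \<rho> i > 0" using bnorm_eq_0_iff[OF i] bnorm_nonneg[of \<rho> i] by linarith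
  define u where "u = bnorm \<rho> (\<lambda>_. 1)"
  \<comment> \<open>The second entry makes \<epsilon> (c u + 1) at most half of \<delta> times the
    norm of \<open>i\<close>, which gives the contradiction. The cap 1/2 ensures |W| \<le>
    1.\<close>
  define \<epsilon> where "\<epsilon> = min (1/2) (\<delta> * bnorm \<rho> i / (2 * (c * u + 1)))"
  have cu: "c * u + 1 > 0" using c by (simp add: u_def add_nonneg_pos)
  have \<epsilon>: "0 < \<epsilon>" "\<epsilon> < 1" using \<delta>(1) s cu by (auto simp: \<epsilon>_def)
  define v where "v = (\<lambda>z. if z \<in> E then 1 else \<epsilon>)"
  have [measurable]: "v \<in> borel_measurable circle" unfolding v_def by measurable
  obtain W where W: "W \<in> borel_measurable circle" "AE z in circle. cmod (W z) = v z"
    "\<And>f. f \<in> H1 \<Longrightarrow> integrable circle (\<lambda>z. of_real (v z) * f z) \<Longrightarrow> (\<lambda>z. W z * f z) \<in> H1"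
  proof (rule outer_function_exists[of v])
    show "AE z in circle. 0 < v z" using \<epsilon> by (auto simp: v_def)
    show "integrable circle v"
      using \<epsilon> by (intro integrable_circle_bounded[where B = 1]) (auto simp: v_def)
    show "integrable circle (\<lambda>z. 1 / v z)"
      using \<epsilon> by (intro integrable_circle_bounded[where B = "1 / \<epsilon>"]) (auto simp: v_def)
  qed (auto intro: that)
  have [measurable]: "W \<in> borel_measurable circle" by (rule W)
  have Wb: "AE z in circle. cmod (W z) \<le> 1"
    using W(2) by eventually_elim (use \<epsilon> in \<open>auto simp: v_def\<close>)
  have "(\<lambda>z. W z * 1) \<in> H1"
  proof (rule W(3)[OF H1_const])
    show "integrable circle (\<lambda>z. complex_of_real (v z) * 1)"
      using \<epsilon> by (intro integrable_circle_bounded[where B = 1]) (auto simp: v_def)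
  qed
  then have WH: "W \<in> hardy \<rho>"
    using bfs_bounded[OF W(1) Wb] by (simp add: hardy_iff)
  have Wn: "bnorm \<rho> W \<le> bnorm \<rho> i + \<epsilon> * u"
  proof -
    have "bnorm \<rho> W \<le> bnorm \<rho> (\<lambda>z. i z + of_real \<epsilon> * 1)"
    proof (rule bnorm_mono_AE[OF bfs_add[OF i bfs_cmult[OF one]] W(1)])
      show "AE z in circle. cmod (W z) \<le> cmod (i z + of_real \<epsilon> * 1)"
        using W(2)
      proof eventually_elim
        case (elim z)
        have "cmod (1 + complex_of_real \<epsilon>) = 1 + \<epsilon>"
          using \<epsilon> norm_of_real[of "1 + \<epsilon>", where 'a = complex] by simp
        then show ?case using elim \<epsilon> by (auto simp: v_def i_def)
      qed
    qed
    also have "\<dots> \<le> bnorm \<rho> i + bnorm \<rho> (\<lambda>z. of_real \<epsilon> * 1)"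
      by (rule bnorm_add[OF i bfs_cmult[OF one]])
    also have "bnorm \<rho> (\<lambda>z. of_real \<epsilon> * 1) = \<epsilon> * u"
      using \<epsilon> by (subst bnorm_cmult) (auto simp: u_def)
    finally show ?thesis .
  qed
  have aW: "(\<lambda>z. a z * W z) \<in> bfs \<rho>" by (rule bfs_mult_bounded[OF hardy_bfs[OF WH] _ ab]) measurable
  have iW: "bnorm \<rho> i \<le> bnorm \<rho> W"
  proof (rule bnorm_mono_AE[OF hardy_bfs[OF WH]])
    show "AE z in circle. cmod (i z) \<le> cmod (W z)"
      using W(2) by eventually_elim (auto simp: v_def i_def)
  qed measurable
  \<comment> \<open>The chain of norms is (c + \<delta>) ||i|| \<le> ||a W|| \<le> c ||W|| \<le> c
    (||i|| + \<epsilon> u), where \<open>i\<close> is the indicator of \<open>E\<close> and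
    \<open>u\<close> is the norm of 1.\<close>
  have "(c + \<delta>) * bnorm \<rho> i = bnorm \<rho> (\<lambda>z. of_real (c + \<delta>) * i z)"
    using c \<delta>(1) by (subst bnorm_cmult) (auto simp del: of_real_add)
  also have "\<dots> \<le> bnorm \<rho> (\<lambda>z. a z * W z)"
  proof (rule bnorm_mono_AE[OF aW])
    show "AE z in circle. cmod (of_real (c + \<delta>) * i z) \<le> cmod (a z * W z)"
      using W(2)
      by eventually_elim (use c \<delta>(1) in \<open>auto simp: v_def i_def E_def norm_mult indicator_def simp del: of_real_add\<close>)
  qed measurable
  also have "\<dots> \<le> c * bnorm \<rho> W"
  proof -
    have Wpos: "bnorm \<rho> W > 0" using s iW by linarith
    define f where "f = (\<lambda>z. of_real (1 / bnorm \<rho> W) * W z)"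
    have f: "f \<in> hardy \<rho>" unfolding f_def by (rule hardy_cmult[OF WH])
    have "bnorm \<rho> f \<le> 1" unfolding f_def using Wpos by (subst bnorm_cmult) (auto simp: norm_divide)
    from le[OF f this] have "bnorm \<rho> (\<lambda>z. of_real (1 / bnorm \<rho> W) * (a z * W z)) \<le> c"
      by (simp add: f_def mult.left_commute)
    then show ?thesis
      using Wpos by (subst (asm) bnorm_cmult[OF bfs_measurable[OF aW]]) (simp add: norm_divide field_simps)
  qed
  also have "\<dots> \<le> c * (bnorm \<rho> i + \<epsilon> * u)" using c Wn by (rule mult_left_mono[rotated])
  finally have "\<delta> * bnorm \<rho> i \<le> \<epsilon> * (c * u)" by (simp add: algebra_simps)
  also have "\<dots> \<le> \<epsilon> * (c * u + 1)" using \<epsilon> by simp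
  also have "\<dots> \<le> \<delta> * bnorm \<rho> i / (2 * (c * u + 1)) * (c * u + 1)"
    using cu by (intro mult_right_mono) (auto simp: \<epsilon>_def)
  also have "\<dots> = \<delta> * bnorm \<rho> i / 2"
  proof -
    have "x / (2 * q) * q = x / 2" if "0 < q" for x q :: real using that by simp
    from this[OF cu] show ?thesis .
  qed
  also have "\<dots> < \<delta> * bnorm \<rho> i" using \<delta>(1) s by simp
  finally show False by simp
qed

end

section \<open>Lower bounds for Toeplitz operators on the weighted Hardy space\<close>

locale toeplitz_setting = banach_function_norm +
  fixes w :: "complex \<Rightarrow> real"
  assumes reflexive: "reflexive_space (bfs \<rho>) (bfs_norm \<rho>)"
    and tr: "translation_invariant \<rho>"
    and w_meas [measurable]: "w \<in> borel_measurable circle"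
    and w_pos: "AE z in circle. 0 < w z"
    and w_bfs: "(\<lambda>z. complex_of_real (w z)) \<in> bfs \<rho>"
    and w_inv: "(\<lambda>z. complex_of_real (1 / w z)) \<in> bfs (assoc_norm \<rho>)"
    and w_riesz: "riesz_bounded (weighted \<rho> w)"
begin

abbreviation "\<rho>w \<equiv> weighted \<rho> w"

sublocale Y: riesz_space "weighted \<rho> w"
  by (intro riesz_space.intro weighted_banach_function_norm riesz_space_axioms.intro w_meas w_pos w_bfs w_inv w_riesz)

lemma divide_weight_bfs:
  assumes x: "x \<in> bfs \<rho>"
  shows "(\<lambda>z. x z / of_real (w z)) \<in> bfs \<rho>w" "bnorm \<rho>w (\<lambda>z. x z / of_real (w z)) = bnorm \<rho> x"
proof -
  have [measurable]: "x \<in> borel_measurable circle" by (rule bfs_measurable[OF x])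
  have "bfs_norm \<rho>w (\<lambda>z. x z / of_real (w z)) = bfs_norm \<rho> x"
    unfolding bfs_norm_weighted
    by (rule bfs_norm_cong_AE) (use w_pos in \<open>auto elim!: eventually_mono\<close>)
  then show "(\<lambda>z. x z / of_real (w z)) \<in> bfs \<rho>w" "bnorm \<rho>w (\<lambda>z. x z / of_real (w z)) = bnorm \<rho> x"
    using x by (auto simp: bfs_def bnorm_def)
qed

lemma weight_mult_bfs:
  assumes "f \<in> bfs \<rho>w"
  shows "(\<lambda>z. of_real (w z) * f z) \<in> bfs \<rho>"
  using assms by (auto simp: bfs_def bfs_norm_weighted)

text \<open>Composing with the Riesz projection extends a functional from the weighted Hardy space to the
  whole space, so that reflexivity applies.\<close>

lemma shift_weakly_null:
  assumes add: "\<And>f g. f \<in> hardy \<rho>w \<Longrightarrow> g \<in> hardy \<rho>w \<Longrightarrow> \<phi> (\<lambda>z. f z + g z) = \<phi> f + \<phi> g"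
    and cmult: "\<And>c f. f \<in> hardy \<rho>w \<Longrightarrow> \<phi> (\<lambda>z. c * f z) = c * \<phi> f"
    and bd: "0 \<le> C" "\<And>f. f \<in> hardy \<rho>w \<Longrightarrow> cmod (\<phi> f) \<le> C * bnorm \<rho>w f"
    and f: "f \<in> hardy \<rho>w"
  shows "(\<lambda>n. \<phi> (\<lambda>z. z powi int n * f z)) \<longlonglongrightarrow> 0"
proof -
  \<comment> \<open>\<phi> acts on functions, while the projection is known up to null sets.
    Linearity and boundedness make \<phi> blind to such changes.\<close>
  have cong: "\<phi> g = \<phi> h" if g: "g \<in> hardy \<rho>w" and h: "h \<in> hardy \<rho>w" and eq: "AE z in circle. g z = h z" for g h
  proof -
    have d: "(\<lambda>z. g z - h z) \<in> hardy \<rho>w" by (rule Y.hardy_diff[OF g h])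
    have "bnorm \<rho>w (\<lambda>z. g z - h z) = 0"
      using Y.bnorm_eq_0_iff[OF Y.hardy_bfs[OF d]] eq by simp
    then have "\<phi> (\<lambda>z. g z - h z) = 0" using bd(2)[OF d] by simp
    moreover have "\<phi> (\<lambda>z. h z + (g z - h z)) = \<phi> h + \<phi> (\<lambda>z. g z - h z)" by (rule add[OF h d])
    ultimately show ?thesis by simp
  qed
  define P where "P = riesz_projection \<rho>w"
  obtain CP where CP: "0 < CP" "\<And>f. f \<in> bfs \<rho>w \<Longrightarrow> bnorm \<rho>w (P f) \<le> CP * bnorm \<rho>w f"
    unfolding P_def using Y.riesz_projection_bounded by metis
  \<comment> \<open>Division by w maps X isometrically into X(w), so \<psi> is a bounded functional
    on X, the space assumed reflexive. At w f, with \<open>f\<close> in the Hardy space, it returns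
    \<phi> f.\<close>
  define \<psi> where "\<psi> = (\<lambda>x. \<phi> (P (\<lambda>z. x z / of_real (w z))))"
  note q = divide_weight_bfs(1)
  have PH: "P g \<in> hardy \<rho>w" if "g \<in> bfs \<rho>w" for g unfolding P_def by (rule Y.riesz_projection_hardy[OF that])
  have "\<psi> \<in> dual (bfs \<rho>) (bfs_norm \<rho>)"
    unfolding dual_iff
  proof (intro conjI ballI allI)
    fix x y assume x: "x \<in> bfs \<rho>" and y: "y \<in> bfs \<rho>"
    have "\<phi> (P (\<lambda>z. x z / of_real (w z) + y z / of_real (w z)))
        = \<phi> (\<lambda>z. P (\<lambda>z. x z / of_real (w z)) z + P (\<lambda>z. y z / of_real (w z)) z)"
      using Y.riesz_projection_add[OF q[OF x] q[OF y]]
      by (intro cong PH Y.hardy_add Y.bfs_add q x y) (simp add: P_def)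
    also have "\<dots> = \<psi> x + \<psi> y"
      unfolding \<psi>_def by (intro add PH q x y)
    finally show "\<psi> (\<lambda>z. x z + y z) = \<psi> x + \<psi> y" by (simp add: \<psi>_def add_divide_distrib)
  next
    fix c x assume x: "x \<in> bfs \<rho>"
    have "\<phi> (P (\<lambda>z. c * (x z / of_real (w z)))) = \<phi> (\<lambda>z. c * P (\<lambda>z. x z / of_real (w z)) z)"
      using Y.riesz_projection_cmult[OF q[OF x], of c]
      by (intro cong PH Y.hardy_cmult Y.bfs_cmult q x) (simp add: P_def)
    also have "\<dots> = c * \<psi> x"
      unfolding \<psi>_def by (intro cmult PH q x)
    finally show "\<psi> (\<lambda>z. c * x z) = c * \<psi> x" by (simp add: \<psi>_def)
  next
    have "cmod (\<psi> x) \<le> (C * CP) * bnorm \<rho> x" if x: "x \<in> bfs \<rho>" for x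
    proof -
      have "cmod (\<psi> x) \<le> C * bnorm \<rho>w (P (\<lambda>z. x z / of_real (w z)))"
        unfolding \<psi>_def by (intro bd PH q x)
      also have "\<dots> \<le> C * (CP * bnorm \<rho>w (\<lambda>z. x z / of_real (w z)))"
        by (intro mult_left_mono CP q x bd)
      finally show ?thesis by (simp add: divide_weight_bfs(2)[OF x])
    qed
    then show "\<exists>C\<ge>0. \<forall>f\<in>bfs \<rho>. cmod (\<psi> f) \<le> C * bnorm \<rho> f"
      using bd(1) CP(1) by (intro exI[of _ "C * CP"]) auto
  qed
  from reflexive_shift_weakly_null[OF reflexive this weight_mult_bfs[OF Y.hardy_bfs[OF f]]]
  have "(\<lambda>n. \<psi> (\<lambda>z. z powi int n * (of_real (w z) * f z))) \<longlonglongrightarrow> 0" .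
  moreover have "\<psi> (\<lambda>z. z powi int n * (of_real (w z) * f z)) = \<phi> (\<lambda>z. z powi int n * f z)" for n
  proof -
    have x: "(\<lambda>z. z powi int n * f z) \<in> hardy \<rho>w" by (rule Y.hardy_powi_mult[OF f]) simp
    have y: "(\<lambda>z. z powi int n * (of_real (w z) * f z) / of_real (w z)) \<in> bfs \<rho>w"
      by (intro q bfs_powi_mult weight_mult_bfs Y.hardy_bfs f)
    have "AE z in circle. z powi int n * (of_real (w z) * f z) / of_real (w z) = z powi int n * f z"
      using w_pos by eventually_elim simp
    then have "AE z in circle. P (\<lambda>z. z powi int n * (of_real (w z) * f z) / of_real (w z)) z = P (\<lambda>z. z powi int n * f z) z"
      unfolding P_def by (intro Y.riesz_projection_cong_AE y Y.hardy_bfs x)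
    moreover have "AE z in circle. P (\<lambda>z. z powi int n * f z) z = z powi int n * f z"
      unfolding P_def by (rule Y.riesz_projection_hardy_id[OF x])
    ultimately have "AE z in circle. P (\<lambda>z. z powi int n * (of_real (w z) * f z) / of_real (w z)) z = z powi int n * f z"
      by eventually_elim simp
    then show ?thesis unfolding \<psi>_def by (intro cong PH y x)
  qed
  ultimately show ?thesis by simp
qed

text \<open>Subtracting from z^n f its component in a finite-dimensional complement brings it into
  M. The coordinates of this component are bounded functionals, so they tend to 0, and in the limit
  the norm of the restriction to M controls T(a) on z^n f.\<close>

lemma Linf_norm_le_m_norm:
  assumes a: "a \<in> C_plus_Hinf"
  shows "Linf_norm a \<le> m_norm (hardy \<rho>w) (bfs_norm \<rho>w) (toeplitz \<rho>w a)"
  unfolding m_norm_def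
proof (rule INF_greatest)
  fix M assume "M \<in> {M. closed_linear_subspace (hardy \<rho>w) (bfs_norm \<rho>w) M \<and> finite_codimension (hardy \<rho>w) M}"
  then have M: "closed_linear_subspace (hardy \<rho>w) (bfs_norm \<rho>w) M" "finite_codimension (hardy \<rho>w) M" by auto
  note MD = Y.closed_linear_subspaceD[OF M(1)]
  let ?T = "toeplitz \<rho>w a"
  have am [measurable]: "a \<in> borel_measurable circle" by (rule C_plus_Hinf_measurable[OF a])
  have ab: "AE z in circle. cmod (a z) \<le> enn2real (Linf_norm a)"
    by (rule AE_norm_le_Linf_norm[OF C_plus_Hinf_bounded[OF a]])
  show "Linf_norm a \<le> op_norm M (bfs_norm \<rho>w) ?T"
  proof (cases "op_norm M (bfs_norm \<rho>w) ?T = \<infinity>")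
    case False
    define c where "c = enn2real (op_norm M (bfs_norm \<rho>w) ?T)"
    have op: "op_norm M (bfs_norm \<rho>w) ?T = ennreal c" using False by (simp add: c_def less_top)
    have TH: "?T f \<in> hardy \<rho>w" if "f \<in> hardy \<rho>w" for f
      by (rule Y.toeplitz_in_hardy[OF am ab _ that]) simp
    \<comment> \<open>Stated with a majorant s > 0 of the norm, which avoids dividing by a norm that
      may be 0.\<close>
    have TM: "bnorm \<rho>w (?T y) \<le> c * s" if y: "y \<in> M" and s: "bnorm \<rho>w y \<le> s" "s > 0" for y s
    proof -
      have yH: "y \<in> hardy \<rho>w" using y MD(1) by auto
      define y' where "y' = (\<lambda>z. of_real (1 / s) * y z)"
      have y': "y' \<in> M" unfolding y'_def by (rule MD(4)[OF y])
      have "bnorm \<rho>w y' \<le> 1"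
        unfolding y'_def using s by (subst Y.bnorm_cmult[OF Y.hardy_measurable[OF yH]]) (simp add: norm_divide)
      then have "bnorm \<rho>w (?T y') \<le> c"
        unfolding c_def using y' MD(1) by (intro Y.op_norm_finite_bound False) (auto intro: Y.hardy_bfs)
      moreover have "bnorm \<rho>w (?T y') = bnorm \<rho>w (\<lambda>z. of_real (1 / s) * ?T y z)"
        using y' MD(1) Y.toeplitz_cmult[OF am ab _ yH, of "of_real (1 / s)"]
        by (intro Y.bnorm_cong_AE Y.hardy_measurable TH Y.hardy_cmult yH) (auto simp: y'_def)
      moreover have "\<dots> = (1 / s) * bnorm \<rho>w (?T y)"
        using s by (subst Y.bnorm_cmult[OF Y.hardy_measurable[OF TH[OF yH]]]) (simp add: norm_divide)
      ultimately have "(1 / s) * bnorm \<rho>w (?T y) \<le> c" by linarith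
      then show ?thesis using s(2) by (simp add: field_simps)
    qed
    obtain CP where CP: "0 < CP" "\<And>f. f \<in> bfs \<rho>w \<Longrightarrow> bnorm \<rho>w (riesz_projection \<rho>w f) \<le> CP * bnorm \<rho>w f"
      using Y.riesz_projection_bounded by metis
    define CT where "CT = CP * enn2real (Linf_norm a)"
    have Tb: "bnorm \<rho>w (?T f) \<le> CT * bnorm \<rho>w f" if f: "f \<in> hardy \<rho>w" for f
    proof -
      have "bnorm \<rho>w (?T f) \<le> CP * bnorm \<rho>w (\<lambda>z. a z * f z)"
        unfolding toeplitz_def by (intro CP Y.bfs_mult_bounded[OF Y.hardy_bfs[OF f] am ab]) simp
      also have "\<dots> \<le> CP * (enn2real (Linf_norm a) * bnorm \<rho>w f)"
        using CP(1) by (intro mult_left_mono Y.bnorm_mult_le[OF am Y.hardy_bfs[OF f] ab]) auto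
      finally show ?thesis by (simp add: CT_def)
    qed
    obtain B \<phi> where B: "finite B" "B \<subseteq> hardy \<rho>w"
      "\<forall>f\<in>hardy \<rho>w. (\<lambda>z. f z - (\<Sum>b\<in>B. \<phi> b f * b z)) \<in> M"
      and \<phi>: "\<forall>b\<in>B. \<forall>f\<in>hardy \<rho>w. \<forall>g\<in>hardy \<rho>w. \<phi> b (\<lambda>z. f z + g z) = \<phi> b f + \<phi> b g"
      "\<forall>b\<in>B. \<forall>c. \<forall>f\<in>hardy \<rho>w. \<phi> b (\<lambda>z. c * f z) = c * \<phi> b f"
      "\<forall>b\<in>B. \<exists>C\<ge>0. \<forall>f\<in>hardy \<rho>w. cmod (\<phi> b f) \<le> C * bnorm \<rho>w f"
      using Y.finite_codimension_coordinates[OF M] by (elim exE conjE)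
    have "AE z in circle. cmod (a z) \<le> c"
    proof (rule Y.multiplier_bound_hardy[OF am ab])
      fix f assume f: "f \<in> hardy \<rho>w" and f1: "bnorm \<rho>w f \<le> 1"
      define x where "x = (\<lambda>n::nat. \<lambda>z. z powi int n * f z)"
      have x: "x n \<in> hardy \<rho>w" for n unfolding x_def by (rule Y.hardy_powi_mult[OF f]) simp
      have xn: "bnorm \<rho>w (x n) = bnorm \<rho>w f" for n
        unfolding x_def by (rule Y.bnorm_powi_mult[OF Y.hardy_measurable[OF f]])
      \<comment> \<open>x n - d n lies in M, and d n tends to 0 in norm because its coordinates
        do.\<close>
      define d where "d = (\<lambda>n z. \<Sum>b\<in>B. \<phi> b (x n) * b z)"
      have d: "d n \<in> hardy \<rho>w" for n
        unfolding d_def using B(2) by (intro Y.hardy_sum Y.hardy_cmult) auto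
      have "(\<lambda>n. \<phi> b (x n)) \<longlonglongrightarrow> 0" if b: "b \<in> B" for b
      proof -
        obtain C where C: "0 \<le> C" "\<And>f. f \<in> hardy \<rho>w \<Longrightarrow> cmod (\<phi> b f) \<le> C * bnorm \<rho>w f" using \<phi>(3) b by blast
        show ?thesis
          unfolding x_def by (rule shift_weakly_null[where \<phi> = "\<phi> b", OF \<phi>(1)[rule_format, OF b] \<phi>(2)[rule_format, OF b] C f])
      qed
      then have "(\<lambda>n. \<Sum>b\<in>B. cmod (\<phi> b (x n)) * bnorm \<rho>w b) \<longlonglongrightarrow> (\<Sum>b\<in>B. cmod 0 * bnorm \<rho>w b)"
        by (intro tendsto_intros)
      then have lim: "(\<lambda>n. \<Sum>b\<in>B. cmod (\<phi> b (x n)) * bnorm \<rho>w b) \<longlonglongrightarrow> 0" by simp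
      have dle: "bnorm \<rho>w (d n) \<le> (\<Sum>b\<in>B. cmod (\<phi> b (x n)) * bnorm \<rho>w b)" for n
      proof -
        have "bfs_norm \<rho>w (d n) \<le> (\<Sum>b\<in>B. bfs_norm \<rho>w (\<lambda>z. \<phi> b (x n) * b z))"
          unfolding d_def using B(2) by (intro Y.bfs_norm_sum Y.hardy_measurable Y.hardy_cmult) auto
        also have "\<dots> = (\<Sum>b\<in>B. ennreal (cmod (\<phi> b (x n)) * bnorm \<rho>w b))"
        proof (rule sum.cong[OF refl])
          fix b assume "b \<in> B"
          then have b: "b \<in> hardy \<rho>w" using B(2) by auto
          show "bfs_norm \<rho>w (\<lambda>z. \<phi> b (x n) * b z) = ennreal (cmod (\<phi> b (x n)) * bnorm \<rho>w b)"
            by (simp add: Y.bfs_norm_cmult Y.hardy_measurable[OF b] bfs_norm_eq_bnorm[OF Y.hardy_bfs[OF b]] ennreal_mult)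
        qed
        also have "\<dots> = ennreal (\<Sum>b\<in>B. cmod (\<phi> b (x n)) * bnorm \<rho>w b)"
          by (intro sum_ennreal) simp
        finally show ?thesis by (intro bnorm_leI sum_nonneg) auto
      qed
      have dlim: "(\<lambda>n. bnorm \<rho>w (d n)) \<longlonglongrightarrow> 0"
        by (rule tendsto_sandwich[OF always_eventually always_eventually tendsto_const lim]) (auto intro: dle)
      \<comment> \<open>z^n a f is split into the error of the shift, T(a) on the element x n - d n
        of M and T(a) on d n. The three bounds tend to 0, c and 0.\<close>
      have main: "bnorm \<rho>w (\<lambda>z. a z * f z) \<le> bnorm \<rho>w (\<lambda>z. ?T (x n) z - z powi int n * (a z * f z))
          + c * (1 + bnorm \<rho>w (d n)) + CT * bnorm \<rho>w (d n)" for n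
      proof -
        define y where "y = (\<lambda>z. x n z - d n z)"
        have y: "y \<in> M" unfolding y_def d_def by (rule B(3)[rule_format, OF x])
        have yH: "y \<in> hardy \<rho>w" using y MD(1) by auto
        have af: "(\<lambda>z. z powi int n * (a z * f z)) \<in> bfs \<rho>w"
          by (intro Y.bfs_powi_mult Y.bfs_mult_bounded[OF Y.hardy_bfs[OF f] am ab]) simp
        have yn: "bnorm \<rho>w y \<le> 1 + bnorm \<rho>w (d n)"
          using Y.bnorm_diff[OF Y.hardy_bfs[OF x] Y.hardy_bfs[OF d], of n n] xn[of n] f1 by (simp add: y_def)
        have "bnorm \<rho>w (\<lambda>z. a z * f z) = bnorm \<rho>w (\<lambda>z. z powi int n * (a z * f z))"
          by (intro Y.bnorm_powi_mult[symmetric] borel_measurable_times am Y.hardy_measurable[OF f])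
        also have "\<dots> \<le> bnorm \<rho>w (\<lambda>z. ?T (x n) z - z powi int n * (a z * f z)) + bnorm \<rho>w (?T y) + bnorm \<rho>w (?T (d n))"
        proof (rule Y.bnorm_dominated3)
          have "AE z in circle. ?T y z = ?T (x n) z - ?T (d n) z"
            unfolding y_def by (rule Y.toeplitz_diff[OF am ab _ x d]) simp
          then show "AE z in circle. cmod (z powi int n * (a z * f z))
              \<le> cmod (?T (x n) z - z powi int n * (a z * f z)) + cmod (?T y z) + cmod (?T (d n) z)"
          proof eventually_elim
            case (elim z)
            have "z powi int n * (a z * f z) = ?T y z + ?T (d n) z - (?T (x n) z - z powi int n * (a z * f z))"
              using elim by simp
            then have "cmod (z powi int n * (a z * f z))
                \<le> cmod (?T y z + ?T (d n) z) + cmod (?T (x n) z - z powi int n * (a z * f z))"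
              by (metis norm_triangle_ineq4)
            then show ?case using norm_triangle_ineq[of "?T y z" "?T (d n) z"] by linarith
          qed
        qed (rule Y.bfs_diff[OF Y.hardy_bfs[OF TH[OF x]] af] Y.hardy_bfs[OF TH[OF yH]] Y.hardy_bfs[OF TH[OF d]]
            bfs_measurable[OF af])+
        also have "\<dots> \<le> bnorm \<rho>w (\<lambda>z. ?T (x n) z - z powi int n * (a z * f z)) + c * (1 + bnorm \<rho>w (d n)) + CT * bnorm \<rho>w (d n)"
          by (intro add_mono order_refl TM[OF y yn] Tb d) (simp add: add_pos_nonneg)
        finally show ?thesis .
      qed
      have "(\<lambda>n. bnorm \<rho>w (\<lambda>z. ?T (x n) z - z powi int n * (a z * f z)) + c * (1 + bnorm \<rho>w (d n)) + CT * bnorm \<rho>w (d n))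
          \<longlonglongrightarrow> 0 + c * (1 + 0) + CT * 0"
        unfolding x_def by (intro tendsto_intros dlim[unfolded x_def] Y.toeplitz_shift_tendsto[OF a f])
      then show "bnorm \<rho>w (\<lambda>z. a z * f z) \<le> c"
        using main by (intro LIMSEQ_le_const[of _ c]) auto
    qed (auto simp: c_def)
    then show ?thesis unfolding op by (rule Linf_norm_leI[OF am])
  qed simp
qed

text \<open>A subsequence of K (z^n f) converges in norm by compactness. Each Fourier coefficient of
  K f is a bounded functional of f, hence tends to 0 along z^n f, so the limit has vanishing
  coefficients and is 0 a.e. Thus \<open>K\<close> contributes nothing in the limit.\<close>

lemma Linf_norm_le_ess_norm:
  assumes a: "a \<in> C_plus_Hinf"
  shows "Linf_norm a \<le> ess_norm (hardy \<rho>w) (bfs_norm \<rho>w) (toeplitz \<rho>w a)"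
  unfolding ess_norm_def
proof (rule INF_greatest)
  fix K assume "K \<in> {K. compact_operator (hardy \<rho>w) (bfs_norm \<rho>w) K}"
  then have K: "compact_operator (hardy \<rho>w) (bfs_norm \<rho>w) K" by simp
  then have lin: "linear_operator (hardy \<rho>w) K" by (simp add: compact_operator_def)
  have KH: "K f \<in> hardy \<rho>w" if "f \<in> hardy \<rho>w" for f using lin that by (auto simp: linear_operator_def)
  let ?T = "toeplitz \<rho>w a"
  let ?op = "op_norm (hardy \<rho>w) (bfs_norm \<rho>w) (\<lambda>f z. ?T f z - K f z)"
  have am [measurable]: "a \<in> borel_measurable circle" by (rule C_plus_Hinf_measurable[OF a])
  have ab: "AE z in circle. cmod (a z) \<le> enn2real (Linf_norm a)"
    by (rule AE_norm_le_Linf_norm[OF C_plus_Hinf_bounded[OF a]])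
  have TH: "?T f \<in> hardy \<rho>w" if "f \<in> hardy \<rho>w" for f
    by (rule Y.toeplitz_in_hardy[OF am ab _ that]) simp
  obtain CK where CK: "0 \<le> CK" "\<And>f. f \<in> hardy \<rho>w \<Longrightarrow> bnorm \<rho>w (K f) \<le> CK * bnorm \<rho>w f"
    using Y.compact_operator_bounded[OF K] by blast
  show "Linf_norm a \<le> ?op"
  proof (cases "?op = \<infinity>")
    case False
    define c where "c = enn2real ?op"
    have op: "?op = ennreal c" using False by (simp add: c_def less_top)
    have "AE z in circle. cmod (a z) \<le> c"
    proof (rule Y.multiplier_bound_hardy[OF am ab])
      fix f assume f: "f \<in> hardy \<rho>w" and f1: "bnorm \<rho>w f \<le> 1"
      define x where "x = (\<lambda>n::nat. \<lambda>z. z powi int n * f z)"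
      have x: "x n \<in> hardy \<rho>w" for n unfolding x_def by (rule Y.hardy_powi_mult[OF f]) simp
      have xn: "bnorm \<rho>w (x n) = bnorm \<rho>w f" for n
        unfolding x_def by (rule Y.bnorm_powi_mult[OF Y.hardy_measurable[OF f]])
      have "(\<lambda>n. fourier_coeff (K (x n)) k) \<longlonglongrightarrow> 0" for k
      proof -
        obtain C where C: "0 < C" "\<And>f k. f \<in> bfs \<rho>w \<Longrightarrow> cmod (fourier_coeff f k) \<le> C * bnorm \<rho>w f"
          using Y.bfs_fourier_coeff_bound by blast
        show ?thesis
          unfolding x_def
        proof (rule shift_weakly_null[where \<phi> = "\<lambda>f. fourier_coeff (K f) k" and C = "C * CK", OF _ _ _ _ f])
          fix g h assume g: "g \<in> hardy \<rho>w" and h: "h \<in> hardy \<rho>w"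
          have "fourier_coeff (K (\<lambda>z. g z + h z)) k = fourier_coeff (\<lambda>z. K g z + K h z) k"
            using lin g h
            by (intro fourier_coeff_cong_AE Y.hardy_measurable KH Y.hardy_add) (auto simp: linear_operator_def)
          then show "fourier_coeff (K (\<lambda>z. g z + h z)) k = fourier_coeff (K g) k + fourier_coeff (K h) k"
            using g h by (simp add: fourier_coeff_add Y.bfs_integrable Y.hardy_bfs KH)
        next
          fix s g assume g: "g \<in> hardy \<rho>w"
          have "fourier_coeff (K (\<lambda>z. s * g z)) k = fourier_coeff (\<lambda>z. s * K g z) k"
            using lin g
            by (intro fourier_coeff_cong_AE Y.hardy_measurable KH Y.hardy_cmult) (auto simp: linear_operator_def)
          then show "fourier_coeff (K (\<lambda>z. s * g z)) k = s * fourier_coeff (K g) k"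
            by (simp add: fourier_coeff_cmult)
        next
          show "0 \<le> C * CK" using C(1) CK(1) by simp
          fix g assume g: "g \<in> hardy \<rho>w"
          have "cmod (fourier_coeff (K g) k) \<le> C * bnorm \<rho>w (K g)" by (intro C Y.hardy_bfs KH g)
          also have "\<dots> \<le> C * (CK * bnorm \<rho>w g)" using C(1) by (intro mult_left_mono CK g) auto
          finally show "cmod (fourier_coeff (K g) k) \<le> C * CK * bnorm \<rho>w g" by simp
        qed
      qed
      note coeff_lim = this
      have "\<forall>n. bfs_norm \<rho>w (x n) \<le> ennreal 1"
        using xn f1 by (simp add: bfs_norm_eq_bnorm[OF Y.hardy_bfs[OF x]])
      then obtain r g where r: "strict_mono r" and g: "g \<in> hardy \<rho>w"
        and rg: "(\<lambda>n. bfs_norm \<rho>w (\<lambda>z. K (x (r n)) z - g z)) \<longlonglongrightarrow> 0"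
        using K x unfolding compact_operator_def by blast
      have lim: "(\<lambda>n. bnorm \<rho>w (\<lambda>z. K (x (r n)) z - g z)) \<longlonglongrightarrow> 0"
        using rg Y.bfs_norm_tendsto_0_iff[of "\<lambda>n z. K (x (r n)) z - g z"]
        by (simp add: Y.bfs_diff Y.hardy_bfs KH x g)
      have "fourier_coeff g k = 0" for k
      proof -
        have "(\<lambda>n. fourier_coeff (K (x (r n))) k) \<longlonglongrightarrow> fourier_coeff g k"
          by (intro Y.fourier_coeff_bfs_tendsto lim Y.hardy_bfs KH x g)
        moreover have "(\<lambda>n. fourier_coeff (K (x (r n))) k) \<longlonglongrightarrow> 0"
          using LIMSEQ_subseq_LIMSEQ[OF coeff_lim r] by (simp add: o_def)
        ultimately show ?thesis by (rule LIMSEQ_unique)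
      qed
      then have g0: "AE z in circle. g z = 0"
        by (intro fourier_coeff_eq_0_imp_AE Y.bfs_integrable Y.hardy_bfs g)
      have Klim: "(\<lambda>n. bnorm \<rho>w (K (x (r n)))) \<longlonglongrightarrow> 0"
      proof -
        have "bnorm \<rho>w (K (x (r n))) = bnorm \<rho>w (\<lambda>z. K (x (r n)) z - g z)" for n
          using g0 by (intro Y.bnorm_cong_AE Y.hardy_measurable KH x Y.hardy_diff g) auto
        then show ?thesis using lim by simp
      qed
      have main: "bnorm \<rho>w (\<lambda>z. a z * f z) \<le> bnorm \<rho>w (\<lambda>z. ?T (x n) z - z powi int n * (a z * f z)) + c + bnorm \<rho>w (K (x n))" for n
      proof -
        have af: "(\<lambda>z. z powi int n * (a z * f z)) \<in> bfs \<rho>w"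
          by (intro Y.bfs_powi_mult Y.bfs_mult_bounded[OF Y.hardy_bfs[OF f] am ab]) simp
        have "bnorm \<rho>w (\<lambda>z. a z * f z) = bnorm \<rho>w (\<lambda>z. z powi int n * (a z * f z))"
          by (intro Y.bnorm_powi_mult[symmetric] borel_measurable_times am Y.hardy_measurable[OF f])
        also have "\<dots> \<le> bnorm \<rho>w (\<lambda>z. ?T (x n) z - z powi int n * (a z * f z))
            + bnorm \<rho>w (\<lambda>z. ?T (x n) z - K (x n) z) + bnorm \<rho>w (K (x n))"
        proof (rule Y.bnorm_dominated3)
          show "AE z in circle. cmod (z powi int n * (a z * f z))
              \<le> cmod (?T (x n) z - z powi int n * (a z * f z)) + cmod (?T (x n) z - K (x n) z) + cmod (K (x n) z)"
          proof (rule AE_I2)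
            fix z
            have "z powi int n * (a z * f z) = (?T (x n) z - K (x n) z) + K (x n) z - (?T (x n) z - z powi int n * (a z * f z))"
              by simp
            then have "cmod (z powi int n * (a z * f z))
                \<le> cmod ((?T (x n) z - K (x n) z) + K (x n) z) + cmod (?T (x n) z - z powi int n * (a z * f z))"
              by (metis norm_triangle_ineq4)
            then show "cmod (z powi int n * (a z * f z))
              \<le> cmod (?T (x n) z - z powi int n * (a z * f z)) + cmod (?T (x n) z - K (x n) z) + cmod (K (x n) z)"
              using norm_triangle_ineq[of "?T (x n) z - K (x n) z" "K (x n) z"] by linarith
          qed
        qed (rule Y.bfs_diff[OF Y.hardy_bfs[OF TH[OF x]] af] Y.bfs_diff[OF Y.hardy_bfs[OF TH[OF x]] Y.hardy_bfs[OF KH[OF x]]]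
            Y.hardy_bfs[OF KH[OF x]] bfs_measurable[OF af])+
        also have "bnorm \<rho>w (\<lambda>z. ?T (x n) z - K (x n) z) \<le> c"
          unfolding c_def using xn[of n] f1 by (intro Y.op_norm_finite_bound[OF False x Y.hardy_bfs[OF x]]) simp
        finally show ?thesis by simp
      qed
      have "(\<lambda>n. bnorm \<rho>w (\<lambda>z. ?T (x n) z - z powi int n * (a z * f z))) \<longlonglongrightarrow> 0"
        unfolding x_def by (rule Y.toeplitz_shift_tendsto[OF a f])
      from LIMSEQ_subseq_LIMSEQ[OF this r]
      have Tlim: "(\<lambda>n. bnorm \<rho>w (\<lambda>z. ?T (x (r n)) z - z powi int (r n) * (a z * f z))) \<longlonglongrightarrow> 0"
        by (simp add: o_def)
      have "(\<lambda>n. bnorm \<rho>w (\<lambda>z. ?T (x (r n)) z - z powi int (r n) * (a z * f z)) + c + bnorm \<rho>w (K (x (r n)))) \<longlonglongrightarrow> 0 + c + 0"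
        by (intro tendsto_intros Tlim Klim)
      then show "bnorm \<rho>w (\<lambda>z. a z * f z) \<le> c"
        using main by (intro LIMSEQ_le_const[of _ c]) auto
    qed (auto simp: c_def)
    then show ?thesis unfolding op by (rule Linf_norm_leI[OF am])
  qed simp
qed

end

section \<open>Upper bounds\<close>

context riesz_space
begin

text \<open>On the space of multiples of \<open>z\<^sup>m\<close> the operator \<open>T(z\<^sup>-\<^sup>m h)\<close> is multiplication by \<open>z\<^sup>-\<^sup>m h\<close>.\<close>

lemma m_norm_le_Linf_norm:
  assumes a: "a \<in> C_plus_Hinf"
  shows "m_norm (hardy \<rho>) (bfs_norm \<rho>) (toeplitz \<rho> a) \<le> Linf_norm a"
proof (rule ennreal_le_epsilon)
  fix r :: real assume r: "0 < r"
  define A where "A = enn2real (Linf_norm a)"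
  have A: "Linf_norm a = ennreal A" using C_plus_Hinf_bounded[OF a] by (simp add: A_def less_top)
  have A0: "0 \<le> A" by (simp add: A_def)
  obtain C where C: "0 < C" "\<And>f. f \<in> bfs \<rho> \<Longrightarrow> bnorm \<rho> (riesz_projection \<rho> f) \<le> C * bnorm \<rho> f"
    using riesz_projection_bounded by metis
  \<comment> \<open>Makes e + C e = r: the excess in the bound of \<open>h\<close> plus the
    projected contribution of \<open>d\<close>.\<close>
  define e where "e = r / (1 + C)"
  have "e * (1 + C) = r" using C(1) by (simp add: e_def)
  then have e: "e > 0" "e + C * e = r"
    using r C(1) by (simp add: e_def, simp add: algebra_simps)
  obtain m h d where h: "h \<in> H1" and dm: "d \<in> borel_measurable circle" and d: "AE z in circle. cmod (d z) \<le> e"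
    and eq: "AE z in circle. a z = z powi (- int m) * h z + d z"
    and hb: "AE z in circle. cmod (h z) \<le> enn2real (Linf_norm a) + e"
    by (rule C_plus_Hinf_decomposition[OF a e(1)])
  have am: "a \<in> borel_measurable circle" by (rule C_plus_Hinf_measurable[OF a])
  have ab: "AE z in circle. cmod (a z) \<le> A"
    unfolding A_def by (rule AE_norm_le_Linf_norm[OF C_plus_Hinf_bounded[OF a]])
  have hb': "AE z in circle. cmod (h z) \<le> A + e" "0 \<le> A + e" using hb e(1) A0 by (auto simp: A_def)
  let ?M = "{f \<in> hardy \<rho>. \<forall>k<int m. fourier_coeff f k = 0}"
  have closed: "closed_linear_subspace (hardy \<rho>) (bfs_norm \<rho>) ?M"
  proof (rule closed_linear_subspaceI)
    fix F f assume F: "\<And>n. F n \<in> ?M" and f: "f \<in> hardy \<rho>" and lim: "(\<lambda>n. bnorm \<rho> (\<lambda>z. F n z - f z)) \<longlonglongrightarrow> 0"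
    have "fourier_coeff f k = 0" if "k < int m" for k
    proof -
      have "(\<lambda>n. fourier_coeff (F n) k) \<longlonglongrightarrow> fourier_coeff f k"
        using F f by (intro fourier_coeff_bfs_tendsto lim hardy_bfs) auto
      moreover have "fourier_coeff (F n) k = 0" for n using F[of n] that by simp
      ultimately show ?thesis by (simp add: LIMSEQ_const_iff)
    qed
    then show "f \<in> ?M" using f by simp
  qed (auto simp: hardy_0 hardy_add hardy_cmult fourier_coeff_add fourier_coeff_cmult bfs_integrable hardy_bfs)
  have fincodim: "finite_codimension (hardy \<rho>) ?M"
    unfolding finite_codimension_def
  proof (intro exI conjI ballI)
    define g where "g = (\<lambda>k::nat. \<lambda>z::complex. z powi int k)"
    \<comment> \<open>\<open>finite_codimension\<close> indexes the coefficients by the basis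
      functions themselves, so distinct exponents must give distinct functions. These live on the
      whole plane, where the value at 2 tells the powers apart.\<close>
    have inj: "inj_on g {..<m}"
    proof (rule inj_onI)
      fix j k assume "g j = g k"
      then have "g j 2 = g k 2" by simp
      then have "(2::complex) ^ j = 2 ^ k" by (simp add: g_def)
      then have "cmod (2 ^ j) = cmod (2 ^ k)" by simp
      then show "j = k" by (simp add: norm_power)
    qed
    show "finite (g ` {..<m})" by simp
    have gH: "g k \<in> hardy \<rho>" for k
      unfolding g_def using hardy_powi_mult[of "\<lambda>_. 1" "int k"] bfs_bounded[of "\<lambda>_. 1" 1] H1_const[of 1]
      by (simp add: hardy_iff)
    then show "g ` {..<m} \<subseteq> hardy \<rho>" by auto
    fix f assume f: "f \<in> hardy \<rho>"
    have sum: "(\<Sum>b\<in>g ` {..<m}. fourier_coeff f (int (inv_into {..<m} g b)) * b z) = (\<Sum>k<m. fourier_coeff f (int k) * g k z)" for z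
      by (subst sum.reindex[OF inj]) (auto intro!: sum.cong simp: inv_into_f_f[OF inj])
    let ?p = "\<lambda>z. \<Sum>k<m. fourier_coeff f (int k) * g k z"
    have pH: "?p \<in> hardy \<rho>" by (intro hardy_sum hardy_cmult gH)
    have "fourier_coeff ?p k = fourier_coeff f k" if "k < int m" for k
    proof -
      have "fourier_coeff ?p k = (\<Sum>j<m. fourier_coeff f (int j) * (if k = int j then 1 else 0))"
        unfolding g_def
        by (subst fourier_coeff_sum) (simp_all add: fourier_coeff_cmult fourier_coeff_powi del: power_int_of_nat)
      also have "\<dots> = fourier_coeff f k"
      proof (cases "k < 0")
        case True
        then show ?thesis using f by (auto simp: hardy_def intro!: sum.neutral)
      next
        case False
        then obtain i where i: "k = int i" using nonneg_int_cases by (metis not_less)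
        then show ?thesis using that by (simp add: sum.delta if_distrib[of "\<lambda>x. _ * x"] cong: if_cong)
      qed
      finally show ?thesis .
    qed
    then have "(\<lambda>z. f z - ?p z) \<in> ?M"
      using f pH by (simp add: hardy_diff fourier_coeff_diff bfs_integrable hardy_bfs)
    then show "(\<lambda>z. f z - (\<Sum>b\<in>g ` {..<m}. fourier_coeff f (int (inv_into {..<m} g b)) * b z)) \<in> ?M"
      by (simp only: sum)
  qed
  have "op_norm ?M (bfs_norm \<rho>) (toeplitz \<rho> a) \<le> ennreal (A + r)"
  proof (rule op_norm_leI)
    show "0 \<le> A + r" using A0 r by simp
    show "?M \<subseteq> bfs \<rho>" by (auto intro: hardy_bfs)
    show "toeplitz \<rho> a f \<in> bfs \<rho>" if "f \<in> ?M" for f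
      using that by (intro hardy_bfs toeplitz_in_hardy[OF am ab A0]) simp
    fix f assume "f \<in> ?M"
    then have f: "f \<in> hardy \<rho>" and f0: "\<And>k. k < int m \<Longrightarrow> fourier_coeff f k = 0" by auto
    have fm: "(\<lambda>z. z powi (- int m) * f z) \<in> hardy \<rho>"
      unfolding hardy_def using bfs_powi_mult[OF hardy_bfs[OF f], of "- int m"] f0
      by (simp add: fourier_coeff_mult_powi)
    have g: "(\<lambda>z. h z * (z powi (- int m) * f z)) \<in> hardy \<rho>"
      by (rule hardy_bounded_mult[OF h hb' fm])
    have "(\<lambda>z. h z * (z powi (- int m) * f z)) = (\<lambda>z. z powi (- int m) * (h z * f z))"
      by (simp add: fun_eq_iff mult.left_commute)
    with g have g: "(\<lambda>z. z powi (- int m) * (h z * f z)) \<in> hardy \<rho>" by simp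
    have df: "(\<lambda>z. d z * f z) \<in> bfs \<rho>" using e by (intro bfs_mult_bounded[OF hardy_bfs[OF f] dm d]) simp
    have "AE z in circle. toeplitz \<rho> a f z = z powi (- int m) * (h z * f z) + riesz_projection \<rho> (\<lambda>z. d z * f z) z"
      using toeplitz_split[OF am h hb' dm d _ eq f] e(1) riesz_projection_hardy_id[OF g]
      by (auto elim!: eventually_elim2)
    then have "bnorm \<rho> (toeplitz \<rho> a f) \<le> bnorm \<rho> (\<lambda>z. z powi (- int m) * (h z * f z)) + bnorm \<rho> (riesz_projection \<rho> (\<lambda>z. d z * f z))"
      by (intro bnorm_triangle_AE hardy_bfs[OF g] hardy_bfs[OF riesz_projection_hardy[OF df]]
          hardy_measurable[OF toeplitz_in_hardy[OF am ab A0 f]])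
    also have "bnorm \<rho> (\<lambda>z. z powi (- int m) * (h z * f z)) = bnorm \<rho> (\<lambda>z. h z * f z)"
      by (intro bnorm_powi_mult hardy_measurable hardy_bounded_mult[OF h hb' f])
    also have "\<dots> \<le> (A + e) * bnorm \<rho> f"
      using H1_integrable[OF h] by (intro bnorm_mult_le[OF _ hardy_bfs[OF f] hb']) auto
    also have "bnorm \<rho> (riesz_projection \<rho> (\<lambda>z. d z * f z)) \<le> C * (e * bnorm \<rho> f)"
      using C(1) e(1) bnorm_mult_le[OF dm hardy_bfs[OF f] d]
      by (intro order_trans[OF C(2)[OF df]] mult_left_mono) auto
    also have "(A + e) * bnorm \<rho> f + C * (e * bnorm \<rho> f) = (A + (e + C * e)) * bnorm \<rho> f"
      by (simp add: algebra_simps)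
    finally show "bnorm \<rho> (toeplitz \<rho> a f) \<le> (A + r) * bnorm \<rho> f" by (simp add: e(2))
  qed
  then have "m_norm (hardy \<rho>) (bfs_norm \<rho>) (toeplitz \<rho> a) \<le> ennreal (A + r)"
    unfolding m_norm_def using closed fincodim by (intro INF_lower2[of ?M]) auto
  then show "m_norm (hardy \<rho>) (bfs_norm \<rho>) (toeplitz \<rho> a) \<le> Linf_norm a + ennreal r"
    using A0 r by (simp add: A)
qed

end

section \<open>Operators of finite rank\<close>

context banach_function_norm
begin

text \<open>Collects what the compactness proof uses instead of the dimension of the range. Values
  lie in \<open>bfs\<close>, not necessarily in the Hardy space, because the single terms of the
  operator \<open>K\<close> in \<open>ess_norm_le\<close> may leave that space although their sum
  does not.\<close>

definition finite_rank :: "((complex \<Rightarrow> complex) \<Rightarrow> complex \<Rightarrow> complex) \<Rightarrow> bool" where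
  "finite_rank K \<longleftrightarrow> (\<forall>f\<in>hardy \<rho>. K f \<in> bfs \<rho>) \<and>
     (\<forall>f\<in>hardy \<rho>. \<forall>g\<in>hardy \<rho>. K (\<lambda>z. f z + g z) = (\<lambda>z. K f z + K g z)) \<and>
     (\<forall>c. \<forall>f\<in>hardy \<rho>. K (\<lambda>z. c * f z) = (\<lambda>z. c * K f z)) \<and>
     (\<forall>f\<in>hardy \<rho>. \<forall>g\<in>hardy \<rho>. (AE z in circle. f z = g z) \<longrightarrow> K f = K g) \<and>
     (\<forall>F B. (\<forall>n::nat. F n \<in> hardy \<rho> \<and> bnorm \<rho> (F n) \<le> B) \<longrightarrow>
        (\<exists>r g. strict_mono r \<and> g \<in> bfs \<rho> \<and> (\<lambda>n. bnorm \<rho> (\<lambda>z. K (F (r n)) z - g z)) \<longlonglongrightarrow> 0))"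

lemma finite_rank_0: "finite_rank (\<lambda>f z. 0)"
  unfolding finite_rank_def
  by (auto simp: bfs_0 bnorm_0 strict_mono_def intro!: exI[of _ "\<lambda>n::nat. n"] exI[of _ "\<lambda>_::complex. 0::complex"])

lemma finite_rankD:
  assumes "finite_rank K"
  shows finite_rank_bfs: "f \<in> hardy \<rho> \<Longrightarrow> K f \<in> bfs \<rho>"
    and finite_rank_additive: "f \<in> hardy \<rho> \<Longrightarrow> g \<in> hardy \<rho> \<Longrightarrow> K (\<lambda>z. f z + g z) = (\<lambda>z. K f z + K g z)"
    and finite_rank_homogeneous: "f \<in> hardy \<rho> \<Longrightarrow> K (\<lambda>z. c * f z) = (\<lambda>z. c * K f z)"
    and finite_rank_cong_AE: "f \<in> hardy \<rho> \<Longrightarrow> g \<in> hardy \<rho> \<Longrightarrow> (AE z in circle. f z = g z) \<Longrightarrow> K f = K g"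
    and finite_rank_subsequence: "\<forall>n::nat. F n \<in> hardy \<rho> \<and> bnorm \<rho> (F n) \<le> B \<Longrightarrow>
      \<exists>r g. strict_mono r \<and> g \<in> bfs \<rho> \<and> (\<lambda>n. bnorm \<rho> (\<lambda>z. K (F (r n)) z - g z)) \<longlonglongrightarrow> 0"
proof -
  note K = assms[unfolded finite_rank_def]
  show "f \<in> hardy \<rho> \<Longrightarrow> K f \<in> bfs \<rho>"
    by (rule K[THEN conjunct1, rule_format])
  show "f \<in> hardy \<rho> \<Longrightarrow> g \<in> hardy \<rho> \<Longrightarrow> K (\<lambda>z. f z + g z) = (\<lambda>z. K f z + K g z)"
    by (rule K[THEN conjunct2, THEN conjunct1, rule_format])
  show "f \<in> hardy \<rho> \<Longrightarrow> K (\<lambda>z. c * f z) = (\<lambda>z. c * K f z)"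
    by (rule K[THEN conjunct2, THEN conjunct2, THEN conjunct1, rule_format])
  show "f \<in> hardy \<rho> \<Longrightarrow> g \<in> hardy \<rho> \<Longrightarrow> (AE z in circle. f z = g z) \<Longrightarrow> K f = K g"
    by (rule K[THEN conjunct2, THEN conjunct2, THEN conjunct2, THEN conjunct1, rule_format])
  show "\<forall>n::nat. F n \<in> hardy \<rho> \<and> bnorm \<rho> (F n) \<le> B \<Longrightarrow>
      \<exists>r g. strict_mono r \<and> g \<in> bfs \<rho> \<and> (\<lambda>n. bnorm \<rho> (\<lambda>z. K (F (r n)) z - g z)) \<longlonglongrightarrow> 0"
    by (rule K[THEN conjunct2, THEN conjunct2, THEN conjunct2, THEN conjunct2, THEN spec, THEN spec, THEN mp])
qed

lemma finite_rank_add: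
  assumes "finite_rank K" "finite_rank L"
  shows "finite_rank (\<lambda>f z. K f z + L f z)"
  unfolding finite_rank_def
proof (intro conjI ballI allI impI)
  note K = finite_rankD[OF assms(1)] and L = finite_rankD[OF assms(2)]
  show "(\<lambda>z. K f z + L f z) \<in> bfs \<rho>" if "f \<in> hardy \<rho>" for f by (intro bfs_add K(1) L(1) that)
  show "(\<lambda>x. K (\<lambda>z. f z + g z) x + L (\<lambda>z. f z + g z) x) = (\<lambda>z. K f z + L f z + (K g z + L g z))"
    if "f \<in> hardy \<rho>" "g \<in> hardy \<rho>" for f g by (simp add: K(2)[OF that] L(2)[OF that] algebra_simps)
  show "(\<lambda>x. K (\<lambda>z. c * f z) x + L (\<lambda>z. c * f z) x) = (\<lambda>z. c * (K f z + L f z))"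
    if "f \<in> hardy \<rho>" for f c by (simp add: K(3)[OF that] L(3)[OF that] distrib_left)
  show "(\<lambda>z. K f z + L f z) = (\<lambda>z. K g z + L g z)"
    if "f \<in> hardy \<rho>" "g \<in> hardy \<rho>" "AE z in circle. f z = g z" for f g
    using K(4)[OF that] L(4)[OF that] by simp
  fix F B assume F: "\<forall>n::nat. F n \<in> hardy \<rho> \<and> bnorm \<rho> (F n) \<le> B"
  then obtain r g where r: "strict_mono r" "g \<in> bfs \<rho>" "(\<lambda>n. bnorm \<rho> (\<lambda>z. K (F (r n)) z - g z)) \<longlonglongrightarrow> 0"
    using K(5)[OF F] by blast
  have "\<forall>n. F (r n) \<in> hardy \<rho> \<and> bnorm \<rho> (F (r n)) \<le> B" using F by blast
  then obtain s h where s: "strict_mono s" "h \<in> bfs \<rho>" "(\<lambda>n. bnorm \<rho> (\<lambda>z. L (F (r (s n))) z - h z)) \<longlonglongrightarrow> 0"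
    using L(5)[of "\<lambda>n. F (r n)" B] by blast
  have 1: "(\<lambda>n. bnorm \<rho> (\<lambda>z. K (F (r (s n))) z - g z)) \<longlonglongrightarrow> 0"
    using LIMSEQ_subseq_LIMSEQ[OF r(3) s(1)] by (simp add: o_def)
  have lim: "(\<lambda>n. bnorm \<rho> (\<lambda>z. K (F (r (s n))) z - g z) + bnorm \<rho> (\<lambda>z. L (F (r (s n))) z - h z)) \<longlonglongrightarrow> 0"
    using tendsto_add[OF 1 s(3)] by simp
  have "(\<lambda>n. bnorm \<rho> (\<lambda>z. K (F (r (s n))) z + L (F (r (s n))) z - (g z + h z))) \<longlonglongrightarrow> 0"
  proof (rule tendsto_sandwich[OF always_eventually always_eventually tendsto_const lim]; rule allI)
    fix n
    have "(\<lambda>z. K (F (r (s n))) z - g z) \<in> bfs \<rho>" "(\<lambda>z. L (F (r (s n))) z - h z) \<in> bfs \<rho>"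
      using F by (auto intro!: bfs_diff K(1) L(1) r(2) s(2))
    from bnorm_add[OF this]
    show "bnorm \<rho> (\<lambda>z. K (F (r (s n))) z + L (F (r (s n))) z - (g z + h z))
        \<le> bnorm \<rho> (\<lambda>z. K (F (r (s n))) z - g z) + bnorm \<rho> (\<lambda>z. L (F (r (s n))) z - h z)"
      by (simp add: add_diff_add)
  qed simp
  then show "\<exists>r g. strict_mono r \<and> g \<in> bfs \<rho> \<and> (\<lambda>n. bnorm \<rho> (\<lambda>z. K (F (r n)) z + L (F (r n)) z - g z)) \<longlonglongrightarrow> 0"
    using strict_mono_o[OF r(1) s(1)] bfs_add[OF r(2) s(2)]
    by (intro exI[of _ "r \<circ> s"] exI[of _ "\<lambda>z. g z + h z"]) (simp add: o_def)
qed

lemma finite_rank_sum: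
  assumes "\<And>i. i \<in> I \<Longrightarrow> finite_rank (K i)"
  shows "finite_rank (\<lambda>f z. \<Sum>i\<in>I. K i f z)"
  using assms
  by (induction I rule: infinite_finite_induct) (auto intro: finite_rank_0 finite_rank_add)

text \<open>A bounded functional maps a bounded sequence to bounded scalars, and Bolzano-Weierstrass
  supplies the subsequence.\<close>

lemma finite_rank_rank_one:
  assumes add: "\<And>f g. f \<in> hardy \<rho> \<Longrightarrow> g \<in> hardy \<rho> \<Longrightarrow> \<phi> (\<lambda>z. f z + g z) = \<phi> f + \<phi> g"
    and cmult: "\<And>c f. f \<in> hardy \<rho> \<Longrightarrow> \<phi> (\<lambda>z. c * f z) = c * \<phi> f"
    and bd: "0 \<le> C" "\<And>f. f \<in> hardy \<rho> \<Longrightarrow> cmod (\<phi> f) \<le> C * bnorm \<rho> f"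
    and b: "b \<in> bfs \<rho>"
  shows "finite_rank (\<lambda>f z. \<phi> f * b z)"
  unfolding finite_rank_def
proof (intro conjI ballI allI impI)
  show "(\<lambda>z. \<phi> f * b z) \<in> bfs \<rho>" for f by (rule bfs_cmult[OF b])
  show "(\<lambda>x. \<phi> (\<lambda>z. f z + g z) * b x) = (\<lambda>z. \<phi> f * b z + \<phi> g * b z)" if "f \<in> hardy \<rho>" "g \<in> hardy \<rho>" for f g
    by (simp add: add[OF that] distrib_right)
  show "(\<lambda>x. \<phi> (\<lambda>z. c * f z) * b x) = (\<lambda>z. c * (\<phi> f * b z))" if "f \<in> hardy \<rho>" for c f
    by (simp add: cmult[OF that] mult.assoc)
  show "(\<lambda>z. \<phi> f * b z) = (\<lambda>z. \<phi> g * b z)" if f: "f \<in> hardy \<rho>" and g: "g \<in> hardy \<rho>" and eq: "AE z in circle. f z = g z" for f g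
  proof -
    have d: "(\<lambda>z. g z - f z) \<in> hardy \<rho>" by (rule hardy_diff[OF g f])
    have "AE z in circle. g z - f z = 0" using eq by eventually_elim simp
    then have "bnorm \<rho> (\<lambda>z. g z - f z) = 0" using bnorm_eq_0_iff[OF hardy_bfs[OF d]] by simp
    then have "\<phi> (\<lambda>z. g z - f z) = 0" using bd(2)[OF d] by simp
    then have "\<phi> f = \<phi> g" using add[OF f d] by simp
    then show ?thesis by simp
  qed
  fix F B assume F: "\<forall>n::nat. F n \<in> hardy \<rho> \<and> bnorm \<rho> (F n) \<le> B"
  have "\<phi> (F n) \<in> cball 0 (C * B)" for n
    using F bd(2)[of "F n"] mult_left_mono[OF _ bd(1), of "bnorm \<rho> (F n)" B] by (auto intro: order_trans)
  then obtain l r where r: "strict_mono r" "((\<lambda>n. \<phi> (F n)) \<circ> r) \<longlonglongrightarrow> l"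
    using compact_cball[of "0::complex" "C * B", unfolded compact_def, THEN spec, of "\<lambda>n. \<phi> (F n)"] by blast
  have "(\<lambda>n. cmod (\<phi> (F (r n)) - l) * bnorm \<rho> b) \<longlonglongrightarrow> cmod (l - l) * bnorm \<rho> b"
    using r(2) by (intro tendsto_intros) (simp add: o_def)
  moreover have "bnorm \<rho> (\<lambda>z. \<phi> (F (r n)) * b z - l * b z) = cmod (\<phi> (F (r n)) - l) * bnorm \<rho> b" for n
    using bnorm_cmult[OF bfs_measurable[OF b], of "\<phi> (F (r n)) - l"] by (simp add: left_diff_distrib)
  ultimately have "(\<lambda>n. bnorm \<rho> (\<lambda>z. \<phi> (F (r n)) * b z - l * b z)) \<longlonglongrightarrow> 0" by simp
  then show "\<exists>r g. strict_mono r \<and> g \<in> bfs \<rho> \<and> (\<lambda>n. bnorm \<rho> (\<lambda>z. \<phi> (F (r n)) * b z - g z)) \<longlonglongrightarrow> 0"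
    using r(1) bfs_cmult[OF b] by blast
qed

text \<open>The limits of images are only known to lie in \<open>bfs\<close>; closedness puts them
  back into the Hardy space.\<close>

lemma finite_rank_compact_operator:
  assumes K: "finite_rank K" and KH: "\<And>f. f \<in> hardy \<rho> \<Longrightarrow> K f \<in> hardy \<rho>"
  shows "compact_operator (hardy \<rho>) (bfs_norm \<rho>) K"
  unfolding compact_operator_def
proof (intro conjI allI impI)
  note K' = finite_rankD[OF K]
  show "linear_operator (hardy \<rho>) K"
    unfolding linear_operator_def
  proof (intro conjI ballI allI impI)
    show "K ` hardy \<rho> \<subseteq> hardy \<rho>" using KH by auto
    show "AE z in circle. K f z = K g z" if "f \<in> hardy \<rho>" "g \<in> hardy \<rho>" "AE z in circle. f z = g z" for f g
    proof -
      have "K f = K g" by (rule K'(4)[OF that])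
      then show ?thesis by simp
    qed
    show "AE z in circle. K (\<lambda>x. f x + g x) z = K f z + K g z" if "f \<in> hardy \<rho>" "g \<in> hardy \<rho>" for f g
      by (simp add: K'(2)[OF that])
    show "AE z in circle. K (\<lambda>x. c * f x) z = c * K f z" if "f \<in> hardy \<rho>" for c f
      by (simp add: K'(3)[OF that])
  qed
  fix F :: "nat \<Rightarrow> complex \<Rightarrow> complex"
  assume F: "(\<forall>n. F n \<in> hardy \<rho>) \<and> (\<exists>C::real. \<forall>n. bfs_norm \<rho> (F n) \<le> ennreal C)"
  then obtain C :: real where C: "\<And>n. bfs_norm \<rho> (F n) \<le> ennreal C" by blast
  have "bnorm \<rho> (F n) \<le> \<bar>C\<bar>" for n
    by (rule bnorm_leI[OF order_trans[OF C ennreal_leI]]) auto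
  then have "\<forall>n. F n \<in> hardy \<rho> \<and> bnorm \<rho> (F n) \<le> \<bar>C\<bar>" using F by blast
  then obtain r g where r: "strict_mono r" "g \<in> bfs \<rho>" "(\<lambda>n. bnorm \<rho> (\<lambda>z. K (F (r n)) z - g z)) \<longlonglongrightarrow> 0"
    using K'(5)[of F "\<bar>C\<bar>"] by blast
  have FK: "K (F n) \<in> hardy \<rho>" for n using F KH by blast
  have g: "g \<in> hardy \<rho>"
    by (rule hardy_closed[OF FK r(2,3)])
  have "(\<lambda>n. bfs_norm \<rho> (\<lambda>z. K (F (r n)) z - g z)) \<longlonglongrightarrow> 0"
    using r(3) bfs_norm_tendsto_0_iff[of "\<lambda>n z. K (F (r n)) z - g z"] by (simp add: bfs_diff hardy_bfs FK g)
  then show "\<exists>r g. strict_mono r \<and> g \<in> hardy \<rho> \<and> (\<lambda>n. bfs_norm \<rho> (\<lambda>z. K (F (r n)) z - g z)) \<longlonglongrightarrow> 0"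
    using r(1) g by blast
qed

lemma bnorm_fejer_mean_le:
  assumes "translation_invariant \<rho>" "g \<in> bfs \<rho>"
  shows "fejer_mean n g \<in> bfs \<rho>" "bnorm \<rho> (fejer_mean n g) \<le> bnorm \<rho> g"
proof -
  note le = bfs_norm_fejer_mean_le[OF assms, of n]
  then show "fejer_mean n g \<in> bfs \<rho>" using assms(2) by (auto simp: bfs_def)
  show "bnorm \<rho> (fejer_mean n g) \<le> bnorm \<rho> g"
    using le by (intro bnorm_leI) (simp_all add: bfs_norm_eq_bnorm[OF assms(2)])
qed

end

section \<open>The upper bound for the essential norm\<close>

context toeplitz_setting
begin

text \<open>For w this is the embedding of X into L^1, for 1/w it is Hoelder's inequality against
  the constant 1.\<close>

lemma weight_integrable: "integrable circle w" and inverse_weight_integrable: "integrable circle (\<lambda>z. 1 / w z)"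
proof -
  show "integrable circle w"
    using bfs_integrable[OF w_bfs] by (simp add: complex_of_real_integrable_eq)
  have "(\<integral>\<^sup>+z. 1 * ennreal (cmod (complex_of_real (1 / w z))) \<partial>circle)
      \<le> \<rho> (\<lambda>_. 1) * assoc_norm \<rho> (\<lambda>z. ennreal (cmod (complex_of_real (1 / w z))))"
    using one_finite by (intro hoelder_associate) auto
  also have "\<dots> < \<infinity>"
    using one_finite w_inv by (simp add: bfs_def bfs_norm_def ennreal_mult_less_top)
  finally show "integrable circle (\<lambda>z. 1 / w z)"
    by (intro integrableI_bounded) (auto simp: norm_divide)
qed

text \<open>T(z^(-m) h) removes the coefficients of h f below m and shifts; this is
  \<open>V\<close>. In \<open>S\<close>, instead, W h f is stripped of its corrected Fejer mean,
  shifted and divided by \<open>W\<close>. In the difference \<open>K\<close> of the two the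
  function h f cancels and only finitely many coefficient functionals remain.\<close>

lemma ess_norm_le:
  assumes a: "a \<in> C_plus_Hinf"
  shows "ess_norm (hardy \<rho>w) (bfs_norm \<rho>w) (toeplitz \<rho>w a) \<le> 2 * Linf_norm a"
proof (rule ennreal_le_epsilon)
  fix \<epsilon> :: real assume \<epsilon>: "0 < \<epsilon>"
  define A where "A = enn2real (Linf_norm a)"
  have A: "Linf_norm a = ennreal A" using C_plus_Hinf_bounded[OF a] by (simp add: A_def less_top)
  have A0: "0 \<le> A" by (simp add: A_def)
  obtain C where C: "0 < C" "\<And>f. f \<in> bfs \<rho>w \<Longrightarrow> bnorm \<rho>w (riesz_projection \<rho>w f) \<le> C * bnorm \<rho>w f"
    using Y.riesz_projection_bounded by metis
  \<comment> \<open>The bound expands to 2 A + e (2 + A + e + C). With e \<le> 1 this leads to the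
    denominator 3 + A + C.\<close>
  define e where "e = min 1 (\<epsilon> / (3 + A + C))"
  have den: "3 + A + C > 0" using A0 C(1) by simp
  have e: "0 < e" "e \<le> 1" using \<epsilon> den by (auto simp: e_def)
  have eb: "(2 + e) * (A + e) + C * e \<le> 2 * A + \<epsilon>"
  proof -
    have "e * (3 + A + C) \<le> \<epsilon> / (3 + A + C) * (3 + A + C)"
      using den by (intro mult_right_mono) (auto simp: e_def)
    then have "e * (3 + A + C) \<le> \<epsilon>" using den by simp
    moreover have "e * e \<le> e * 1" using e by (intro mult_left_mono) auto
    ultimately show ?thesis by (simp add: algebra_simps)
  qed
  obtain m h d where h: "h \<in> H1" and dm: "d \<in> borel_measurable circle" and d: "AE z in circle. cmod (d z) \<le> e"
    and eq: "AE z in circle. a z = z powi (- int m) * h z + d z"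
    and hb: "AE z in circle. cmod (h z) \<le> enn2real (Linf_norm a) + e"
    by (rule C_plus_Hinf_decomposition[OF a e(1)])
  have am: "a \<in> borel_measurable circle" by (rule C_plus_Hinf_measurable[OF a])
  have ab: "AE z in circle. cmod (a z) \<le> A"
    unfolding A_def by (rule AE_norm_le_Linf_norm[OF C_plus_Hinf_bounded[OF a]])
  have hb': "AE z in circle. cmod (h z) \<le> A + e" "0 \<le> A + e" using hb e(1) A0 by (auto simp: A_def)
  have hm [measurable]: "h \<in> borel_measurable circle" using H1_integrable[OF h] by simp
  obtain W where Wm [measurable]: "W \<in> borel_measurable circle" and W0: "\<And>z. W z \<noteq> 0"
    and Ww: "AE z in circle. cmod (W z) = w z"
    and W1: "\<And>f. f \<in> H1 \<Longrightarrow> integrable circle (\<lambda>z. of_real (w z) * f z) \<Longrightarrow> (\<lambda>z. W z * f z) \<in> H1"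
    and W2: "\<And>f. f \<in> H1 \<Longrightarrow> integrable circle (\<lambda>z. f z / of_real (w z)) \<Longrightarrow> (\<lambda>z. f z / W z) \<in> H1"
    by (rule outer_function_exists[OF w_meas w_pos weight_integrable inverse_weight_integrable])
      (auto intro: that)
  \<comment> \<open>As |W| = w a.e., division by \<open>W\<close> carries the norm of X into the
    weighted norm just as division by w does; in addition it preserves analyticity, by
    \<open>W2\<close>.\<close>
  have Wbfs: "(\<lambda>z. x z / W z) \<in> bfs \<rho>w" "bnorm \<rho>w (\<lambda>z. x z / W z) = bnorm \<rho> x" if x: "x \<in> bfs \<rho>" for x
  proof -
    have [measurable]: "x \<in> borel_measurable circle" by (rule bfs_measurable[OF x])
    have "bfs_norm \<rho>w (\<lambda>z. x z / W z) = bfs_norm \<rho> x"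
      unfolding bfs_norm_weighted
    proof (rule bfs_norm_cong_AE)
      show "AE z in circle. cmod (complex_of_real (w z) * (x z / W z)) = cmod (x z)"
        using Ww w_pos by eventually_elim (simp add: norm_mult norm_divide)
    qed measurable
    then show "(\<lambda>z. x z / W z) \<in> bfs \<rho>w" "bnorm \<rho>w (\<lambda>z. x z / W z) = bnorm \<rho> x"
      using x by (auto simp: bfs_def bnorm_def)
  qed
  define G where "G = (\<lambda>f z. W z * (h z * f z))"
  have G: "G f \<in> hardy \<rho>" "bnorm \<rho> (G f) \<le> (A + e) * bnorm \<rho>w f" if f: "f \<in> hardy \<rho>w" for f
  proof -
    have hf: "(\<lambda>z. h z * f z) \<in> hardy \<rho>w" by (rule Y.hardy_bounded_mult[OF h hb' f])
    note [measurable] = Y.hardy_measurable[OF hf]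
    have wb: "(\<lambda>z. of_real (w z) * (h z * f z)) \<in> bfs \<rho>" by (rule weight_mult_bfs[OF Y.hardy_bfs[OF hf]])
    have ae: "AE z in circle. cmod (G f z) = cmod (of_real (w z) * (h z * f z))"
      using Ww w_pos by eventually_elim (simp add: G_def norm_mult)
    have Gm: "G f \<in> borel_measurable circle" unfolding G_def by measurable
    have Gb: "G f \<in> bfs \<rho>" using ae by (intro bfs_mono_AE[OF wb Gm]) (auto elim: eventually_mono)
    have "G f \<in> H1" unfolding G_def
      using hf bfs_integrable[OF wb] by (intro W1) (auto simp: Y.hardy_iff)
    with Gb show "G f \<in> hardy \<rho>" by (simp add: hardy_iff)
    have "bnorm \<rho> (G f) = bnorm \<rho>w (\<lambda>z. h z * f z)"
      unfolding bnorm_weighted by (rule bnorm_cong_AE[OF Gm bfs_measurable[OF wb] ae])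
    also have "\<dots> \<le> (A + e) * bnorm \<rho>w f" by (rule Y.bnorm_mult_le[OF hm Y.hardy_bfs[OF f] hb'])
    finally show "bnorm \<rho> (G f) \<le> (A + e) * bnorm \<rho>w f" .
  qed
  have Gadd: "G (\<lambda>z. f z + g z) = (\<lambda>z. G f z + G g z)" and Gcmult: "G (\<lambda>z. c * f z) = (\<lambda>z. c * G f z)" for f g c
    by (simp_all add: G_def fun_eq_iff algebra_simps)
  obtain C1 where C1: "0 < C1" "\<And>f k. f \<in> bfs \<rho> \<Longrightarrow> cmod (fourier_coeff f k) \<le> C1 * bnorm \<rho> f"
    using bfs_fourier_coeff_bound by blast
  obtain C2 where C2: "0 < C2" "\<And>f k. f \<in> bfs \<rho>w \<Longrightarrow> cmod (fourier_coeff f k) \<le> C2 * bnorm \<rho>w f"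
    using Y.bfs_fourier_coeff_bound by blast
  define u where "u = bnorm \<rho> (\<lambda>_. 1)"
  have one: "(\<lambda>_. 1) \<in> bfs \<rho>" by (rule bfs_bounded[where B = 1]) auto
  have "(\<lambda>n. \<Sum>k<m. \<bar>1 - fejer_weight n (int k)\<bar> * (C1 * u)) \<longlonglongrightarrow> (\<Sum>k<m. \<bar>1 - 1\<bar> * (C1 * u))"
    by (intro tendsto_intros fejer_weight_tendsto)
  then have "(\<lambda>n. \<Sum>k<m. \<bar>1 - fejer_weight n (int k)\<bar> * (C1 * u)) \<longlonglongrightarrow> 0" by simp
  then have "\<forall>\<^sub>F n in sequentially. (\<Sum>k<m. \<bar>1 - fejer_weight n (int k)\<bar> * (C1 * u)) < e"
    using e(1) by (rule order_tendstoD)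
  \<comment> \<open>\<open>n\<close> is chosen after \<open>m\<close>: the weights of the exponents
    below m are so close to 1 that the correction in \<open>q\<close> is small relative to G f.
    \<open>C1\<close> bounds the coefficients, and \<open>u\<close> is the norm of every power of
    z.\<close>
  then obtain n where n: "(\<Sum>k<m. \<bar>1 - fejer_weight n (int k)\<bar> * (C1 * u)) < e"
    by (auto simp: eventually_sequentially)
  \<comment> \<open>\<open>q f\<close> is the Fejer mean of \<open>G f\<close>, corrected so that the coefficients of \<open>G f - q f\<close> below
    \<open>m\<close> vanish.\<close>
  define \<delta> where "\<delta> = (\<lambda>k. complex_of_real (1 - fejer_weight n k))"
  define q where "q = (\<lambda>f z. fejer_mean n (G f) z + (\<Sum>k<m. \<delta> (int k) * fourier_coeff (G f) (int k) * z powi int k))"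
  define R where "R = (\<lambda>f z. G f z - q f z)"
  define S where "S = (\<lambda>f z. (z powi (- int m) * R f z) / W z)"
  have pw: "(\<lambda>z. z powi k) \<in> bfs \<rho>" for k
    using bfs_powi_mult[OF one, of k] by simp
  \<comment> \<open>The factor 2 + e counts G f itself, its Fejer mean of at most the same norm, and
    e for the correction.\<close>
  have R: "R f \<in> bfs \<rho>" "bnorm \<rho> (R f) \<le> (2 + e) * ((A + e) * bnorm \<rho>w f)"
    "\<And>k. k < int m \<Longrightarrow> fourier_coeff (R f) k = 0" if f: "f \<in> hardy \<rho>w" for f
  proof -
    note Gf = G(1)[OF f]
    let ?s = "\<lambda>z. \<Sum>k<m. \<delta> (int k) * fourier_coeff (G f) (int k) * z powi int k"
    have s: "?s \<in> bfs \<rho>" by (intro bfs_sum bfs_cmult pw)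
    have F: "fejer_mean n (G f) \<in> bfs \<rho>" "bnorm \<rho> (fejer_mean n (G f)) \<le> bnorm \<rho> (G f)"
      using bnorm_fejer_mean_le[OF tr hardy_bfs[OF Gf]] by auto
    show Rb: "R f \<in> bfs \<rho>"
      unfolding R_def q_def by (intro bfs_diff bfs_add hardy_bfs Gf F s)
    have sn: "bnorm \<rho> ?s \<le> e * bnorm \<rho> (G f)"
    proof -
      have "bfs_norm \<rho> ?s \<le> (\<Sum>k<m. bfs_norm \<rho> (\<lambda>z. \<delta> (int k) * fourier_coeff (G f) (int k) * z powi int k))"
        by (intro bfs_norm_sum bfs_measurable[OF bfs_cmult] pw)
      also have "\<dots> = (\<Sum>k<m. ennreal (cmod (\<delta> (int k)) * cmod (fourier_coeff (G f) (int k)) * u))"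
      proof (rule sum.cong[OF refl])
        fix k
        have "bnorm \<rho> (\<lambda>z. z powi int k) = u"
          using bnorm_powi_mult[OF bfs_measurable[OF one], of "int k"] by (simp add: u_def)
        then show "bfs_norm \<rho> (\<lambda>z. \<delta> (int k) * fourier_coeff (G f) (int k) * z powi int k)
            = ennreal (cmod (\<delta> (int k)) * cmod (fourier_coeff (G f) (int k)) * u)"
          by (simp only: bfs_norm_cmult[OF bfs_measurable[OF pw]] bfs_norm_eq_bnorm[OF pw] norm_mult)
             (simp add: ennreal_mult u_def)
      qed
      also have "\<dots> = ennreal (\<Sum>k<m. cmod (\<delta> (int k)) * cmod (fourier_coeff (G f) (int k)) * u)"
        by (intro sum_ennreal) (simp add: u_def)
      finally have "bnorm \<rho> ?s \<le> (\<Sum>k<m. cmod (\<delta> (int k)) * cmod (fourier_coeff (G f) (int k)) * u)"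
        by (intro bnorm_leI sum_nonneg) (auto simp: u_def)
      also have "\<dots> \<le> (\<Sum>k<m. \<bar>1 - fejer_weight n (int k)\<bar> * (C1 * bnorm \<rho> (G f)) * u)"
        using C1(2)[OF hardy_bfs[OF Gf]]
        by (intro sum_mono mult_right_mono mult_mono) (auto simp: \<delta>_def u_def simp del: of_real_diff)
      also have "\<dots> = (\<Sum>k<m. \<bar>1 - fejer_weight n (int k)\<bar> * (C1 * u)) * bnorm \<rho> (G f)"
        by (simp add: sum_distrib_left sum_distrib_right mult_ac)
      also have "\<dots> \<le> e * bnorm \<rho> (G f)" using n by (intro mult_right_mono) auto
      finally show ?thesis .
    qed
    have "bnorm \<rho> (R f) \<le> bnorm \<rho> (G f) + bnorm \<rho> (fejer_mean n (G f)) + bnorm \<rho> ?s"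
    proof (rule bnorm_dominated3[OF hardy_bfs[OF Gf] F(1) s bfs_measurable[OF Rb]], rule AE_I2)
      fix z
      show "cmod (R f z) \<le> cmod (G f z) + cmod (fejer_mean n (G f) z) + cmod (?s z)"
        unfolding R_def q_def
        using norm_triangle_ineq4[of "G f z" "fejer_mean n (G f) z + ?s z"]
          norm_triangle_ineq[of "fejer_mean n (G f) z" "?s z"] by linarith
    qed
    also have "\<dots> \<le> (2 + e) * bnorm \<rho> (G f)" using F(2) sn by (simp add: algebra_simps)
    also have "\<dots> \<le> (2 + e) * ((A + e) * bnorm \<rho>w f)" using e G(2)[OF f] by (intro mult_left_mono) auto
    finally show "bnorm \<rho> (R f) \<le> (2 + e) * ((A + e) * bnorm \<rho>w f)" .
    fix k assume k: "k < int m"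
    have "fourier_coeff ?s k = (\<Sum>j<m. \<delta> (int j) * fourier_coeff (G f) (int j) * (if k = int j then 1 else 0))"
      by (subst fourier_coeff_sum)
        (simp_all only: fourier_coeff_cmult fourier_coeff_powi bfs_integrable[OF bfs_cmult[OF pw]])
    also have "\<dots> = \<delta> k * fourier_coeff (G f) k"
    proof (cases "k < 0")
      case True
      then show ?thesis using Gf by (auto simp: hardy_def intro!: sum.neutral)
    next
      case False
      then obtain i where i: "k = int i" using nonneg_int_cases by (metis not_less)
      then show ?thesis using k by (simp add: if_distrib[of "\<lambda>x. _ * x"] cong: if_cong)
    qed
    finally have sk: "fourier_coeff ?s k = \<delta> k * fourier_coeff (G f) k" .
    have "fourier_coeff (R f) k = fourier_coeff (G f) k - (of_real (fejer_weight n k) * fourier_coeff (G f) k + \<delta> k * fourier_coeff (G f) k)"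
      unfolding R_def q_def
      using bfs_integrable[OF hardy_bfs[OF Gf]] bfs_integrable[OF F(1)] bfs_integrable[OF s]
      by (simp only: fourier_coeff_diff fourier_coeff_add Bochner_Integration.integrable_add fourier_coeff_fejer_mean sk)
    then show "fourier_coeff (R f) k = 0" by (simp add: \<delta>_def algebra_simps)
  qed
  \<comment> \<open>The coefficients of R f below m vanish, so z^(-m) R f is analytic, and division
    by the outer function keeps it so.\<close>
  have S: "S f \<in> hardy \<rho>w" "bnorm \<rho>w (S f) \<le> (2 + e) * ((A + e) * bnorm \<rho>w f)" if f: "f \<in> hardy \<rho>w" for f
  proof -
    have zR: "(\<lambda>z. z powi (- int m) * R f z) \<in> bfs \<rho>" by (rule bfs_powi_mult[OF R(1)[OF f]])
    have "(\<lambda>z. z powi (- int m) * R f z) \<in> H1"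
      using R(3)[OF f] bfs_integrable[OF zR] by (simp add: H1_def fourier_coeff_mult_powi)
    then have "S f \<in> H1"
      unfolding S_def by (intro W2 Y.bfs_integrable divide_weight_bfs(1)[OF zR])
    then show "S f \<in> hardy \<rho>w" using Wbfs(1)[OF zR] by (simp add: Y.hardy_iff S_def)
    have "bnorm \<rho>w (S f) = bnorm \<rho> (R f)"
      unfolding S_def using Wbfs(2)[OF zR] bnorm_powi_mult[OF bfs_measurable[OF R(1)[OF f]]] by simp
    then show "bnorm \<rho>w (S f) \<le> (2 + e) * ((A + e) * bnorm \<rho>w f)" using R(2)[OF f] by simp
  qed
  \<comment> \<open>A pointwise formula for T(z^(-m) h) f: the coefficients of h f below m, which
    the shift would move to negative indices, are removed beforehand.\<close>
  define V where "V = (\<lambda>f z. z powi (- int m) * (h z * f z - (\<Sum>k<m. fourier_coeff (\<lambda>z. h z * f z) (int k) * z powi int k)))"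
  \<comment> \<open>The sums are the Fejer mean of G f and its correction, both shifted and divided
    by \<open>W\<close>, and the coefficients removed in \<open>V\<close>. Single terms need not be
    analytic, but the total is, since it equals V f - S f a.e.\<close>
  define K where "K = (\<lambda>f z.
      (\<Sum>i\<le>n. \<Sum>j\<le>n. (fourier_coeff (G f) (int i - int j) / of_nat (n + 1)) * (z powi (int i - int j - int m) / W z)) +
      (\<Sum>k<m. (\<delta> (int k) * fourier_coeff (G f) (int k)) * (z powi (int k - int m) / W z)) +
      (\<Sum>k<m. (- fourier_coeff (\<lambda>z. h z * f z) (int k)) * z powi (int k - int m)))"
  have KV: "AE z in circle. K f z = V f z - S f z" for f
    using AE_circle_norm
  proof eventually_elim
    case (elim z)
    then have z: "z \<noteq> 0" by auto
    then have p: "z powi (k - int m) = z powi (- int m) * z powi k" for k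
      using power_int_add[of z "- int m" k] by simp
    have "K f z = z powi (- int m) * (q f z / W z - (\<Sum>k<m. fourier_coeff (\<lambda>z. h z * f z) (int k) * z powi int k))"
      unfolding K_def q_def fejer_mean_def p
      by (simp add: add_divide_distrib sum_divide_distrib sum_distrib_left distrib_left right_diff_distrib sum_negf
          mult_ac del: power_int_of_nat of_nat_Suc)
    also have "q f z / W z = h z * f z - R f z / W z"
      using W0[of z] by (simp add: R_def G_def field_simps)
    finally show ?case by (simp add: V_def S_def algebra_simps)
  qed
  have VH: "V f \<in> hardy \<rho>w" and VP: "AE z in circle. riesz_projection \<rho>w (\<lambda>z. z powi (- int m) * (h z * f z)) z = V f z"
    if f: "f \<in> hardy \<rho>w" for f
  proof -
    let ?g = "\<lambda>z. h z * f z"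
    let ?p = "\<lambda>z. \<Sum>k<m. fourier_coeff ?g (int k) * z powi int k"
    have hf: "?g \<in> hardy \<rho>w" by (rule Y.hardy_bounded_mult[OF h hb' f])
    have pwY: "(\<lambda>z. z powi k) \<in> bfs \<rho>w" for k
      using Y.bfs_powi_mult[OF Y.bfs_bounded[of "\<lambda>_. 1" 1], of k] by simp
    have pb: "?p \<in> bfs \<rho>w" by (intro Y.bfs_sum Y.bfs_cmult pwY)
    have pk: "fourier_coeff ?p k = (if k < int m then fourier_coeff ?g k else 0)" for k
    proof -
      have "fourier_coeff ?p k = (\<Sum>j<m. fourier_coeff ?g (int j) * (if k = int j then 1 else 0))"
        by (subst fourier_coeff_sum)
          (simp_all only: fourier_coeff_cmult fourier_coeff_powi Y.bfs_integrable[OF Y.bfs_cmult[OF pwY]])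
      also have "\<dots> = (if k < int m then fourier_coeff ?g k else 0)"
      proof (cases "k < 0")
        case True
        then show ?thesis using hf by (auto simp: hardy_def intro!: sum.neutral)
      next
        case False
        then obtain i where i: "k = int i" using nonneg_int_cases by (metis not_less)
        then show ?thesis by (simp add: if_distrib[of "\<lambda>x. _ * x"] cong: if_cong)
      qed
      finally show ?thesis .
    qed
    have Vb: "V f \<in> bfs \<rho>w" unfolding V_def by (intro Y.bfs_powi_mult Y.bfs_diff Y.hardy_bfs[OF hf] pb)
    have Vk: "fourier_coeff (V f) k = (if k < 0 then 0 else fourier_coeff ?g (k + int m))" for k
    proof -
      have "fourier_coeff (V f) k = fourier_coeff (\<lambda>z. ?g z - ?p z) (k + int m)"
        unfolding V_def fourier_coeff_mult_powi by simp
      also have "\<dots> = fourier_coeff ?g (k + int m) - fourier_coeff ?p (k + int m)"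
        by (rule fourier_coeff_diff[OF Y.bfs_integrable[OF Y.hardy_bfs[OF hf]] Y.bfs_integrable[OF pb]])
      also have "\<dots> = (if k < 0 then 0 else fourier_coeff ?g (k + int m))" unfolding pk by auto
      finally show ?thesis .
    qed
    show VH: "V f \<in> hardy \<rho>w" using Vb Vk by (simp add: hardy_def)
    show "AE z in circle. riesz_projection \<rho>w (\<lambda>z. z powi (- int m) * (h z * f z)) z = V f z"
    proof (rule Y.riesz_projection_eqI[OF Y.bfs_powi_mult[OF Y.hardy_bfs[OF hf]] VH])
      show "fourier_coeff (V f) k = fourier_coeff (\<lambda>z. z powi (- int m) * (h z * f z)) k" if "0 \<le> k" for k
        unfolding fourier_coeff_mult_powi Vk using that by simp
    qed
  qed
  have Gco: "Y.finite_rank (\<lambda>f z. c * fourier_coeff (G f) k * b z)" if b: "b \<in> bfs \<rho>w" for b c k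
  proof (rule Y.finite_rank_rank_one[where C = "cmod c * (C1 * (A + e))", OF _ _ _ _ b])
    fix f g assume f: "f \<in> hardy \<rho>w" and g: "g \<in> hardy \<rho>w"
    show "c * fourier_coeff (G (\<lambda>z. f z + g z)) k = c * fourier_coeff (G f) k + c * fourier_coeff (G g) k"
      unfolding Gadd using G(1)[OF f] G(1)[OF g]
      by (simp add: fourier_coeff_add bfs_integrable hardy_bfs distrib_left)
  next
    fix s f
    show "c * fourier_coeff (G (\<lambda>z. s * f z)) k = s * (c * fourier_coeff (G f) k)"
      unfolding Gcmult by (simp add: fourier_coeff_cmult)
  next
    show "0 \<le> cmod c * (C1 * (A + e))" using C1(1) hb'(2) by simp
    fix f assume f: "f \<in> hardy \<rho>w"
    have "cmod (fourier_coeff (G f) k) \<le> C1 * bnorm \<rho> (G f)" by (rule C1(2)[OF hardy_bfs[OF G(1)[OF f]]])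
    also have "\<dots> \<le> C1 * ((A + e) * bnorm \<rho>w f)" using C1(1) G(2)[OF f] by (intro mult_left_mono) auto
    finally show "cmod (c * fourier_coeff (G f) k) \<le> cmod c * (C1 * (A + e)) * bnorm \<rho>w f"
      by (simp add: norm_mult mult.assoc mult_left_mono)
  qed
  have fr: "Y.finite_rank K"
    unfolding K_def
  proof (intro Y.finite_rank_add Y.finite_rank_sum)
    have zW: "(\<lambda>z. z powi k / W z) \<in> bfs \<rho>w" for k by (rule Wbfs(1)[OF pw])
    fix i j
    have "Y.finite_rank (\<lambda>f z. (1 / of_nat (n + 1)) * fourier_coeff (G f) (int i - int j) * (z powi (int i - int j - int m) / W z))"
      by (rule Gco[OF zW])
    then show "Y.finite_rank (\<lambda>f z. (fourier_coeff (G f) (int i - int j) / of_nat (n + 1)) * (z powi (int i - int j - int m) / W z))"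
      by simp
  next
    fix k
    have zW: "(\<lambda>z. z powi k / W z) \<in> bfs \<rho>w" for k by (rule Wbfs(1)[OF pw])
    show "Y.finite_rank (\<lambda>f z. (\<delta> (int k) * fourier_coeff (G f) (int k)) * (z powi (int k - int m) / W z))"
      by (rule Gco[OF zW])
  next
    fix k
    have b: "(\<lambda>z. z powi (int k - int m)) \<in> bfs \<rho>w"
      using Y.bfs_powi_mult[OF Y.bfs_bounded[of "\<lambda>_. 1" 1], of "int k - int m"] by simp
    have hf: "(\<lambda>z. h z * f z) \<in> bfs \<rho>w" "bnorm \<rho>w (\<lambda>z. h z * f z) \<le> (A + e) * bnorm \<rho>w f" if "f \<in> hardy \<rho>w" for f
      using Y.hardy_bfs[OF Y.hardy_bounded_mult[OF h hb' that]] Y.bnorm_mult_le[OF hm Y.hardy_bfs[OF that] hb'] by auto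
    show "Y.finite_rank (\<lambda>f z. (- fourier_coeff (\<lambda>z. h z * f z) (int k)) * z powi (int k - int m))"
    proof (rule Y.finite_rank_rank_one[where C = "C2 * (A + e)", OF _ _ _ _ b])
      fix f g assume f: "f \<in> hardy \<rho>w" and g: "g \<in> hardy \<rho>w"
      show "- fourier_coeff (\<lambda>z. h z * (f z + g z)) (int k)
          = - fourier_coeff (\<lambda>z. h z * f z) (int k) + - fourier_coeff (\<lambda>z. h z * g z) (int k)"
        by (simp add: distrib_left fourier_coeff_add Y.bfs_integrable hf f g)
    next
      fix s f
      show "- fourier_coeff (\<lambda>z. h z * (s * f z)) (int k) = s * - fourier_coeff (\<lambda>z. h z * f z) (int k)"
        using fourier_coeff_cmult[of s "\<lambda>z. h z * f z" "int k"] by (simp add: mult.left_commute)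
    next
      show "0 \<le> C2 * (A + e)" using C2(1) hb'(2) by simp
      fix f assume f: "f \<in> hardy \<rho>w"
      have "cmod (fourier_coeff (\<lambda>z. h z * f z) (int k)) \<le> C2 * bnorm \<rho>w (\<lambda>z. h z * f z)" by (rule C2(2)[OF hf(1)[OF f]])
      also have "\<dots> \<le> C2 * ((A + e) * bnorm \<rho>w f)" using C2(1) hf(2)[OF f] by (intro mult_left_mono) auto
      finally show "cmod (- fourier_coeff (\<lambda>z. h z * f z) (int k)) \<le> C2 * (A + e) * bnorm \<rho>w f" by (simp add: mult.assoc)
    qed
  qed
  have KH: "K f \<in> hardy \<rho>w" if f: "f \<in> hardy \<rho>w" for f
  proof (rule Y.hardy_cong_AE[OF Y.hardy_diff[OF VH[OF f] S(1)[OF f]]])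
    show "K f \<in> borel_measurable circle" by (rule bfs_measurable[OF Y.finite_rank_bfs[OF fr f]])
    show "AE z in circle. V f z - S f z = K f z" using KV[of f] by eventually_elim simp
  qed
  have compact: "compact_operator (hardy \<rho>w) (bfs_norm \<rho>w) K"
    by (rule Y.finite_rank_compact_operator[OF fr KH])
  have "op_norm (hardy \<rho>w) (bfs_norm \<rho>w) (\<lambda>f z. toeplitz \<rho>w a f z - K f z) \<le> ennreal ((2 + e) * (A + e) + C * e)"
  proof (rule Y.op_norm_leI)
    show "0 \<le> (2 + e) * (A + e) + C * e" using e(1) C(1) hb'(2) by simp
    show "hardy \<rho>w \<subseteq> bfs \<rho>w" by (auto intro: Y.hardy_bfs)
    fix f assume f: "f \<in> hardy \<rho>w"
    have TH: "toeplitz \<rho>w a f \<in> hardy \<rho>w" by (rule Y.toeplitz_in_hardy[OF am ab A0 f])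
    show TK: "(\<lambda>z. toeplitz \<rho>w a f z - K f z) \<in> bfs \<rho>w" by (intro Y.bfs_diff Y.hardy_bfs TH KH f)
    have df: "(\<lambda>z. d z * f z) \<in> bfs \<rho>w" using e by (intro Y.bfs_mult_bounded[OF Y.hardy_bfs[OF f] dm d]) simp
    have "AE z in circle. toeplitz \<rho>w a f z
        = riesz_projection \<rho>w (\<lambda>z. z powi (- int m) * (h z * f z)) z + riesz_projection \<rho>w (\<lambda>z. d z * f z) z"
      using e(1) by (intro Y.toeplitz_split[OF am h hb' dm d _ eq f]) simp
    \<comment> \<open>What remains is \<open>S\<close> and the projected part of the small symbol
      \<open>d\<close>.\<close>
    then have "AE z in circle. toeplitz \<rho>w a f z - K f z = S f z + riesz_projection \<rho>w (\<lambda>z. d z * f z) z"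
      using VP[OF f] KV[of f] by eventually_elim simp
    then have "bnorm \<rho>w (\<lambda>z. toeplitz \<rho>w a f z - K f z) \<le> bnorm \<rho>w (S f) + bnorm \<rho>w (riesz_projection \<rho>w (\<lambda>z. d z * f z))"
      by (rule Y.bnorm_triangle_AE[OF Y.hardy_bfs[OF S(1)[OF f]] Y.hardy_bfs[OF Y.riesz_projection_hardy[OF df]] bfs_measurable[OF TK]])
    also have "\<dots> \<le> (2 + e) * ((A + e) * bnorm \<rho>w f) + C * (e * bnorm \<rho>w f)"
    proof (rule add_mono[OF S(2)[OF f]])
      have "bnorm \<rho>w (riesz_projection \<rho>w (\<lambda>z. d z * f z)) \<le> C * bnorm \<rho>w (\<lambda>z. d z * f z)" by (rule C(2)[OF df])
      also have "\<dots> \<le> C * (e * bnorm \<rho>w f)"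
        using C(1) e(1) Y.bnorm_mult_le[OF dm Y.hardy_bfs[OF f] d] by (intro mult_left_mono) auto
      finally show "bnorm \<rho>w (riesz_projection \<rho>w (\<lambda>z. d z * f z)) \<le> C * (e * bnorm \<rho>w f)" .
    qed
    finally show "bnorm \<rho>w (\<lambda>z. toeplitz \<rho>w a f z - K f z) \<le> ((2 + e) * (A + e) + C * e) * bnorm \<rho>w f"
      by (simp add: algebra_simps)
  qed
  also have "\<dots> \<le> ennreal (2 * A + \<epsilon>)" by (rule ennreal_leI[OF eb])
  also have "\<dots> = 2 * Linf_norm a + ennreal \<epsilon>"
    using A0 \<epsilon> by (simp add: A ennreal_mult)
  finally have "op_norm (hardy \<rho>w) (bfs_norm \<rho>w) (\<lambda>f z. toeplitz \<rho>w a f z - K f z) \<le> 2 * Linf_norm a + ennreal \<epsilon>" .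
  then show "ess_norm (hardy \<rho>w) (bfs_norm \<rho>w) (toeplitz \<rho>w a) \<le> 2 * Linf_norm a + ennreal \<epsilon>"
    unfolding ess_norm_def using compact by (intro INF_lower2[of K]) auto
qed

end

theorem theorem6p5:
  fixes \<rho> :: "(complex \<Rightarrow> ennreal) \<Rightarrow> ennreal"
    and w :: "complex \<Rightarrow> real" and a :: "complex \<Rightarrow> complex"
  assumes "banach_function_norm \<rho>"
    and "reflexive_space (bfs \<rho>) (bfs_norm \<rho>)"
    and "translation_invariant \<rho>"
    and "w \<in> borel_measurable circle"
    and "AE z in circle. 0 < w z"
    and "(\<lambda>z. complex_of_real (w z)) \<in> bfs \<rho>"
    and "(\<lambda>z. complex_of_real (1 / w z)) \<in> bfs (assoc_norm \<rho>)"
    and "riesz_bounded (weighted \<rho> w)"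
    and "a \<in> C_plus_Hinf"
  defines "H \<equiv> hardy (weighted \<rho> w)"
    and "N \<equiv> bfs_norm (weighted \<rho> w)"
    and "T \<equiv> toeplitz (weighted \<rho> w) a"
  shows "Linf_norm a = m_norm H N T \<and> m_norm H N T \<le> ess_norm H N T \<and>
         ess_norm H N T \<le> 2 * Linf_norm a"
proof -
  interpret toeplitz_setting \<rho> w
    using assms(1-8) by (intro toeplitz_setting.intro toeplitz_setting_axioms.intro)
  have "Linf_norm a = m_norm H N T"
    unfolding H_def N_def T_def
    by (rule antisym[OF Linf_norm_le_m_norm Y.m_norm_le_Linf_norm]) fact+
  \<comment> \<open>The middle inequality goes through the norm of \<open>a\<close>, which equals
    the first quantity and bounds the second from below.\<close>
  then show ?thesis
    using Linf_norm_le_ess_norm[OF assms(9)] ess_norm_le[OF assms(9)]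
    by (simp add: H_def N_def T_def)
qed

end
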